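(* Let $P\subset\mathbb{R}^2$ be a lattice polygon with precisely $g$ interior lattice points, and let $\Delta$ be a (not necessarily regular) unimodular triangulation of $P$ with skeleton $G$. Suppose $G$ is a graph with a heavy cycle $C$ with two loops, with cut edges $e_1$ and $e_2$. Then the heavy component $P'$ can have at most three interior lattice points, and these lie on the line spanned by the edge $[z,w]\in\Delta$, where $z$ is the interior lattice point dual to $C$, and $w$ is the intersection point of the split edges $s_1$ and $s_2$. In particular, $P'$ is hyperelliptic and $g\leq 5$.
   Context: A lattice polygon is the (two-dimensional) convex hull of finitely many points of $\mathbb{Z}^2$. A lattice polygon is hyperelliptic if all its interior lattice points lie on a common line. A unimodular triangulation of $P$ is a triangulation of $V=P\cap\mathbb{Z}^2$ (a subdivision of $P$ into triangles with vertices in $V$) all of whose triangles have Euclidean area $\tfrac12$. Dual graph and skeleton. The dual graph $\Gamma=\Gamma(\Delta)$ has the triangles of $\Delta$ as nodes; two triangles form an edge of $\Gamma$ if they share an edge in $\Delta$. The skeleton $G=G(\Delta)$ is obtained from $\Gamma$ as follows. First, repeatedly delete nodes of degree one together with the unique incident edge until none are left; the remaining edges of $\Gamma$ are called nonredundant. Second, repeatedly remove a node of degree two and join its two neighbors by an edge, until no nodes of degree two are left. The result is a connected trivalent planar graph (loops and multiple edges allowed) of genus $g$, embedded in the plane as induced by $\Delta$; the genus of a connected graph is its number of edges minus number of nodes plus one. Each node of $G$ is a node of $\Gamma$, i.e., a triangle of $\Delta$. Each edge of $G$ arises from an edge path in $\Gamma$; the contraction map $\eta$ is the resulting surjection from nonredundant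 edges of $\Gamma$ onto edges of $G$. The bounded regions of $G$ correspond bijectively to the interior lattice points of $P$; the interior lattice point dual to a cycle bounding a region is the one corresponding to that region. An edge of a connected graph is a cut edge if deleting it creates two connected components. Heavy cycle with two loops. A connected trivalent planar graph $G$ has a heavy cycle with two loops if it has a cycle $C$ (bounding a region) containing two distinct vertices $v_1,v_2$ joined by an edge of $C$, such that for $i=1,2$ the vertex $v_i$ is incident with a cut edge $e_i$ (not in $C$) whose other endpoint $u_i$ carries a loop; and the rest of $G$ is a subgraph $G_3$ of positive genus which shares at least one vertex with $C$ (and does not contain $v_1,v_2$), where, apart from the edge between $v_1$ and $v_2$, the cycle $C$ consists of an edge from $v_1$ to $G_3$, an edge from $v_2$ to $G_3$, and a (possibly trivial) path in $G_3$. Thus $G$ consists of the two loops, $e_1$, $e_2$, and the connected subgraph $G_3\cup C$. Splits and heavy component. A split of $V$ is a polytopal subdivision of $V$ with exactly two maximal cells; their common edge spans the split line. If $e$ is a cut edge of $G$, then $\eta^{-1}(e)$ contains a cut edge of $\Gamma$, dual to an edge $s$ of $\Delta$ whose endpoints lie on $\partial P$ and which spans the split line of a split of $V$. For $i=1,2$ pick such an edge $s_i$ (the split edge) for $e_i$, with split line $S_i$. The lines $S_1,S_2$ do not meet in the interior of $P$, so they decompose $P$ into three lattice polygons $P_1,P_2,P'$, where $P_i$ is the part containing the interior lattice point corresponding to the loop at $u_i$, and $P'$ is the part whose induced triangulation corresponds to $G_3\cup C$. The polygon $P'$ is called the heavy component of $P$. It is known that in this situation the triangles of $\Delta$ dual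 to $v_1$ and $v_2$ share an edge $[z,w]$, where $z$ is the interior lattice point of $P$ dual to $C$ and $w\in\partial P$ is the point where $S_1$ and $S_2$ (and $s_1$ and $s_2$) meet. *)

theory Defs
  imports "HOL-Analysis.Analysis"
begin

section \<open>Lattice polygons and unimodular triangulations\<close>

definition lattice_points :: "(real^2) set" where
  "lattice_points = {x. \<forall>i. x $ i \<in> \<int>}"

definition lattice_polygon :: "(real^2) set \<Rightarrow> bool" where
  "lattice_polygon P \<longleftrightarrow>
     (\<exists>A. finite A \<and> A \<subseteq> lattice_points \<and> P = convex hull A) \<and> aff_dim P = 2"

definition interior_lattice_points :: "(real^2) set \<Rightarrow> (real^2) set" where
  "interior_lattice_points P = interior P \<inter> lattice_points"

definition hyperelliptic :: "(real^2) set \<Rightarrow> bool" where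
  "hyperelliptic P \<longleftrightarrow> lattice_polygon P \<and>
     (\<exists>L. affine L \<and> aff_dim L = 1 \<and> interior_lattice_points P \<subseteq> L)"

text \<open>A triangulation is given by its set of triangles.  The library predicate
  \<open>triangulation\<close> provides that any two triangles meet in a common, possibly empty, face.\<close>

definition unimodular_triangulation :: "(real^2) set set \<Rightarrow> (real^2) set \<Rightarrow> bool" where
  "unimodular_triangulation \<Delta> P \<longleftrightarrow>
     triangulation \<Delta> \<and> \<Union>\<Delta> = P \<and>
     (\<forall>T\<in>\<Delta>. 2 simplex T \<and> {x. x extreme_point_of T} \<subseteq> P \<inter> lattice_points \<and> measure lborel T = 1/2)"

definition triangulation_edges :: "(real^2) set set \<Rightarrow> (real^2) set set" where
  "triangulation_edges \<Delta> = {s. \<exists>T\<in>\<Delta>. s edge_of T}"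


section \<open>Undirected multigraphs\<close>

text \<open>Each edge is mapped to its set of endpoints; a loop has exactly one endpoint.\<close>

record ('v, 'e) multigraph =
  nodes :: "'v set"
  edges :: "'e set"
  ends :: "'e \<Rightarrow> 'v set"

definition node_degree :: "('v, 'e) multigraph \<Rightarrow> 'v \<Rightarrow> nat" where
  "node_degree G v =
     card {e \<in> edges G. v \<in> ends G e} + card {e \<in> edges G. ends G e = {v}}"

definition trivalent :: "('v, 'e) multigraph \<Rightarrow> bool" where
  "trivalent G \<longleftrightarrow> (\<forall>v\<in>nodes G. node_degree G v = 3)"

definition reachability :: "('v, 'e) multigraph \<Rightarrow> 'v rel" where
  "reachability G = {(u, v). \<exists>e\<in>edges G. ends G e = {u, v}}\<^sup>* \<inter> (nodes G \<times> nodes G)"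

definition graph_components :: "('v, 'e) multigraph \<Rightarrow> 'v set set" where
  "graph_components G = nodes G // reachability G"

definition connected_graph :: "('v, 'e) multigraph \<Rightarrow> bool" where
  "connected_graph G \<longleftrightarrow> nodes G \<noteq> {} \<and> reachability G = nodes G \<times> nodes G"

definition graph_genus :: "('v, 'e) multigraph \<Rightarrow> int" where
  "graph_genus G = int (card (edges G)) - int (card (nodes G)) + 1"

definition delete_edge :: "('v, 'e) multigraph \<Rightarrow> 'e \<Rightarrow> ('v, 'e) multigraph" where
  "delete_edge G e = G\<lparr>edges := edges G - {e}\<rparr>"

definition delete_node :: "('v, 'e) multigraph \<Rightarrow> 'v \<Rightarrow> ('v, 'e) multigraph" where
  "delete_node G v =
     G\<lparr>nodes := nodes G - {v}, edges := {e \<in> edges G. v \<notin> ends G e}\<rparr>"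

definition cut_edge :: "('v, 'e) multigraph \<Rightarrow> 'e \<Rightarrow> bool" where
  "cut_edge G e \<longleftrightarrow>
     connected_graph G \<and> e \<in> edges G \<and> card (graph_components (delete_edge G e)) = 2"

text \<open>\<open>is_path G x vs es y\<close>: a path from \<open>x\<close> to \<open>y\<close> visiting the pairwise distinct nodes \<open>vs\<close>
  along the edges \<open>es\<close>; it is trivial if \<open>es = []\<close>.\<close>

definition is_path ::
    "('v, 'e) multigraph \<Rightarrow> 'v \<Rightarrow> 'v list \<Rightarrow> 'e list \<Rightarrow> 'v \<Rightarrow> bool" where
  "is_path G x vs es y \<longleftrightarrow>
     length vs = length es + 1 \<and> distinct vs \<and> set vs \<subseteq> nodes G \<and> hd vs = x \<and> last vs = y \<and>
     set es \<subseteq> edges G \<and> (\<forall>i<length es. ends G (es ! i) = {vs ! i, vs ! Suc i})"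


section \<open>Dual graph and skeleton\<close>

text \<open>An edge of the dual graph is represented by the edge of the triangulation shared by its
  two end triangles.\<close>

definition dual_graph :: "(real^2) set set \<Rightarrow> ((real^2) set, (real^2) set) multigraph" where
  "dual_graph \<Delta> =
     \<lparr>nodes = \<Delta>,
      edges = {s. \<exists>T\<in>\<Delta>. \<exists>T'\<in>\<Delta>. T \<noteq> T' \<and> s edge_of T \<and> s edge_of T'},
      ends = (\<lambda>s. {T\<in>\<Delta>. s edge_of T})\<rparr>"

definition prune_step :: "('v, 'e) multigraph \<Rightarrow> ('v, 'e) multigraph \<Rightarrow> bool" where
  "prune_step G G' \<longleftrightarrow> (\<exists>v\<in>nodes G. node_degree G v = 1 \<and> G' = delete_node G v)"

text \<open>In the second phase an edge is the set of all dual graph edges on the path that has been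
  contracted to it.  Hence, for the resulting skeleton \<open>G\<close>, the contraction map \<open>\<eta>\<close> sends a
  nonredundant edge \<open>s\<close> to the unique \<open>e \<in> edges G\<close> with \<open>s \<in> e\<close>, and \<open>e\<close> is itself
  the preimage of \<open>e\<close> under \<open>\<eta>\<close>.\<close>

definition singleton_edges :: "('v, 'e) multigraph \<Rightarrow> ('v, 'e set) multigraph" where
  "singleton_edges G =
     \<lparr>nodes = nodes G, edges = (\<lambda>s. {s}) ` edges G, ends = (\<lambda>e. \<Union>(ends G ` e))\<rparr>"

definition smooth_step :: "('v, 'e set) multigraph \<Rightarrow> ('v, 'e set) multigraph \<Rightarrow> bool" where
  "smooth_step G G' \<longleftrightarrow>
     (\<exists>v\<in>nodes G. \<exists>a\<in>edges G. \<exists>b\<in>edges G. \<exists>x y.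
        node_degree G v = 2 \<and> a \<noteq> b \<and> x \<noteq> v \<and> y \<noteq> v \<and>
        ends G a = {v, x} \<and> ends G b = {v, y} \<and>
        G' = \<lparr>nodes = nodes G - {v},
              edges = insert (a \<union> b) (edges G - {a, b}),
              ends = (ends G)(a \<union> b := {x, y})\<rparr>)"

definition skeleton ::
    "(real^2) set set \<Rightarrow> ((real^2) set, (real^2) set set) multigraph \<Rightarrow> bool" where
  "skeleton \<Delta> G \<longleftrightarrow>
     (\<exists>K. prune_step\<^sup>*\<^sup>* (dual_graph \<Delta>) K \<and> (\<forall>v\<in>nodes K. node_degree K v \<noteq> 1) \<and>
          smooth_step\<^sup>*\<^sup>* (singleton_edges K) G \<and> (\<forall>v\<in>nodes G. node_degree G v \<noteq> 2))"

text \<open>The triangles around an interior lattice point \<open>z\<close> form a cycle in the dual graph, whose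
  edges are the edges of the triangulation containing \<open>z\<close>.  The image of this cycle under
  \<open>\<eta>\<close> bounds the region of the skeleton corresponding to \<open>z\<close>.\<close>

definition region_boundary ::
    "((real^2) set, (real^2) set set) multigraph \<Rightarrow> real^2 \<Rightarrow> (real^2) set set set" where
  "region_boundary G z = {e \<in> edges G. \<exists>s\<in>e. z \<in> s}"

definition dual_point ::
    "(real^2) set \<Rightarrow> ((real^2) set, (real^2) set set) multigraph \<Rightarrow>
     (real^2) set set set \<Rightarrow> real^2 \<Rightarrow> bool" where
  "dual_point P G C z \<longleftrightarrow> z \<in> interior_lattice_points P \<and> C = region_boundary G z"


section \<open>Heavy cycles with two loops\<close>

text \<open>Cycles are given by their edge sets.  Here \<open>b\<close> is the edge of \<open>C\<close> joining \<open>v1\<close> and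
  \<open>v2\<close>, \<open>fi\<close> is the edge of \<open>C\<close> from \<open>vi\<close> to \<open>G3\<close>, and \<open>li\<close> is the loop at \<open>ui\<close>.
  That \<open>C\<close> bounds a region refers to the embedding and is expressed by \<open>dual_point\<close>.\<close>

definition heavy_cycle_with_two_loops ::
    "('v, 'e) multigraph \<Rightarrow> 'e set \<Rightarrow> 'e \<Rightarrow> 'e \<Rightarrow> ('v, 'e) multigraph \<Rightarrow> bool" where
  "heavy_cycle_with_two_loops G C e1 e2 G3 \<longleftrightarrow>
     connected_graph G \<and> trivalent G \<and>
     (\<exists>v1 v2 u1 u2 l1 l2 b f1 f2 x1 x2 vs es.
        distinct [v1, v2, u1, u2] \<and> {v1, v2, u1, u2} \<subseteq> nodes G \<and>
        distinct [b, f1, f2, e1, e2, l1, l2] \<and> {b, f1, f2, e1, e2, l1, l2} \<subseteq> edges G \<and>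
        cut_edge G e1 \<and> ends G e1 = {v1, u1} \<and> ends G l1 = {u1} \<and>
        cut_edge G e2 \<and> ends G e2 = {v2, u2} \<and> ends G l2 = {u2} \<and>
        G3 = G\<lparr>nodes := nodes G - {v1, v2, u1, u2},
               edges := edges G - {b, f1, f2, e1, e2, l1, l2}\<rparr> \<and>
        connected_graph G3 \<and> graph_genus G3 > 0 \<and>
        ends G b = {v1, v2} \<and> ends G f1 = {v1, x1} \<and> ends G f2 = {v2, x2} \<and>
        is_path G3 x1 vs es x2 \<and> C = {b, f1, f2} \<union> set es)"


section \<open>Splits and the heavy component\<close>

definition polytopal_split :: "(real^2) set \<Rightarrow> (real^2) set \<Rightarrow> (real^2) set \<Rightarrow> bool" where
  "polytopal_split V X Y \<longleftrightarrow>
     (\<exists>A\<subseteq>V. X = convex hull A) \<and> (\<exists>B\<subseteq>V. Y = convex hull B) \<and>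
     aff_dim X = 2 \<and> aff_dim Y = 2 \<and> X \<union> Y = convex hull V \<and>
     (X \<inter> Y) edge_of X \<and> (X \<inter> Y) edge_of Y"

definition split_line :: "(real^2) set \<Rightarrow> (real^2) set \<Rightarrow> bool" where
  "split_line V S \<longleftrightarrow> (\<exists>X Y. polytopal_split V X Y \<and> S = affine hull (X \<inter> Y))"

definition split_edge ::
    "(real^2) set \<Rightarrow> (real^2) set set \<Rightarrow> (real^2) set set \<Rightarrow> (real^2) set \<Rightarrow> bool" where
  "split_edge P \<Delta> e s \<longleftrightarrow>
     s \<in> e \<and> cut_edge (dual_graph \<Delta>) s \<and> {x. x extreme_point_of s} \<subseteq> frontier P \<and>
     split_line (P \<inter> lattice_points) (affine hull s)"

text \<open>The lines \<open>S1\<close> and \<open>S2\<close> cut \<open>P\<close> into the polygons \<open>closure ` components (P - (S1 \<union> S2))\<close>;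
  the heavy component is the one whose triangles include, among the nodes of \<open>G\<close>, precisely those of
  \<open>G3 \<union> C\<close>.\<close>

definition heavy_component ::
    "(real^2) set \<Rightarrow> ((real^2) set, 'e) multigraph \<Rightarrow> ((real^2) set, 'e) multigraph \<Rightarrow>
     'e set \<Rightarrow> (real^2) set \<Rightarrow> (real^2) set \<Rightarrow> (real^2) set \<Rightarrow> bool" where
  "heavy_component P G G3 C S1 S2 P' \<longleftrightarrow>
     P' \<in> closure ` components (P - (S1 \<union> S2)) \<and>
     {T \<in> nodes G. T \<subseteq> P'} = nodes G3 \<union> \<Union>(ends G ` C)"

end

theory Submission
  imports Defs
begin

text \<open>
  The triangles around an interior lattice point form a cycle of the dual graph.  Such a cycle passes
  through a node carrying a loop either along the whole loop or not at all, so the edges of \<open>\<Delta>\<close> dual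
  to \<open>e1\<close> and \<open>e2\<close> have their endpoints on \<open>\<partial>P\<close>: they are chords of \<open>P\<close>, and beyond each of
  them lies exactly one interior lattice point.  Hence \<open>v1\<close> is a triangle \<open>[z, p, q]\<close> where \<open>p, q\<close> are
  boundary points and \<open>p + q - z\<close> is the unique interior lattice point beyond the chord \<open>[p, q]\<close>.
  By convexity all lattice points of \<open>P\<close> lie in the cone at \<open>z\<close> spanned by \<open>p\<close> and \<open>q\<close> or in the
  opposite cone, since otherwise \<open>p\<close> or \<open>q\<close> would be interior.  The same holds for \<open>v2\<close>.  As \<open>G3\<close> has
  positive genus, there is an interior lattice point outside both cones; this forces \<open>v1\<close> and \<open>v2\<close>
  to share a vertex \<open>w\<close> and all such points to lie on the ray from \<open>z\<close> opposite to \<open>w\<close>.  If the third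
  point after \<open>z\<close> on this ray were interior, a vertex of \<open>P\<close> beyond \<open>[p, w]\<close> would produce a
  second interior lattice point beyond that chord.
\<close>

section \<open>Contraction of degree-two nodes\<close>

text \<open>No drawing of the skeleton is used. \<open>G\<close> results from an arbitrary order of
  prunings and contractions, so all that is kept about it is an invariant: its edges are classes
  partitioning the nonredundant edges of \<Gamma>, and a property of these edges that cannot change
  at a contracted node is constant on each class. Two such properties link the graph to the plane:
  to contain a given interior lattice point, and, on classes without the chord in question, to reach
  beyond that chord, which is the sign of a determinant. The convexity arguments all use one device:
  in lattice coordinates at \<open>z\<close>, a lattice point known not to be interior is written as
  a convex combination of points of \<open>P\<close> with positive weight on interior ones. The
  weights solve linear equations in the coordinates. The bound 3 counts \<open>z\<close>,
  \<open>z - (w - z)\<close> and \<open>z - 2 (w - z)\<close>; the bound 5 adds one point beyond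
  each chord.\<close>

definition incident :: "('v, 'e) multigraph \<Rightarrow> 'v \<Rightarrow> 'e set" where
  "incident K v = {s \<in> edges K. v \<in> ends K s}"

text \<open>\<open>linked K W e\<close> expresses that \<open>e\<close> is connected through the nodes in \<open>W\<close>: a property of
  edges that cannot change at these nodes is constant on \<open>e\<close>.\<close>

definition linked :: "('v, 'e) multigraph \<Rightarrow> 'v set \<Rightarrow> 'e set \<Rightarrow> bool" where
  "linked K W e \<longleftrightarrow>
     (\<forall>Q. (\<forall>v\<in>W. incident K v \<subseteq> e \<longrightarrow>
           (\<forall>s\<in>incident K v. \<forall>t\<in>incident K v. Q s \<longrightarrow> Q t)) \<longrightarrow>
        (\<forall>s\<in>e. \<forall>t\<in>e. Q s \<longrightarrow> Q t))"

lemma linkedD: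
  assumes "linked K W e"
    and "\<And>v s t. v \<in> W \<Longrightarrow> incident K v \<subseteq> e \<Longrightarrow> s \<in> incident K v \<Longrightarrow> t \<in> incident K v \<Longrightarrow> Q s \<Longrightarrow> Q t"
    and "s \<in> e" "t \<in> e" "Q s"
  shows "Q t"
  using assms(1)[unfolded linked_def, rule_format, of Q s t] assms(2-5) by metis

text \<open>Invariant of the second phase, phrased so that the order of contractions does not
  matter. The count 2 at a loop records that both ends of the contracted path arrive at the same
  node. That a contracted node has its two edges in a single class makes it possible to walk along
  the class.\<close>

definition smoothing :: "('v, 'e) multigraph \<Rightarrow> ('v, 'e set) multigraph \<Rightarrow> bool" where
  "smoothing K H \<longleftrightarrow>
     nodes H \<subseteq> nodes K \<and> \<Union>(edges H) = edges K \<and> disjoint (edges H) \<and> {} \<notin> edges H \<and>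
     (\<forall>e\<in>edges H. ends H e \<noteq> {} \<and> ends H e \<subseteq> nodes H) \<and>
     (\<forall>v\<in>nodes H. \<forall>e\<in>edges H. card (incident K v \<inter> e) =
        (if ends H e = {v} then 2 else if v \<in> ends H e then 1 else 0)) \<and>
     (\<forall>v\<in>nodes K - nodes H. card (incident K v) = 2 \<and> (\<exists>e\<in>edges H. incident K v \<subseteq> e)) \<and>
     (\<forall>e\<in>edges H. linked K (nodes K - nodes H) e)"

lemma smoothing_singleton_edges:
  assumes "\<And>s. s \<in> edges K \<Longrightarrow> ends K s \<noteq> {} \<and> ends K s \<subseteq> nodes K"
    and "\<And>s v. s \<in> edges K \<Longrightarrow> ends K s \<noteq> {v}"
  shows "smoothing K (singleton_edges K)"
proof -
  have c: "card (incident K v \<inter> {s}) = (if v \<in> ends K s then 1 else 0)" if "s \<in> edges K" for v s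
  proof (cases "v \<in> ends K s")
    case True
    then have "incident K v \<inter> {s} = {s}" using that by (auto simp: incident_def)
    then show ?thesis using True by simp
  next
    case False
    then have "incident K v \<inter> {s} = {}" by (auto simp: incident_def)
    then show ?thesis using False by simp
  qed
  show ?thesis
    unfolding smoothing_def singleton_edges_def
    using assms by (auto simp: disjoint_def linked_def c)
qed

text \<open>A node of degree two with two distinct non-loop edges \<open>a\<close>, \<open>b\<close>
  carries no further edge, so its edges in \<open>K\<close> are one member of \<open>a\<close> and
  one of \<open>b\<close>. It thus becomes a contracted node with both edges in
  \<open>a \<union> b\<close>, and all other classes stay as they were.\<close>

lemma smoothing_smooth_step:
  assumes H: "smoothing K H" and fin: "finite (edges K)" and step: "smooth_step H H'"
  shows "smoothing K H'"
proof -
  have nd: "nodes H \<subseteq> nodes K" and un: "\<Union>(edges H) = edges K" and dj: "disjoint (edges H)"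
    and ne: "{} \<notin> edges H"
    and en: "\<And>e. e \<in> edges H \<Longrightarrow> ends H e \<noteq> {} \<and> ends H e \<subseteq> nodes H"
    and cd: "\<And>v e. v \<in> nodes H \<Longrightarrow> e \<in> edges H \<Longrightarrow> card (incident K v \<inter> e) =
        (if ends H e = {v} then 2 else if v \<in> ends H e then 1 else 0)"
    and rm: "\<And>v. v \<in> nodes K - nodes H \<Longrightarrow> card (incident K v) = 2 \<and> (\<exists>e\<in>edges H. incident K v \<subseteq> e)"
    and cn: "\<And>e. e \<in> edges H \<Longrightarrow> linked K (nodes K - nodes H) e"
    using H unfolding smoothing_def by simp_all
  obtain v a b x y where v: "v \<in> nodes H" and a: "a \<in> edges H" and b: "b \<in> edges H"
    and deg: "node_degree H v = 2" and ab: "a \<noteq> b" and xv: "x \<noteq> v" and yv: "y \<noteq> v"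
    and ea: "ends H a = {v, x}" and eb: "ends H b = {v, y}"
    and H': "H' = \<lparr>nodes = nodes H - {v}, edges = insert (a \<union> b) (edges H - {a, b}),
              ends = (ends H)(a \<union> b := {x, y})\<rparr>"
    using step unfolding smooth_step_def by blast
  have finH: "finite (edges H)" using fin un by (metis finite_UnionD)
  have fine: "finite e" if "e \<in> edges H" for e using that fin un by (metis Sup_upper finite_subset)
  have at_v: "{e \<in> edges H. v \<in> ends H e} = {a, b}"
  proof -
    have "{a, b} \<subseteq> {e \<in> edges H. v \<in> ends H e}" using a b ea eb by auto
    moreover have "card {e \<in> edges H. v \<in> ends H e} \<le> card {a, b}"
      using deg ab by (simp add: node_degree_def)
    ultimately show ?thesis
      using card_seteq[of "{e \<in> edges H. v \<in> ends H e}" "{a, b}"] finH by simp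
  qed
  have dab: "a \<inter> b = {}" using dj a b ab by (auto simp: disjoint_def)
  have new: "e \<noteq> a \<union> b" if "e \<in> edges H" for e
  proof
    assume e: "e = a \<union> b"
    then have "e \<inter> a \<noteq> {}" "e \<inter> b \<noteq> {}" using ne a b by auto
    then show False using dj a b that ab unfolding disjoint_def by metis
  qed
  have inc_v: "incident K v \<subseteq> a \<union> b"
  proof
    fix s assume s: "s \<in> incident K v"
    then obtain e where e: "e \<in> edges H" "s \<in> e" using un by (auto simp: incident_def)
    then have "card (incident K v \<inter> e) \<noteq> 0" using s fine by auto
    then have "v \<in> ends H e" using cd[OF v e(1)] by (auto split: if_splits)
    then show "s \<in> a \<union> b" using at_v e by auto
  qed
  have one: "card (incident K v \<inter> a) = 1" "card (incident K v \<inter> b) = 1"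
    using cd[OF v a] cd[OF v b] ea eb xv yv by auto
  show ?thesis
    unfolding smoothing_def
  proof (intro conjI ballI allI impI)
    show "nodes H' \<subseteq> nodes K" using nd H' by auto
    show "\<Union> (edges H') = edges K" using un H' a b by auto
    have "e \<inter> (a \<union> b) = {}" if "e \<in> edges H - {a, b}" for e
      using dj a b that unfolding disjoint_def by blast
    then show "disjoint (edges H')"
      using dj unfolding H' disjoint_def by (auto simp: Int_commute)
    show "{} \<notin> edges H'" using ne a H' by auto
  next
    fix e assume e: "e \<in> edges H'"
    show "ends H' e \<noteq> {}" using e en H' by auto
    show "ends H' e \<subseteq> nodes H'"
    proof (cases "e = a \<union> b")
      case True
      then show ?thesis using en[OF a] en[OF b] ea eb xv yv H' by auto
    next
      case False
      then have "e \<in> edges H - {a, b}" using e H' by auto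
      then have "v \<notin> ends H e" using at_v by auto
      then show ?thesis using en \<open>e \<in> edges H - {a, b}\<close> False H' by auto
    qed
  next
    fix w e assume w: "w \<in> nodes H'" and e: "e \<in> edges H'"
    have wH: "w \<in> nodes H" "w \<noteq> v" using w H' by auto
    show "card (incident K w \<inter> e) = (if ends H' e = {w} then 2 else if w \<in> ends H' e then 1 else 0)"
    proof (cases "e = a \<union> b")
      case True
      have "incident K w \<inter> e = (incident K w \<inter> a) \<union> (incident K w \<inter> b)" using True by auto
      then have "card (incident K w \<inter> e) = card (incident K w \<inter> a) + card (incident K w \<inter> b)"
        using dab fine[OF a] fine[OF b] by (subst card_Un_disjoint[symmetric]) auto
      \<comment> \<open>If \<open>x = y\<close>, both summands are 1 at \<open>w = x\<close>: this
        is how a loop arises, with the required count 2.\<close>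
      also have "\<dots> = (if w = x then 1 else 0) + (if w = y then 1 else 0)"
        using cd[OF wH(1) a] cd[OF wH(1) b] ea eb wH(2) xv yv by (auto split: if_splits)
      finally show ?thesis using True H' by auto
    next
      case False
      then show ?thesis using cd[OF wH(1)] e H' by auto
    qed
  next
    fix w assume w: "w \<in> nodes K - nodes H'"
    show "card (incident K w) = 2"
    proof (cases "w = v")
      case True
      have "incident K v = (incident K v \<inter> a) \<union> (incident K v \<inter> b)" using inc_v by auto
      then have "card (incident K v) = card (incident K v \<inter> a) + card (incident K v \<inter> b)"
        using dab fine[OF a] fine[OF b] by (subst card_Un_disjoint[symmetric]) auto
      then show ?thesis using one True by simp
    next
      case False
      then show ?thesis using rm w H' by auto
    qed
    show "\<exists>e\<in>edges H'. incident K w \<subseteq> e"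
    proof (cases "w = v")
      case True
      then show ?thesis using inc_v H' by auto
    next
      case False
      then have "\<exists>e\<in>edges H. incident K w \<subseteq> e" using rm w H' by auto
      then obtain e where e: "e \<in> edges H" "incident K w \<subseteq> e" by auto
      show ?thesis
      proof (cases "e \<in> {a, b}")
        case True
        then show ?thesis using e(2) H' by auto
      next
        case False
        then show ?thesis using e H' by auto
      qed
    qed
  next
    fix e assume e: "e \<in> edges H'"
    show "linked K (nodes K - nodes H') e"
      unfolding linked_def
    proof (intro allI impI ballI)
      fix Q s t
      assume Q: "\<forall>v\<in>nodes K - nodes H'. incident K v \<subseteq> e \<longrightarrow>
             (\<forall>s\<in>incident K v. \<forall>t\<in>incident K v. Q s \<longrightarrow> Q t)"
        and st: "s \<in> e" "t \<in> e" "Q s"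
      have old: "Q t'" if "e' \<in> edges H" "e' \<subseteq> e" "s' \<in> e'" "t' \<in> e'" "Q s'" for e' s' t'
      proof (rule linkedD[where Q = Q, OF cn[OF that(1)] _ that(3-5)])
        fix w s t
        assume "w \<in> nodes K - nodes H" "incident K w \<subseteq> e'" "s \<in> incident K w" "t \<in> incident K w" "Q s"
        then show "Q t" using Q that(2) H' by auto
      qed
      show "Q t"
      proof (cases "e = a \<union> b")
        case True
        \<comment> \<open>\<open>v\<close> has one edge in each old class, so \<open>Q\<close>
          crosses from \<open>a\<close> to \<open>b\<close> there.\<close>
        obtain sa sb where sab: "sa \<in> incident K v" "sa \<in> a" "sb \<in> incident K v" "sb \<in> b"
          using one by (metis IntE card_1_singletonE insertI1)
        have "v \<in> nodes K - nodes H'" using v nd H' by auto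
        then have "Q sa \<longleftrightarrow> Q sb" using Q sab inc_v True by blast
        moreover have "Q s' \<longleftrightarrow> Q sa" if "s' \<in> a" for s' using old[of a] that sab a True by blast
        moreover have "Q s' \<longleftrightarrow> Q sb" if "s' \<in> b" for s' using old[of b] that sab b True by blast
        ultimately show ?thesis using st True by blast
      next
        case False
        then have "e \<in> edges H" using e H' by auto
        then show ?thesis using old[of e s t] st by blast
      qed
    qed
  qed
qed

lemma smoothing_rtranclp:
  assumes "smooth_step\<^sup>*\<^sup>* (singleton_edges K) H" "finite (edges K)"
    and "\<And>s. s \<in> edges K \<Longrightarrow> ends K s \<noteq> {} \<and> ends K s \<subseteq> nodes K"
    and "\<And>s v. s \<in> edges K \<Longrightarrow> ends K s \<noteq> {v}"
  shows "smoothing K H"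
  using assms(1)
proof (induction rule: rtranclp_induct)
  case base
  then show ?case using assms(3,4) by (rule smoothing_singleton_edges)
next
  case (step H H')
  then show ?case using assms(2) smoothing_smooth_step by blast
qed

text \<open>Non-membership spreads: a set that is closed under all edges but \<open>e\<close> and
  misses \<open>v\<close> also misses \<open>x\<close>, \<open>v'\<close>, \<open>u'\<close> and,
  \<open>H\<close> being connected, all of \<open>H\<close>. Only \<open>u\<close> remains.
  \<open>F\<close> will be the set of skeleton nodes beyond the chord taken from
  \<open>e\<close>.\<close>

lemma heavy_lobe:
  assumes conn: "connected_graph H" and sub: "edges H \<subseteq> edges G" "e \<notin> edges H" "ends H = ends G"
    and nd: "nodes H = nodes G - {v, v', u, u'}" "x \<in> nodes H"
    and f: "f \<in> edges G" "f \<noteq> e" "ends G f = {v, x}"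
    and b: "b \<in> edges G" "b \<noteq> e" "ends G b = {v, v'}"
    and dd: "d \<in> edges G" "d \<noteq> e" "ends G d = {v', u'}"
    and F: "F \<subseteq> nodes G" "v \<notin> F"
      "\<And>e'. e' \<in> edges G \<Longrightarrow> e' \<noteq> e \<Longrightarrow> ends G e' \<inter> F \<noteq> {} \<Longrightarrow> ends G e' \<subseteq> F"
  shows "F \<subseteq> {u}"
proof -
  have x: "x \<notin> F" using F(2) F(3)[OF f(1,2)] f(3) by auto
  have v': "v' \<notin> F" using F(2) F(3)[OF b(1,2)] b(3) by auto
  have u': "u' \<notin> F" using v' F(3)[OF dd(1,2)] dd(3) by auto
  have "w \<notin> F" if "(x, w) \<in> {(u, v). \<exists>e\<in>edges H. ends H e = {u, v}}\<^sup>*" for w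
    using that
  proof (induction rule: rtrancl_induct)
    case base
    show ?case by (rule x)
  next
    case (step w w')
    then obtain c where c: "c \<in> edges H" "ends H c = {w, w'}" by auto
    then have "ends G c \<inter> F \<noteq> {} \<Longrightarrow> ends G c \<subseteq> F" using F(3)[of c] sub by auto
    then show ?case using step.IH c(2) sub(3) by auto
  qed
  moreover have "(x, w) \<in> {(u, v). \<exists>e\<in>edges H. ends H e = {u, v}}\<^sup>*" if "w \<in> nodes H" for w
    using conn that nd(2) unfolding connected_graph_def reachability_def by auto
  ultimately have "w \<notin> F" if "w \<in> nodes H" for w using that by blast
  then show ?thesis using F(1,2) v' u' nd(1) by blast
qed

section \<open>Lattice triangles in the plane\<close>

text \<open>Twice the signed area of the triangle \<open>a\<close>, \<open>b\<close>,
  \<open>x\<close>. Its sign tells on which side of the line through \<open>a\<close> and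
  \<open>b\<close> the point \<open>x\<close> lies; it is affine in \<open>x\<close>, integral at
  lattice points, and 1 or -1 for unimodular triangles.\<close>

definition side :: "real^2 \<Rightarrow> real^2 \<Rightarrow> real^2 \<Rightarrow> real" where
  "side a b x = (b $ 1 - a $ 1) * (x $ 2 - a $ 2) - (b $ 2 - a $ 2) * (x $ 1 - a $ 1)"

lemma side_self [simp]: "side a b a = 0" "side a b b = 0" "side a a x = 0"
  by (auto simp: side_def)

lemma side_swap: "side b a x = - side a b x"
  by (simp add: side_def algebra_simps)

lemma side_rotate: "side b c a = side a b c"
  by (simp add: side_def algebra_simps)

lemma side_sum: "side b c x + side c a x + side a b x = side a b c"
  by (simp add: side_def algebra_simps)

lemma side_convex_comb: "u + v = 1 \<Longrightarrow> side a b (u *\<^sub>R x + v *\<^sub>R y) = u * side a b x + v * side a b y"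
  unfolding side_def vector_add_component vector_scaleR_component real_scaleR_def
  by algebra

lemma side_lattice:
  assumes "a \<in> lattice_points" "b \<in> lattice_points" "x \<in> lattice_points"
  shows "side a b x \<in> \<int>"
  using assms by (auto simp: side_def lattice_points_def)

lemma barycentric:
  assumes "side a b c \<noteq> 0"
  shows "x = (side b c x / side a b c) *\<^sub>R a + (side c a x / side a b c) *\<^sub>R b + (side a b x / side a b c) *\<^sub>R c"
proof -
  have "side a b c * x $ i = side b c x * a $ i + side c a x * b $ i + side a b x * c $ i" for i
    using exhaust_2[of i] by (auto simp: side_def algebra_simps)
  then show ?thesis using assms by (simp add: vec_eq_iff field_simps)
qed

lemma mem_triangle_iff:
  assumes D: "side a b c \<noteq> 0"
  shows "x \<in> convex hull {a, b, c} \<longleftrightarrow>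
    0 \<le> side b c x / side a b c \<and> 0 \<le> side c a x / side a b c \<and> 0 \<le> side a b x / side a b c"
proof
  assume "x \<in> convex hull {a, b, c}"
  then obtain u v w where uvw: "0 \<le> u" "0 \<le> v" "0 \<le> w" "u + v + w = 1"
    and x: "x = u *\<^sub>R a + v *\<^sub>R b + w *\<^sub>R c" unfolding convex_hull_3 by auto
  have w: "w = 1 - u - v" using uvw by simp
  have "side b c x = u * side a b c" "side c a x = v * side a b c" "side a b x = w * side a b c"
    unfolding x w by (simp_all add: side_def algebra_simps)
  then show "0 \<le> side b c x / side a b c \<and> 0 \<le> side c a x / side a b c \<and> 0 \<le> side a b x / side a b c"
    using D uvw by simp
next
  assume "0 \<le> side b c x / side a b c \<and> 0 \<le> side c a x / side a b c \<and> 0 \<le> side a b x / side a b c"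
  moreover have "side b c x / side a b c + side c a x / side a b c + side a b x / side a b c = 1"
    using D side_sum[of b c x a] by (simp add: add_divide_distrib[symmetric])
  ultimately show "x \<in> convex hull {a, b, c}"
    unfolding convex_hull_3 using barycentric[OF D, of x] by blast
qed

text \<open>Barycentric coordinates are quotients by a unit, hence integers at lattice points;
  nonnegative integers with sum 1 single out a vertex.\<close>

lemma lattice_points_triangle:
  assumes D: "\<bar>side a b c\<bar> = 1" and "{a, b, c} \<subseteq> lattice_points"
  shows "convex hull {a, b, c} \<inter> lattice_points = {a, b, c}"
proof
  show "convex hull {a, b, c} \<inter> lattice_points \<subseteq> {a, b, c}"
  proof
    fix x assume x: "x \<in> convex hull {a, b, c} \<inter> lattice_points"
    define i j k where "i = side b c x / side a b c" "j = side c a x / side a b c" "k = side a b x / side a b c"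
    have D': "side a b c = 1 \<or> side a b c = -1" using D by linarith
    have "i \<in> \<int>" "j \<in> \<int>" "k \<in> \<int>"
      using D' side_lattice x assms(2) unfolding i_j_k_def by auto
    moreover have "0 \<le> i" "0 \<le> j" "0 \<le> k"
      using x mem_triangle_iff[of a b c x] D' unfolding i_j_k_def by auto
    moreover have "i + j + k = 1"
      unfolding i_j_k_def using D' side_sum[of b c x a] by (auto simp: add_divide_distrib[symmetric])
    ultimately have "i = 1 \<and> j = 0 \<and> k = 0 \<or> i = 0 \<and> j = 1 \<and> k = 0 \<or> i = 0 \<and> j = 0 \<and> k = 1"
      by (auto elim!: Ints_cases)
    moreover have "x = i *\<^sub>R a + j *\<^sub>R b + k *\<^sub>R c"
      unfolding i_j_k_def by (rule barycentric) (use D' in auto)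
    ultimately show "x \<in> {a, b, c}" by auto
  qed
  show "{a, b, c} \<subseteq> convex hull {a, b, c} \<inter> lattice_points"
    using assms(2) hull_subset[of "{a, b, c}" convex] by blast
qed

section \<open>Convex combinations with interior points, lines and half-planes\<close>

lemma interior_convex_comb:
  fixes P :: "'a::euclidean_space set"
  assumes "convex P" "x \<in> interior P" "y \<in> P" "0 < u" "0 \<le> v" "u + v = 1"
  shows "u *\<^sub>R x + v *\<^sub>R y \<in> interior P"
proof -
  have "y - u *\<^sub>R (y - x) \<in> interior P"
    using assms by (intro mem_interior_convex_shrink) auto
  moreover have "y - u *\<^sub>R (y - x) = u *\<^sub>R x + v *\<^sub>R y"
    unfolding eq_diff_eq[THEN iffD2, OF assms(6)] by (simp add: algebra_simps)
  ultimately show ?thesis by simp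
qed

text \<open>To refute a configuration, a point known not to be interior is written in this form.
  \<open>v < 1\<close> puts some weight on the interior points, either of which may have weight
  0.\<close>

lemma interior_convex_comb3:
  fixes P :: "'a::euclidean_space set"
  assumes "convex P" "x \<in> interior P" "x' \<in> interior P" "y \<in> P"
    and "0 \<le> u" "0 \<le> u'" "0 \<le> v" "u + u' + v = 1" "v < 1"
  shows "u *\<^sub>R x + u' *\<^sub>R x' + v *\<^sub>R y \<in> interior P"
proof -
  have p: "u + u' > 0" using assms by linarith
  have "(u / (u + u')) *\<^sub>R x + (u' / (u + u')) *\<^sub>R x' \<in> interior P"
    using convexD[of "interior P" x x', OF _ assms(2,3), of "u / (u + u')" "u' / (u + u')"] assms p
    by (simp add: convex_interior add_divide_distrib[symmetric])
  then have "(u + u') *\<^sub>R ((u / (u + u')) *\<^sub>R x + (u' / (u + u')) *\<^sub>R x') + v *\<^sub>R y \<in> interior P"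
    by (rule interior_convex_comb[OF assms(1) _ assms(4) p]) (use assms in auto)
  then show ?thesis using p by (simp add: scaleR_add_right)
qed

lemma side_segment_zero:
  assumes "x \<in> closed_segment a b" shows "side a b x = 0"
proof -
  obtain u where "x = (1 - u) *\<^sub>R a + u *\<^sub>R b" using assms unfolding closed_segment_def by auto
  then show ?thesis by (simp add: side_convex_comb)
qed

lemma side_zero_line:
  assumes "side a b x = 0" "a \<noteq> b"
  obtains t where "x = (1 - t) *\<^sub>R a + t *\<^sub>R b"
proof -
  have D: "b $ 1 \<noteq> a $ 1 \<or> b $ 2 \<noteq> a $ 2" using assms(2) by (auto simp: vec_eq_iff forall_2)
  show thesis
  proof (cases "b $ 1 = a $ 1")
    case False
    have "x = (1 - (x $ 1 - a $ 1) / (b $ 1 - a $ 1)) *\<^sub>R a + ((x $ 1 - a $ 1) / (b $ 1 - a $ 1)) *\<^sub>R b"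
      using False assms(1)
      by (simp add: vec_eq_iff forall_2 side_def divide_simps) (simp add: algebra_simps)
    then show thesis by (rule that)
  next
    case True
    then have b2: "b $ 2 \<noteq> a $ 2" using D by auto
    have "x = (1 - (x $ 2 - a $ 2) / (b $ 2 - a $ 2)) *\<^sub>R a + ((x $ 2 - a $ 2) / (b $ 2 - a $ 2)) *\<^sub>R b"
      using b2 True assms(1)
      by (simp add: vec_eq_iff forall_2 side_def divide_simps) (simp add: algebra_simps)
    then show thesis by (rule that)
  qed
qed

lemma affine_hull_segment_side:
  assumes "a \<noteq> b" shows "affine hull (closed_segment a b) = {x. side a b x = 0}"
proof -
  have "affine hull (closed_segment a b) = affine hull {a, b}"
    by (simp add: segment_convex_hull)
  also have "\<dots> = {x. side a b x = 0}"
  proof (intro equalityI subsetI)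
    fix x assume "x \<in> affine hull {a, b}"
    then obtain u v where "x = u *\<^sub>R a + v *\<^sub>R b" "u + v = 1" unfolding affine_hull_2 by auto
    then show "x \<in> {x. side a b x = 0}" by (simp add: side_convex_comb)
  next
    fix x assume "x \<in> {x. side a b x = 0}"
    then obtain t where "x = (1 - t) *\<^sub>R a + t *\<^sub>R b" using side_zero_line[OF _ assms] by auto
    moreover have "1 - t + t = 1" by simp
    ultimately show "x \<in> affine hull {a, b}" unfolding affine_hull_2 by blast
  qed
  finally show ?thesis .
qed

lemma open_segmentI:
  fixes a b :: "'a::real_vector"
  assumes "0 < t" "t < 1" "a \<noteq> b"
  shows "(1 - t) *\<^sub>R a + t *\<^sub>R b \<in> open_segment a b"
  using assms by (auto simp: in_segment)

lemma side_crossing: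
  assumes "side a b x > 0" "side a b y < 0"
  obtains w where "w \<in> open_segment x y" "side a b w = 0"
proof -
  define t where "t = side a b x / (side a b x - side a b y)"
  have t: "0 < t" "t < 1" using assms by (auto simp: t_def)
  have "t * (side a b x - side a b y) = side a b x" using assms by (simp add: t_def)
  then have "(1 - t) * side a b x + t * side a b y = 0" by (simp add: algebra_simps)
  then have "side a b ((1 - t) *\<^sub>R x + t *\<^sub>R y) = 0"
    using side_convex_comb[of "1 - t" t a b x y] by simp
  moreover have "x \<noteq> y" using assms by auto
  ultimately show thesis using that open_segmentI[OF t] by blast
qed

lemma convex_side_less: "convex {x. side p q x < 0}"
proof (rule convexI)
  fix x y :: "real^2" and u v :: real
  assume "x \<in> {x. side p q x < 0}" "y \<in> {x. side p q x < 0}" "0 \<le> u" "0 \<le> v" "u + v = 1"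
  then show "u *\<^sub>R x + v *\<^sub>R y \<in> {x. side p q x < 0}"
    using convex_bound_lt[of "side p q x" 0 "side p q y" u v] by (simp add: side_convex_comb)
qed

text \<open>A connected set that avoids a line stays on one side of it. \<open>z\<close> is only
  required in the closure because the heavy component is the closure of a component; strict
  negativity at \<open>z\<close> is an open condition and so passes to some point of
  \<open>C0\<close>.\<close>

lemma half_plane_component:
  fixes P :: "(real^2) set"
  assumes P: "convex P" and C0: "C0 \<in> components (P - ({x. side a b x = 0} \<union> {x. side c d x = 0}))"
    and z: "z \<in> closure C0" "side a b z < 0" "side c d z < 0"
  shows "C0 = P \<inter> {x. side a b x < 0} \<inter> {x. side c d x < 0}" (is "C0 = ?M")
proof -
  have cont: "continuous_on UNIV (side p q)" for p q
    unfolding side_def by (intro continuous_intros)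
  have op: "open {x. side p q x < 0}" "open {x. side p q x > 0}" for p q
    using open_Collect_less[OF cont continuous_on_const] open_Collect_less[OF continuous_on_const cont] by auto
  have "open ({x. side a b x < 0} \<inter> {x. side c d x < 0})" using op by blast
  then have "({x. side a b x < 0} \<inter> {x. side c d x < 0}) \<inter> C0 \<noteq> {}"
    using z open_Int_closure_eq_empty by blast
  then obtain y where y: "y \<in> C0" "side a b y < 0" "side c d y < 0" by blast
  have sub: "C0 \<subseteq> P - ({x. side a b x = 0} \<union> {x. side c d x = 0})" using in_components_subset[OF C0] .
  have neg: "side p q x < 0" if x: "x \<in> C0" and pq: "side p q y < 0" "\<And>x. x \<in> C0 \<Longrightarrow> side p q x \<noteq> 0" for p q x
  proof (rule ccontr)
    assume "\<not> side p q x < 0"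
    then have "{x. side p q x > 0} \<inter> C0 \<noteq> {}" using x pq(2)[OF x] by force
    moreover have "{x. side p q x < 0} \<inter> C0 \<noteq> {}" using y(1) pq(1) by blast
    moreover have "C0 \<subseteq> {x. side p q x < 0} \<union> {x. side p q x > 0}" using pq(2) by force
    moreover have "{x. side p q x < 0} \<inter> {x. side p q x > 0} \<inter> C0 = {}" by force
    ultimately show False using connectedD[OF in_components_connected[OF C0] op(1)[of p q] op(2)[of p q]] by blast
  qed
  have "C0 \<subseteq> ?M"
  proof
    fix x assume x: "x \<in> C0"
    have "side a b x < 0" by (rule neg[OF x y(2)]) (use sub in blast)
    moreover have "side c d x < 0" by (rule neg[OF x y(3)]) (use sub in blast)
    ultimately show "x \<in> ?M" using x sub by blast
  qed
  moreover have "?M \<subseteq> C0"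
  proof (rule components_maximal[OF C0])
    show "connected ?M" by (intro convex_connected convex_Int P convex_side_less)
    show "?M \<subseteq> P - ({x. side a b x = 0} \<union> {x. side c d x = 0})" by force
    show "C0 \<inter> ?M \<noteq> {}" using y sub by blast
  qed
  ultimately show ?thesis by blast
qed

lemma segment_subset_triangle: "closed_segment a b \<subseteq> convex hull {a, b, c}"
  unfolding segment_convex_hull by (intro hull_mono) auto

lemma side_collinear:
  assumes "a \<noteq> b" "side a b p = 0" "side a b q = 0" "side a b r = 0"
  shows "side p q r = 0"
proof -
  obtain s where p: "p = (1 - s) *\<^sub>R a + s *\<^sub>R b" using side_zero_line assms(1,2) by metis
  obtain t where q: "q = (1 - t) *\<^sub>R a + t *\<^sub>R b" using side_zero_line assms(1,3) by metis
  obtain u where r: "r = (1 - u) *\<^sub>R a + u *\<^sub>R b" using side_zero_line assms(1,4) by metis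
  show ?thesis unfolding p q r by (simp add: side_def algebra_simps)
qed

section \<open>Triangles cut off by boundary points\<close>

text \<open>Coordinates \<open>(i, j)\<close> with origin \<open>z\<close> and basis
  \<open>p - z\<close>, \<open>q - z\<close>. When \<open>z\<close>, \<open>p\<close>,
  \<open>q\<close> span a unimodular triangle, the lattice points are the integer pairs; the line
  through \<open>p\<close> and \<open>q\<close> is \<open>i + j = 1\<close>, and
  \<open>p + q - z\<close> is \<open>(1, 1)\<close>.\<close>

definition lattice_comb :: "real^2 \<Rightarrow> real^2 \<Rightarrow> real^2 \<Rightarrow> real \<Rightarrow> real \<Rightarrow> real^2" where
  "lattice_comb z p q i j = z + i *\<^sub>R (p - z) + j *\<^sub>R (q - z)"

lemma lattice_comb_swap: "lattice_comb z p q i j = lattice_comb z q p j i"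
  by (simp add: lattice_comb_def)

lemma lattice_comb_nth: "lattice_comb z p q i j $ k = z $ k + i * (p $ k - z $ k) + j * (q $ k - z $ k)"
  by (simp add: lattice_comb_def)

lemma side_lattice_comb:
  "side z p (lattice_comb z p q i j) = j * side z p q"
  "side q z (lattice_comb z p q i j) = i * side z p q"
  "side p q (lattice_comb z p q i j) = (1 - i - j) * side z p q"
  by (simp_all add: side_def lattice_comb_nth algebra_simps)

lemma lattice_comb_inject:
  assumes "side z p q \<noteq> 0" "lattice_comb z p q i j = lattice_comb z p q i' j'"
  shows "i = i'" "j = j'"
  using assms(1) arg_cong[OF assms(2), of "side z p"] arg_cong[OF assms(2), of "side q z"]
  by (simp_all add: side_lattice_comb)

lemma lattice_comb_obtain:
  assumes "\<bar>side z p q\<bar> = 1" "{z, p, q, x} \<subseteq> lattice_points"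
  obtains i j :: int where "x = lattice_comb z p q i j"
proof -
  define D where "D = side z p q"
  have D: "D = 1 \<or> D = -1" using assms(1) by (auto simp: D_def abs_if split: if_splits)
  have "side q z x / D \<in> \<int>" "side z p x / D \<in> \<int>"
    using D side_lattice[of q z x] side_lattice[of z p x] assms(2) by auto
  then obtain i j where ij: "side q z x / D = of_int i" "side z p x / D = of_int j" by (metis Ints_cases)
  have "x = (side p q x / D) *\<^sub>R z + (side q z x / D) *\<^sub>R p + (side z p x / D) *\<^sub>R q"
    unfolding D_def by (rule barycentric) (use assms(1) in auto)
  moreover have "side p q x / D = 1 - side q z x / D - side z p x / D"
    using side_sum[of p q x z] side_rotate[of z p q] D by (auto simp: D_def)
  ultimately have "x = lattice_comb z p q i j"
    unfolding ij(1,2) by (simp add: lattice_comb_def algebra_simps)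
  then show thesis by (rule that)
qed

definition in_cone :: "real^2 \<Rightarrow> real^2 \<Rightarrow> real^2 \<Rightarrow> real^2 \<Rightarrow> bool" where
  "in_cone z p q x \<longleftrightarrow> (\<exists>i j. 0 \<le> i \<and> 0 \<le> j \<and> x = lattice_comb z p q i j)"

lemma in_coneI: "0 \<le> i \<Longrightarrow> 0 \<le> j \<Longrightarrow> in_cone z p q (lattice_comb z p q i j)"
  unfolding in_cone_def by blast

lemma in_cone_commute: "in_cone z p q x \<longleftrightarrow> in_cone z q p x"
  unfolding in_cone_def using lattice_comb_swap by metis

text \<open>Lying beyond \<open>[p, q]\<close> means \<open>i + j \<ge> 2\<close> for
  \<open>y\<close>. If \<open>j \<le> 0\<close>, then \<open>p\<close> is a convex combination of
  \<open>z\<close>, \<open>y\<close>, \<open>q\<close> and would be interior; likewise for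
  \<open>i\<close> and \<open>q\<close>. So \<open>i, j \<ge> 1\<close>, and \<open>(1, 1)\<close>
  lies between \<open>y\<close> and a point of \<open>[p, q]\<close>.\<close>

lemma interior_apex:
  assumes P: "convex P" "z \<in> interior P" "p \<in> P" "q \<in> P" "p \<notin> interior P" "q \<notin> interior P"
    and D: "\<bar>side z p q\<bar> = 1" "{z, p, q} \<subseteq> lattice_points"
    and y: "y \<in> interior P" "y \<in> lattice_points" "side p q y / side p q z < 0"
  shows "p + q - z \<in> interior P"
proof -
  obtain i j :: int where ij: "y = lattice_comb z p q i j"
    using lattice_comb_obtain[OF D(1), of y] D(2) y(2) by auto
  have "side p q z = side z p q" by (simp add: side_rotate)
  then have "1 - real_of_int i - real_of_int j < 0"
    using y(3) D(1) unfolding ij side_lattice_comb by auto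
  then have s: "i + j \<ge> 2" by linarith
  have pos: "j \<ge> 1" if "p \<in> P" "q \<in> P" "p \<notin> interior P" "y = lattice_comb z p q i j" "i + j \<ge> 2"
    for p q and i j :: int
  proof (rule ccontr)
    assume j: "\<not> j \<ge> 1"
    define ri rj where "ri = real_of_int i" "rj = real_of_int j"
    have r: "ri \<ge> 2 - rj" "rj \<le> 0" "ri > 0" using j that(5) by (auto simp: ri_rj_def)
    \<comment> \<open>In coordinates \<open>(1, 0) = (1 / i) (i, j) + (- j / i) (0, 1)\<close>; the
      remaining weight goes to \<open>z\<close>.\<close>
    have "((ri + rj - 1) / ri) *\<^sub>R z + (1 / ri) *\<^sub>R y + (- rj / ri) *\<^sub>R q \<in> interior P"
      by (intro interior_convex_comb3 P y that) (use r in \<open>auto simp: divide_simps\<close>)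
    moreover have "((ri + rj - 1) / ri) *\<^sub>R z + (1 / ri) *\<^sub>R y + (- rj / ri) *\<^sub>R q = p"
      unfolding that(4) ri_rj_def[symmetric] using r
      by (simp add: vec_eq_iff lattice_comb_nth divide_simps) (simp add: algebra_simps)
    ultimately show False using that by simp
  qed
  have "j \<ge> 1" using pos[OF P(3,4,5) ij s] .
  moreover have "i \<ge> 1" using pos[OF P(4,3,6), of j i] ij s lattice_comb_swap by (metis add.commute)
  ultimately have ge: "i \<ge> 1" "j \<ge> 1" by auto
  define ri rj where "ri = real_of_int i" "rj = real_of_int j"
  have r: "ri \<ge> 1" "rj \<ge> 1" using ge by (auto simp: ri_rj_def)
  show ?thesis
  proof (cases "i + j = 2")
    case True
    then have "i = 1" "j = 1" using ge by auto
    then show ?thesis using y ij by (simp add: lattice_comb_def algebra_simps)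
  next
    case False
    then have r3: "ri + rj - 2 > 0" using s by (simp add: ri_rj_def)
    \<comment> \<open>The line from \<open>y\<close> through \<open>(1, 1)\<close> meets
      \<open>[p, q]\<close> in this point.\<close>
    have c: "((rj - 1) / (ri + rj - 2)) *\<^sub>R p + ((ri - 1) / (ri + rj - 2)) *\<^sub>R q \<in> P"
      by (intro convexD P) (use r r3 in \<open>auto simp: divide_simps\<close>)
    have "(1 / (ri + rj - 1)) *\<^sub>R y + ((ri + rj - 2) / (ri + rj - 1)) *\<^sub>R
        (((rj - 1) / (ri + rj - 2)) *\<^sub>R p + ((ri - 1) / (ri + rj - 2)) *\<^sub>R q) \<in> interior P"
      by (intro interior_convex_comb P y c) (use r r3 in \<open>auto simp: divide_simps\<close>)
    moreover have "(1 / (ri + rj - 1)) *\<^sub>R y + ((ri + rj - 2) / (ri + rj - 1)) *\<^sub>R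
        (((rj - 1) / (ri + rj - 2)) *\<^sub>R p + ((ri - 1) / (ri + rj - 2)) *\<^sub>R q) = p + q - z"
      unfolding ij ri_rj_def[symmetric] using r r3
      by (simp add: vec_eq_iff lattice_comb_nth divide_simps) (simp add: algebra_simps)
    ultimately show ?thesis by simp
  qed
qed

text \<open>The local picture at \<open>v1\<close> and at \<open>v2\<close>: a unimodular triangle
  at \<open>z\<close> whose other two vertices are on the boundary, such that the reflection of
  \<open>z\<close> in the midpoint of their edge is interior again.\<close>

definition cap :: "(real^2) set \<Rightarrow> real^2 \<Rightarrow> real^2 \<Rightarrow> real^2 \<Rightarrow> bool" where
  "cap P z p q \<longleftrightarrow> convex P \<and> {z, p, q} \<subseteq> lattice_points \<and> \<bar>side z p q\<bar> = 1 \<and> z \<in> interior P \<and>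
     p \<in> P \<and> q \<in> P \<and> p \<notin> interior P \<and> q \<notin> interior P \<and> p + q - z \<in> interior P"

lemma cap_commute: "cap P z p q \<longleftrightarrow> cap P z q p"
proof -
  have "side z q p = - side z p q" by (simp add: side_def algebra_simps)
  then show ?thesis unfolding cap_def by (auto simp: add.commute)
qed

text \<open>If \<open>i < 0 < j\<close>, then \<open>q = (0, 1)\<close> is a convex combination of
  \<open>z\<close>, the interior point \<open>(1, 1)\<close> and \<open>r\<close>, with positive
  weight on \<open>(1, 1)\<close>, so \<open>q\<close> would be interior. Exchanging
  \<open>p\<close> and \<open>q\<close> excludes the other mixed quadrant.\<close>

lemma cap_quadrants:
  assumes cap: "cap P z p q" and r: "r \<in> P" "r = lattice_comb z p q (of_int i) (of_int j)"
  shows "0 \<le> i \<and> 0 \<le> j \<or> i \<le> 0 \<and> j \<le> 0"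
proof -
  have no: False if cap: "cap P z p q" and r: "r \<in> P" "r = lattice_comb z p q (of_int i) (of_int j)" and "i < 0" "j > 0"
    for p q i j
  proof -
    define ri rj where "ri = real_of_int i" "rj = real_of_int j"
    have s: "ri \<le> -1" "rj \<ge> 1" using that(4,5) by (auto simp: ri_rj_def)
    have "((rj - 1) / (rj - ri)) *\<^sub>R z + (- ri / (rj - ri)) *\<^sub>R (p + q - z) + (1 / (rj - ri)) *\<^sub>R r \<in> interior P"
      using cap r(1) s unfolding cap_def by (intro interior_convex_comb3) (auto simp: divide_simps)
    moreover have "((rj - 1) / (rj - ri)) *\<^sub>R z + (- ri / (rj - ri)) *\<^sub>R (p + q - z) + (1 / (rj - ri)) *\<^sub>R r = q"
      unfolding r(2) ri_rj_def[symmetric] using s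
      by (simp add: vec_eq_iff lattice_comb_nth divide_simps) (simp add: algebra_simps)
    ultimately show False using cap by (simp add: cap_def)
  qed
  show ?thesis
  proof (rule ccontr)
    assume "\<not> ?thesis"
    then consider "i < 0" "j > 0" | "j < 0" "i > 0" by linarith
    then show False
    proof cases
      case 1
      then show False by (rule no[OF cap r])
    next
      case 2
      have "r = lattice_comb z q p (of_int j) (of_int i)" using r(2) lattice_comb_swap by simp
      then show False using 2 by (rule no[OF cap_commute[THEN iffD1, OF cap] r(1)])
    qed
  qed
qed

text \<open>\<open>q\<close> is \<open>(0, 1)\<close> on this axis, and a point of \<open>P\<close>
  farther out would make it interior because \<open>z\<close> is.\<close>

lemma cap_axis:
  assumes cap: "cap P z p q" and r: "r \<in> P" "r = lattice_comb z p q 0 j"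
  shows "j \<le> 1" and "r \<in> interior P \<Longrightarrow> j < 1"
proof -
  show j: "j \<le> 1"
  proof (rule ccontr)
    assume j: "\<not> j \<le> 1"
    have "(1 - 1 / j) *\<^sub>R z + (1 / j) *\<^sub>R r \<in> interior P"
      using cap r(1) j unfolding cap_def by (intro interior_convex_comb) (auto simp: divide_simps)
    moreover have "(1 - 1 / j) *\<^sub>R z + (1 / j) *\<^sub>R r = q"
      unfolding r(2) using j
      by (simp add: vec_eq_iff lattice_comb_nth divide_simps) (simp add: algebra_simps)
    ultimately show False using cap by (simp add: cap_def)
  qed
  assume "r \<in> interior P"
  then have "j \<noteq> 1" using cap r by (auto simp: cap_def lattice_comb_def)
  then show "j < 1" using j by linarith
qed

lemma cap_lattice_point:
  assumes cap: "cap P z p q" and r: "r \<in> P" "r \<in> lattice_points"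
  obtains i j :: int where "r = lattice_comb z p q i j" "0 \<le> i \<and> 0 \<le> j \<or> i \<le> 0 \<and> j \<le> 0"
proof -
  obtain i j :: int where "r = lattice_comb z p q i j"
    using lattice_comb_obtain[of z p q r] cap r(2) unfolding cap_def by auto
  then show thesis using that cap_quadrants[OF cap r(1)] by blast
qed

text \<open>The equation says \<open>i + j = 2\<close>. The quadrants leave \<open>(2, 0)\<close>,
  \<open>(1, 1)\<close> and \<open>(0, 2)\<close>, and \<open>cap_axis\<close> excludes the outer
  two. This identifies the third vertex of the triangle across the chord.\<close>

lemma cap_apex:
  assumes cap: "cap P z p q" and c: "c \<in> P" "c \<in> lattice_points" "side p q c = - side p q z"
  shows "c = p + q - z"
proof -
  obtain i j :: int where ij: "c = lattice_comb z p q i j" "0 \<le> i \<and> 0 \<le> j \<or> i \<le> 0 \<and> j \<le> 0"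
    using cap_lattice_point[OF cap c(1,2)] .
  have "side p q z = side z p q" by (simp add: side_rotate)
  then have "(1 - real_of_int i - real_of_int j) * side z p q = - side z p q"
    using c(3) unfolding ij(1) side_lattice_comb by simp
  then have "(2 - real_of_int i - real_of_int j) * side z p q = 0" by (simp add: algebra_simps)
  moreover have "side z p q \<noteq> 0" using cap by (auto simp: cap_def)
  ultimately have "2 - real_of_int i - real_of_int j = 0" by simp
  then have s: "i + j = 2" by linarith
  have "i \<noteq> 0"
  proof
    assume "i = 0"
    then show False using cap_axis(1)[OF cap c(1), of j] ij s by simp
  qed
  moreover have "j \<noteq> 0"
  proof
    assume "j = 0"
    then show False
      using cap_axis(1)[OF cap_commute[THEN iffD1, OF cap] c(1), of i] ij s lattice_comb_swap[of z p q] by simp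
  qed
  ultimately have "i = 1" "j = 1" using s ij(2) by auto
  then show ?thesis using ij(1) by (simp add: lattice_comb_def algebra_simps)
qed

text \<open>The lattice points of the cone with \<open>i + j \<le> 1\<close> are \<open>z\<close>,
  \<open>p\<close> and \<open>q\<close>, and of these only \<open>z\<close> is interior.\<close>

lemma cap_in_cone_beyond:
  assumes cap: "cap P z p q" and y: "y \<in> interior P" "y \<in> lattice_points" "y \<noteq> z" "in_cone z p q y"
  shows "side p q y / side p q z < 0"
proof -
  have yP: "y \<in> P" using y interior_subset by blast
  have nz: "side z p q \<noteq> 0" using cap by (auto simp: cap_def)
  obtain i j :: int where ij: "y = lattice_comb z p q i j"
    using cap_lattice_point[OF cap yP y(2)] .
  obtain i' j' where "0 \<le> i'" "0 \<le> j'" "y = lattice_comb z p q i' j'"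
    using y(4) unfolding in_cone_def by auto
  then have ge: "0 \<le> i" "0 \<le> j" using lattice_comb_inject[OF nz, of i j i' j'] ij by auto
  have "\<not> (i = 0 \<and> j \<le> 1)"
    using cap_axis(2)[OF cap yP, of j] ij y ge by (auto simp: lattice_comb_def)
  moreover have "\<not> (j = 0 \<and> i \<le> 1)"
    using cap_axis(2)[OF cap_commute[THEN iffD1, OF cap] yP, of i] ij y ge lattice_comb_swap[of z p q]
    by (auto simp: lattice_comb_def)
  ultimately have "1 - real_of_int i - real_of_int j < 0" using ge by linarith
  moreover have "side p q z = side z p q" by (simp add: side_rotate)
  ultimately show ?thesis unfolding ij side_lattice_comb using nz by simp
qed

text \<open>Without a common vertex, \<open>p1\<close> and \<open>q1\<close> lie outside the second
  cone, hence in its opposite. As \<open>y\<close> is outside the first cone, it lies in the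
  opposite of the first cone, and reflecting twice puts it into the second cone.\<close>

lemma caps_share_vertex:
  assumes cap1: "cap P z p1 q1" and cap2: "cap P z p2 q2"
    and p1: "in_cone z p2 q2 p1 \<Longrightarrow> p1 \<in> {p2, q2}" and q1: "in_cone z p2 q2 q1 \<Longrightarrow> q1 \<in> {p2, q2}"
    and y: "y \<in> P" "y \<in> lattice_points" "\<not> in_cone z p1 q1 y" "\<not> in_cone z p2 q2 y"
  shows "{p1, q1} \<inter> {p2, q2} \<noteq> {}"
proof (rule ccontr)
  assume n: "\<not> ?thesis"
  have neg: "\<exists>s t. s \<ge> 0 \<and> t \<ge> 0 \<and> r = lattice_comb z p q (- s) (- t)"
    if R: "cap P z p q" "r \<in> P" "r \<in> lattice_points" "\<not> in_cone z p q r" for p q r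
  proof -
    obtain i j :: int where ij: "r = lattice_comb z p q i j" "0 \<le> i \<and> 0 \<le> j \<or> i \<le> 0 \<and> j \<le> 0"
      using cap_lattice_point[OF R(1-3)] .
    have "\<not> (0 \<le> i \<and> 0 \<le> j)" using R(4) ij(1) in_coneI[of i j z p q] by auto
    then have "real_of_int (- i) \<ge> 0 \<and> real_of_int (- j) \<ge> 0 \<and> r = lattice_comb z p q (- real_of_int (- i)) (- real_of_int (- j))"
      using ij by auto
    then show ?thesis by blast
  qed
  have P: "p1 \<in> P" "p1 \<in> lattice_points" "q1 \<in> P" "q1 \<in> lattice_points" using cap1 by (auto simp: cap_def)
  obtain s t where st: "s \<ge> 0" "t \<ge> 0" "p1 = lattice_comb z p2 q2 (- s) (- t)"
    using neg[OF cap2 P(1,2)] p1 n by blast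
  obtain s' t' where st': "s' \<ge> 0" "t' \<ge> 0" "q1 = lattice_comb z p2 q2 (- s') (- t')"
    using neg[OF cap2 P(3,4)] q1 n by blast
  obtain i j where ij: "i \<ge> 0" "j \<ge> 0" "y = lattice_comb z p1 q1 (- i) (- j)"
    using neg[OF cap1 y(1-3)] by blast
  have "y = lattice_comb z p2 q2 (i * s + j * s') (i * t + j * t')"
    unfolding ij(3) st(3) st'(3) by (simp add: vec_eq_iff lattice_comb_nth algebra_simps)
  then have "in_cone z p2 q2 y" unfolding in_cone_def using ij st st' by (intro exI conjI) auto
  then show False using y by simp
qed

text \<open>Both unimodular triangles have the edge \<open>[z, w]\<close>, so the first coordinate
  of \<open>q\<close> is a unit; it is -1 because \<open>q\<close> is outside the first
  cone.\<close>

lemma adjacent_caps: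
  assumes cap1: "cap P z p w" and cap2: "cap P z q w" and pq: "p \<noteq> q"
    and q: "in_cone z p w q \<Longrightarrow> q \<in> {p, w}"
  obtains k where "k \<ge> 0" "q = lattice_comb z p w (-1) (- k)"
proof -
  have Q: "q \<in> P" "q \<in> lattice_points" using cap2 by (auto simp: cap_def)
  obtain i j :: int where ij: "q = lattice_comb z p w i j" "0 \<le> i \<and> 0 \<le> j \<or> i \<le> 0 \<and> j \<le> 0"
    using cap_lattice_point[OF cap1 Q] .
  have "q \<noteq> w" using cap2 by (auto simp: cap_def)
  then have "\<not> in_cone z p w q" using q pq by auto
  then have "\<not> (0 \<le> i \<and> 0 \<le> j)" using ij(1) in_coneI[of i j z p w] by auto
  then have le: "i \<le> 0" "j \<le> 0" using ij(2) by auto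
  have "side w z q = side z q w" by (simp add: side_def algebra_simps)
  then have "\<bar>real_of_int i * side z p w\<bar> = 1"
    using cap2 side_lattice_comb(2)[of w z p i j] ij(1) by (simp add: cap_def)
  then have "\<bar>real_of_int i\<bar> = 1" using cap1 by (simp add: cap_def abs_mult)
  then have "i = -1" using le by linarith
  then show thesis using that[of "- j"] ij(1) le by simp
qed

text \<open>\<open>y\<close> lies in both opposite cones. Since \<open>q\<close> has first
  coordinate -1, the coordinate of \<open>y\<close> along \<open>p - z\<close> is the negative of
  the one along \<open>q - z\<close>; both are at most 0, so both vanish.\<close>

lemma adjacent_caps_axis:
  assumes cap1: "cap P z p w" and cap2: "cap P z q w" and k: "k \<ge> 0" "q = lattice_comb z p w (-1) (- k)"
    and y: "y \<in> P" "y \<in> lattice_points" "\<not> in_cone z p w y" "\<not> in_cone z q w y"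
  obtains m :: nat where "y = z - real m *\<^sub>R (w - z)"
proof -
  obtain i j :: int where ij: "y = lattice_comb z p w i j" "0 \<le> i \<and> 0 \<le> j \<or> i \<le> 0 \<and> j \<le> 0"
    using cap_lattice_point[OF cap1 y(1,2)] .
  obtain i' j' :: int where ij': "y = lattice_comb z q w i' j'" "0 \<le> i' \<and> 0 \<le> j' \<or> i' \<le> 0 \<and> j' \<le> 0"
    using cap_lattice_point[OF cap2 y(1,2)] .
  have "\<not> (0 \<le> i \<and> 0 \<le> j)" using y(3) ij(1) in_coneI[of i j z p w] by auto
  then have le: "i \<le> 0" "j \<le> 0" using ij(2) by auto
  have "\<not> (0 \<le> i' \<and> 0 \<le> j')" using y(4) ij'(1) in_coneI[of i' j' z q w] by auto
  then have le': "i' \<le> 0" using ij'(2) by auto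
  have "y = lattice_comb z p w (- real_of_int i') (real_of_int j' - k * real_of_int i')"
    unfolding ij'(1) k(2) by (simp add: vec_eq_iff lattice_comb_nth algebra_simps)
  moreover have "side z p w \<noteq> 0" using cap1 by (auto simp: cap_def)
  ultimately have "real_of_int i = - real_of_int i'" using lattice_comb_inject(1) ij(1) by metis
  then have "i = 0" using le le' by simp
  then have "y = z - real (nat (- j)) *\<^sub>R (w - z)"
    using ij(1) le by (simp add: lattice_comb_def)
  then show thesis by (rule that)
qed

lemma interior_extend:
  fixes y d :: "'a::real_normed_vector"
  assumes "y \<in> interior P"
  obtains t where "t > 0" "y + t *\<^sub>R d \<in> P"
proof -
  obtain e where e: "e > 0" "ball y e \<subseteq> P" using assms by (meson mem_interior)
  define n where "n = norm d + 1"
  have n: "n > 0" by (simp add: n_def add_nonneg_pos)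
  define t where "t = e / (2 * n)"
  have t: "t > 0" using e n by (simp add: t_def)
  have "t * n = e / 2" using n by (simp add: t_def)
  then have "t * norm d < e" using t e by (simp add: n_def algebra_simps)
  then have "y + t *\<^sub>R d \<in> ball y e" using t by (simp add: dist_norm)
  then show thesis using that t e by blast
qed

text \<open>As \<open>(1, 1)\<close> is interior, \<open>P\<close> has a lattice point
  \<open>r = (i, j)\<close> with \<open>i \<ge> 2\<close>. The boundary point
  \<open>p = (1, 0)\<close> must not fall into the hull of \<open>z\<close>, \<open>(0, -n)\<close>
  and \<open>r\<close>, which forces \<open>r\<close> upwards: \<open>j > n (i - 1)\<close>. The
  point \<open>(1, 2)\<close> must not become interior, which holds \<open>r\<close> down:
  \<open>j \<le> i + 1\<close>. For \<open>n \<ge> 3\<close> the two bounds contradict each other.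
  The hypothesis on \<open>(1, 2)\<close> will come from the uniqueness of the interior lattice
  point beyond the chord.\<close>

lemma cap_axis_bound:
  assumes cap: "cap P z p w" and P: "lattice_polygon P"
    and out: "lattice_comb z p w 1 2 \<notin> interior P"
    and y: "z - real n *\<^sub>R (w - z) \<in> interior P"
  shows "n \<le> 2"
proof (rule ccontr)
  assume "\<not> n \<le> 2"
  then have n: "real n \<ge> 3" by simp
  have D: "\<bar>side z p w\<bar> = 1" and D0: "side z p w \<noteq> 0" using cap by (auto simp: cap_def)
  \<comment> \<open>\<open>f\<close> is the coordinate along \<open>p - z\<close>.\<close>
  define f where "f x = side w z x / side z p w" for x
  obtain A where A: "A \<subseteq> lattice_points" "P = convex hull A" using P by (auto simp: lattice_polygon_def)
  have fcomb: "f (u *\<^sub>R x + v *\<^sub>R x') = u * f x + v * f x'" if "u + v = 1" for u v x x'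
    unfolding f_def side_convex_comb[OF that] by (simp add: add_divide_distrib)
  \<comment> \<open>Otherwise \<open>P\<close> would lie in \<open>f \<le> 1\<close>, although its
    interior point \<open>p + w - z\<close> has \<open>f = 1\<close>.\<close>
  have "\<exists>r\<in>A. f r > 1"
  proof (rule ccontr)
    assume "\<not> ?thesis"
    then have "A \<subseteq> {x. f x \<le> 1}" by force
    moreover have "convex {x. f x \<le> 1}"
    proof (rule convexI)
      fix x x' :: "real^2" and u v :: real
      assume "x \<in> {x. f x \<le> 1}" "x' \<in> {x. f x \<le> 1}" "0 \<le> u" "0 \<le> v" "u + v = 1"
      then show "u *\<^sub>R x + v *\<^sub>R x' \<in> {x. f x \<le> 1}"
        using fcomb convex_bound_le[of "f x" 1 "f x'" u v] by simp
    qed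
    ultimately have sub: "P \<subseteq> {x. f x \<le> 1}" unfolding A(2) by (rule hull_minimal)
    obtain t where t: "t > 0" "(p + w - z) + t *\<^sub>R (p - z) \<in> P"
      using interior_extend[of "p + w - z" P "p - z"] cap unfolding cap_def by blast
    have "(p + w - z) + t *\<^sub>R (p - z) = lattice_comb z p w (1 + t) 1"
      by (simp add: lattice_comb_def algebra_simps)
    then have "f ((p + w - z) + t *\<^sub>R (p - z)) = 1 + t" using D0 by (simp add: f_def side_lattice_comb)
    then show False using sub t by auto
  qed
  then obtain r where rA: "r \<in> A" and fr: "f r > 1" by blast
  have rP: "r \<in> P" "r \<in> lattice_points" using rA A hull_subset[of A convex] by auto
  obtain i j :: int where ij: "r = lattice_comb z p w i j" "0 \<le> i \<and> 0 \<le> j \<or> i \<le> 0 \<and> j \<le> 0"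
    using cap_lattice_point[OF cap rP] .
  have "f r = i" using D0 by (simp add: f_def ij(1) side_lattice_comb)
  then have i2: "i \<ge> 2" "j \<ge> 0" using fr ij(2) by auto
  define ri rj where "ri = real_of_int i" "rj = real_of_int j"
  have r: "ri \<ge> 2" "rj \<ge> 0" using i2 by (auto simp: ri_rj_def)
  have rr: "r = lattice_comb z p w ri rj" using ij(1) by (simp add: ri_rj_def)
  have lower: "real n * ri < real n + rj"
  proof (rule ccontr)
    assume ge: "\<not> real n * ri < real n + rj"
    \<comment> \<open>In coordinates \<open>(1, 0) = (1 / i) (i, j) + (j / (n i)) (0, -n)\<close>;
      the weight left for \<open>z\<close> is nonnegative exactly when the claimed inequality
      fails.\<close>
    have "(1 - 1 / ri - rj / (n * ri)) *\<^sub>R z + (rj / (n * ri)) *\<^sub>R (z - real n *\<^sub>R (w - z)) + (1 / ri) *\<^sub>R r \<in> interior P"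
    proof (rule interior_convex_comb3)
      have "1 - 1 / ri - rj / (n * ri) = (real n * ri - real n - rj) / (n * ri)"
        using r n by (simp add: divide_simps) (simp add: algebra_simps)
      also have "\<dots> \<ge> 0" using r n ge by simp
      finally show "0 \<le> 1 - 1 / ri - rj / (n * ri)" .
    qed (use cap y rP(1) r n in \<open>auto simp: cap_def\<close>)
    moreover have "(1 - 1 / ri - rj / (n * ri)) *\<^sub>R z + (rj / (n * ri)) *\<^sub>R (z - real n *\<^sub>R (w - z)) + (1 / ri) *\<^sub>R r = p"
      unfolding rr using r n
      by (simp add: vec_eq_iff lattice_comb_nth divide_simps) (simp add: algebra_simps)
    ultimately show False using cap by (simp add: cap_def)
  qed
  have upper: "rj \<le> ri + 1"
  proof (rule ccontr)
    assume gt: "\<not> rj \<le> ri + 1"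
    \<comment> \<open>The segment from \<open>w = (0, 1)\<close> to \<open>r\<close> passes through
      \<open>(1, h)\<close>. If \<open>h > 2\<close>, then \<open>(1, 2)\<close> lies strictly
      between the interior point \<open>(1, 1)\<close> and \<open>(1, h)\<close>.\<close>
    define h where "h = (rj + ri - 1) / ri"
    have h: "h > 2" using gt r by (simp add: h_def divide_simps)
    have hp: "(1 / ri) *\<^sub>R r + (1 - 1 / ri) *\<^sub>R w \<in> P"
      using cap rP(1) r unfolding cap_def by (intro convexD) (auto simp: divide_simps)
    have h_eq: "(1 / ri) *\<^sub>R r + (1 - 1 / ri) *\<^sub>R w = lattice_comb z p w 1 h"
      unfolding rr h_def using r
      by (simp add: vec_eq_iff lattice_comb_nth divide_simps) (simp add: algebra_simps)
    have "((h - 2) / (h - 1)) *\<^sub>R (p + w - z) + (1 / (h - 1)) *\<^sub>R lattice_comb z p w 1 h \<in> interior P"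
      using cap hp h unfolding cap_def h_eq by (intro interior_convex_comb) (auto simp: divide_simps)
    moreover have "((h - 2) / (h - 1)) *\<^sub>R (p + w - z) + (1 / (h - 1)) *\<^sub>R lattice_comb z p w 1 h = lattice_comb z p w 1 2"
      using h by (simp add: vec_eq_iff lattice_comb_nth divide_simps) (simp add: algebra_simps)
    ultimately show False using out by simp
  qed
  \<comment> \<open>\<open>3 (i - 1) < i + 1\<close> means \<open>i < 2\<close>; with
    \<open>n = 2\<close> the same comparison would still allow \<open>i = 2\<close>.\<close>
  have "3 * (ri - 1) \<le> real n * (ri - 1)" using n r by (intro mult_right_mono) auto
  also have "\<dots> < ri + 1" using lower upper by (simp add: algebra_simps)
  finally have "2 * ri < 4" by simp
  then show False using r by simp
qed

section \<open>Unimodular triangulations and their chords\<close>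

locale unimodular_polygon =
  fixes P :: "(real^2) set" and \<Delta> :: "(real^2) set set"
  assumes polygon: "lattice_polygon P" and unimodular: "unimodular_triangulation \<Delta> P"
begin

abbreviation "L \<equiv> lattice_points"

abbreviation "\<Gamma> \<equiv> dual_graph \<Delta>"

lemma convex_P: "convex P"
  using polygon by (auto simp: lattice_polygon_def)

lemma compact_P: "compact P"
  using polygon by (auto simp: lattice_polygon_def finite_imp_compact_convex_hull)

lemma finite_\<Delta>: "finite \<Delta>"
  using unimodular by (auto simp: unimodular_triangulation_def triangulation_def)

lemma Union_\<Delta>: "\<Union>\<Delta> = P"
  using unimodular by (auto simp: unimodular_triangulation_def)

lemma Int_face_of: "T \<in> \<Delta> \<Longrightarrow> T' \<in> \<Delta> \<Longrightarrow> (T \<inter> T') face_of T"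
  using unimodular by (auto simp: unimodular_triangulation_def triangulation_def)

lemma unimodular_triangle:
  assumes "T \<in> \<Delta>"
  obtains a b c where "T = convex hull {a, b, c}" "\<bar>side a b c\<bar> = 1" "{a, b, c} \<subseteq> L"
    "\<not> affine_dependent {a, b, c}" "card {a, b, c} = 3"
proof -
  have T: "2 simplex T" "{x. x extreme_point_of T} \<subseteq> P \<inter> L" "measure lborel T = 1/2"
    using unimodular assms by (auto simp: unimodular_triangulation_def)
  obtain X where X: "\<not> affine_dependent X" "int (card X) = 3" "T = convex hull X"
    using T(1) by (auto simp: simplex_def)
  then have "card X = 3" by simp
  then obtain a b c where abc: "X = {a, b, c}" by (metis card_3_iff)
  have "X \<subseteq> L"
    using T(2) extreme_point_of_convex_hull_affine_independent[OF X(1)] X(3) by auto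
  moreover have "\<bar>side a b c\<bar> / 2 = 1 / 2"
    using T(3) content_triangle[of a b c] unfolding X(3) abc side_def
    by (simp add: algebra_simps abs_minus_commute)
  ultimately show thesis using that X \<open>card X = 3\<close> abc by auto
qed

lemma lattice_vertex:
  assumes "T \<in> \<Delta>" "a \<in> T \<inter> L" "b \<in> T \<inter> L" "a \<noteq> b"
  obtains c where "c \<in> L" "c \<noteq> a" "c \<noteq> b" "T = convex hull {a, b, c}" "\<bar>side a b c\<bar> = 1"
    "T \<inter> L = {a, b, c}" "\<not> affine_dependent {a, b, c}"
proof -
  obtain p q r where T: "T = convex hull {p, q, r}" "\<bar>side p q r\<bar> = 1" "{p, q, r} \<subseteq> L"
    "\<not> affine_dependent {p, q, r}" "card {p, q, r} = 3"
    using unimodular_triangle[OF assms(1)] .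
  have TL: "T \<inter> L = {p, q, r}" using lattice_points_triangle[OF T(2,3)] T(1) by simp
  have s: "\<bar>side p r q\<bar> = 1" "\<bar>side q p r\<bar> = 1" "\<bar>side q r p\<bar> = 1" "\<bar>side r p q\<bar> = 1" "\<bar>side r q p\<bar> = 1"
    using T(2) by (auto simp: side_def algebra_simps)
  have d: "p \<noteq> q" "p \<noteq> r" "q \<noteq> r" using T(2) by (auto simp: side_def)
  have "a \<in> {p, q, r}" "b \<in> {p, q, r}" using assms TL by auto
  then consider "a = p" "b = q" | "a = q" "b = p" | "a = p" "b = r" | "a = r" "b = p"
    | "a = q" "b = r" | "a = r" "b = q" using assms(4) by blast
  then show thesis
    by cases (use that[of p] that[of q] that[of r] T TL s d in \<open>simp_all add: insert_commute\<close>)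
qed

lemma lattice_vertices:
  assumes "T \<in> \<Delta>" "z \<in> T \<inter> L"
  obtains a b where "a \<in> L" "b \<in> L" "a \<noteq> z" "b \<noteq> z" "a \<noteq> b" "T = convex hull {z, a, b}"
    "\<bar>side z a b\<bar> = 1" "T \<inter> L = {z, a, b}"
proof -
  obtain p q r where T: "T = convex hull {p, q, r}" "\<bar>side p q r\<bar> = 1" "{p, q, r} \<subseteq> L"
    "\<not> affine_dependent {p, q, r}" "card {p, q, r} = 3"
    using unimodular_triangle[OF assms(1)] .
  have TL: "T \<inter> L = {p, q, r}" using lattice_points_triangle[OF T(2,3)] T(1) by simp
  then obtain a where a: "a \<in> T \<inter> L" "a \<noteq> z" using T(2) by (metis insertCI side_self(3) zero_neq_one abs_zero)
  show thesis
    using lattice_vertex[OF assms a(1) a(2)[symmetric]] that a by (metis IntE)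
qed

lemma edge_iff:
  assumes "T \<in> \<Delta>"
  shows "s edge_of T \<longleftrightarrow> (\<exists>a b. a \<in> T \<inter> L \<and> b \<in> T \<inter> L \<and> a \<noteq> b \<and> s = closed_segment a b)"
proof -
  obtain p q r where T: "T = convex hull {p, q, r}" "\<bar>side p q r\<bar> = 1" "{p, q, r} \<subseteq> L"
    "\<not> affine_dependent {p, q, r}" "card {p, q, r} = 3"
    using unimodular_triangle[OF assms(1)] .
  have TL: "T \<inter> L = {p, q, r}" using lattice_points_triangle[OF T(2,3)] T(1) by simp
  show ?thesis
  proof
    assume "s edge_of T"
    then have "s face_of convex hull {p, q, r}" and s: "aff_dim s = 1"
      unfolding edge_of_def T(1)[symmetric] by blast+
    then obtain X where X: "X \<subseteq> {p, q, r}" "s = convex hull X"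
      using face_of_convex_hull_affine_independent[OF T(4)] by blast
    have "\<not> affine_dependent X" using X(1) T(4) affine_dependent_subset by blast
    then have "int (card X) = 2"
      using s X(2) aff_dim_affine_independent[of X] by (simp add: aff_dim_convex_hull)
    then have "card X = 2" by simp
    then obtain a b where ab: "X = {a, b}" "a \<noteq> b" by (auto simp: card_2_iff)
    then have "a \<in> T \<inter> L" "b \<in> T \<inter> L" "s = closed_segment a b"
      unfolding TL using X by (simp_all add: segment_convex_hull)
    then show "\<exists>a b. a \<in> T \<inter> L \<and> b \<in> T \<inter> L \<and> a \<noteq> b \<and> s = closed_segment a b"
      using ab(2) by metis
  next
    assume "\<exists>a b. a \<in> T \<inter> L \<and> b \<in> T \<inter> L \<and> a \<noteq> b \<and> s = closed_segment a b"
    then obtain a b where ab: "{a, b} \<subseteq> {p, q, r}" "a \<noteq> b" "s = closed_segment a b"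
      unfolding TL by auto
    have "s face_of convex hull {p, q, r}"
      using ab unfolding face_of_convex_hull_affine_independent[OF T(4)]
      by (intro exI[of _ "{a, b}"]) (simp add: segment_convex_hull)
    moreover have "aff_dim s = 1"
      using ab by (simp add: segment_convex_hull aff_dim_convex_hull aff_dim_2)
    ultimately show "s edge_of T" unfolding edge_of_def T(1) by simp
  qed
qed

lemma edge_closed_segment:
  assumes "T \<in> \<Delta>" "closed_segment a b edge_of T"
  shows "a \<in> T \<inter> L" "b \<in> T \<inter> L" "a \<noteq> b"
proof -
  obtain x y where xy: "x \<in> T \<inter> L" "y \<in> T \<inter> L" "x \<noteq> y" "closed_segment a b = closed_segment x y"
    using edge_iff[OF assms(1)] assms(2) by auto
  then have "{a, b} = {x, y}" by (simp add: closed_segment_eq)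
  then show "a \<in> T \<inter> L" "b \<in> T \<inter> L" "a \<noteq> b" using xy by (auto simp: doubleton_eq_iff)
qed

lemma edge_lattice:
  assumes "T \<in> \<Delta>" "closed_segment a b edge_of T"
  shows "closed_segment a b \<inter> L = {a, b}"
proof -
  note ab = edge_closed_segment[OF assms]
  obtain c where c: "c \<in> L" "c \<noteq> a" "c \<noteq> b" "T = convex hull {a, b, c}" "\<bar>side a b c\<bar> = 1" "T \<inter> L = {a, b, c}"
    using lattice_vertex[OF assms(1) ab] by metis
  have "c \<notin> closed_segment a b" using side_segment_zero c(5) by force
  moreover have "closed_segment a b \<subseteq> T" using assms(2) edge_of_imp_subset by blast
  ultimately show ?thesis using c(6) ab by auto
qed

section \<open>How triangles of \<Delta> meet along an edge\<close>

lemma triangle_eqI: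
  assumes "T \<in> \<Delta>" "T' \<in> \<Delta>" "T \<inter> L \<subseteq> T'"
  shows "T = T'"
proof -
  obtain p q r where T: "T = convex hull {p, q, r}" "\<bar>side p q r\<bar> = 1" "{p, q, r} \<subseteq> L"
    "\<not> affine_dependent {p, q, r}" "card {p, q, r} = 3"
    using unimodular_triangle[OF assms(1)] .
  obtain p' q' r' where T': "T' = convex hull {p', q', r'}" "\<bar>side p' q' r'\<bar> = 1" "{p', q', r'} \<subseteq> L"
    "\<not> affine_dependent {p', q', r'}" "card {p', q', r'} = 3"
    using unimodular_triangle[OF assms(2)] .
  have "T \<inter> L = {p, q, r}" "T' \<inter> L = {p', q', r'}"
    using lattice_points_triangle[OF T(2,3)] lattice_points_triangle[OF T'(2,3)] T T' by auto
  then have "{p, q, r} \<subseteq> {p', q', r'}" using assms(3) by auto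
  then have "{p, q, r} = {p', q', r'}" using T(5) T'(5) by (intro card_subset_eq) auto
  then show ?thesis using T(1) T'(1) by simp
qed

text \<open>With both apexes on the same side, \<open>c' - c\<close> is a multiple of
  \<open>b - a\<close>, and the triangles overlap near the midpoint of \<open>[a, b]\<close>. A
  point \<open>x\<close> of \<open>T'\<close> there lies on an open segment from a point
  \<open>y\<close> of \<open>[a, b]\<close> to \<open>c\<close>, so the face property forces
  \<open>c\<close> into \<open>T'\<close>.\<close>

lemma opposite_sides:
  assumes T: "T \<in> \<Delta>" "T' \<in> \<Delta>" "T \<noteq> T'"
    and c: "T = convex hull {a, b, c}" "side a b c = 1" "{a, b, c} \<subseteq> L"
    and c': "T' = convex hull {a, b, c'}" "\<bar>side a b c'\<bar> = 1" "c' \<in> L"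
  shows "side a b c' = -1"
proof (rule ccontr)
  assume "side a b c' \<noteq> -1"
  then have s: "side a b c' = 1" using c'(2) by linarith
  have ab: "a \<noteq> b" using s by (auto simp: side_def)
  define j where "j = side c a c'"
  have j: "side b c c' = - j" using side_sum[of b c c' a] s c(2) by (simp add: j_def)
  have c'_eq: "c' = (- j) *\<^sub>R a + j *\<^sub>R b + c"
    using barycentric[of a b c c'] c(2) s j by (simp add: j_def)
  \<comment> \<open>So small that the shift by \<epsilon>\<open>j\<close> along the edge, caused by
    replacing \<open>c'\<close> by \<open>c\<close>, keeps \<open>y\<close> within
    \<open>[a, b]\<close>.\<close>
  define \<epsilon> where "\<epsilon> = 1 / (2 * \<bar>j\<bar> + 2)"
  have \<epsilon>: "0 < \<epsilon>" "\<epsilon> < 1" "\<epsilon> * (2 * \<bar>j\<bar> + 2) = 1" by (auto simp: \<epsilon>_def divide_simps)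
  have "\<bar>\<epsilon> * j\<bar> < (1 - \<epsilon>) / 2" using \<epsilon> by (simp add: abs_mult algebra_simps)
  then have \<epsilon>j: "\<epsilon> * j < (1 - \<epsilon>) / 2" "- (\<epsilon> * j) < (1 - \<epsilon>) / 2"
    by (auto simp: abs_less_iff)
  define x where "x = ((1 - \<epsilon>) / 2) *\<^sub>R a + ((1 - \<epsilon>) / 2) *\<^sub>R b + \<epsilon> *\<^sub>R c'"
  define y where "y = (((1 - \<epsilon>) / 2 - \<epsilon> * j) / (1 - \<epsilon>)) *\<^sub>R a + (((1 - \<epsilon>) / 2 + \<epsilon> * j) / (1 - \<epsilon>)) *\<^sub>R b"
  have "x \<in> T'" unfolding x_def c'(1) convex_hull_3 using \<epsilon>
    by (intro CollectI exI conjI) auto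
  have yab: "y \<in> closed_segment a b"
  proof -
    have "((1 - \<epsilon>) / 2 - \<epsilon> * j) / (1 - \<epsilon>) = 1 - ((1 - \<epsilon>) / 2 + \<epsilon> * j) / (1 - \<epsilon>)"
      using \<epsilon> by (simp add: divide_simps)
    moreover have "0 \<le> ((1 - \<epsilon>) / 2 + \<epsilon> * j) / (1 - \<epsilon>)" "((1 - \<epsilon>) / 2 + \<epsilon> * j) / (1 - \<epsilon>) \<le> 1"
      using \<epsilon> \<epsilon>j by (auto simp: divide_simps)
    ultimately show ?thesis unfolding closed_segment_def y_def by auto
  qed
  have yT: "y \<in> T" using yab segment_subset_triangle[of a b c] c(1) by auto
  have xy: "x = (1 - \<epsilon>) *\<^sub>R y + \<epsilon> *\<^sub>R c"
  proof -
    have "(1 - \<epsilon>) *\<^sub>R y = ((1 - \<epsilon>) / 2 - \<epsilon> * j) *\<^sub>R a + ((1 - \<epsilon>) / 2 + \<epsilon> * j) *\<^sub>R b"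
      using \<epsilon> by (simp add: y_def scaleR_add_right)
    then show ?thesis unfolding x_def c'_eq by (simp add: algebra_simps)
  qed
  have "c \<noteq> y" using side_segment_zero[OF yab] c(2) by auto
  then have "x \<in> open_segment y c" unfolding xy using \<epsilon> by (intro open_segmentI) auto
  moreover have cT: "c \<in> T" unfolding c(1) by (simp add: hull_inc)
  moreover have "x \<in> T"
    using xy convexD_alt[of T y c \<epsilon>] yT cT \<epsilon> c(1) by auto
  ultimately have "c \<in> T'"
    using Int_face_of[OF T(1,2)] \<open>x \<in> T'\<close> yT unfolding face_of_def by blast
  moreover have "a \<in> T'" "b \<in> T'" unfolding c'(1) by (auto simp: hull_inc)
  moreover have "T \<inter> L = {a, b, c}" using lattice_points_triangle[of a b c] c by auto
  ultimately show False using triangle_eqI[OF T(1,2)] T(3) by auto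
qed

lemma triangle_subset_P: "T \<in> \<Delta> \<Longrightarrow> T \<subseteq> P"
  using Union_\<Delta> by auto

lemma compact_triangle:
  assumes "T \<in> \<Delta>" shows "compact T" "convex T"
proof -
  obtain a b c where "T = convex hull {a, b, c}" using unimodular_triangle[OF assms] by metis
  then show "compact T" "convex T" by (auto simp: finite_imp_compact_convex_hull)
qed

text \<open>The midpoint \<open>m\<close> of the edge is interior, so \<open>P\<close> continues on
  the side away from \<open>c\<close>. A triangle containing a point just across the edge contains
  \<open>m\<close>, and then by the face property the whole edge.\<close>

lemma interior_edge_shared:
  assumes T: "T \<in> \<Delta>" and x: "x \<in> interior P" "x \<in> T \<inter> L" and b: "b \<in> T \<inter> L" "b \<noteq> x"
  obtains T' where "T' \<in> \<Delta>" "T' \<noteq> T" "closed_segment x b edge_of T'"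
proof -
  obtain c where c: "T = convex hull {x, b, c}" "\<bar>side x b c\<bar> = 1"
    using lattice_vertex[OF T x(2) b(1) b(2)[symmetric]] by metis
  define m where "m = (1/2) *\<^sub>R x + (1/2) *\<^sub>R b"
  have "b \<in> P" using b triangle_subset_P[OF T] by auto
  then have mP: "m \<in> interior P"
    unfolding m_def by (intro interior_convex_comb convex_P x(1)) auto
  \<comment> \<open>A neighbourhood of \<open>m\<close> that meets only triangles containing
    \<open>m\<close>.\<close>
  define U where "U = interior P \<inter> (\<Inter>T'\<in>{T' \<in> \<Delta>. m \<notin> T'}. - T')"
  have "open U" unfolding U_def
    using finite_\<Delta> compact_triangle by (auto intro!: open_Int open_INT simp: compact_imp_closed open_Compl)
  moreover have "m \<in> U" using mP by (auto simp: U_def)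
  ultimately obtain e where e: "e > 0" "ball m e \<subseteq> U" by (meson open_contains_ball)
  define n where "n = norm (c - m) + 1"
  define t where "t = e / (2 * n)"
  have n: "n > 0" by (simp add: n_def add_nonneg_pos)
  have t: "t > 0" using e n by (simp add: t_def)
  have "t * norm (c - m) < e"
  proof -
    have "t * n = e / 2" using n by (simp add: t_def)
    then show ?thesis using t e by (simp add: n_def algebra_simps)
  qed
  define y where "y = (1 + t) *\<^sub>R m + (- t) *\<^sub>R c"
  have "y = m - t *\<^sub>R (c - m)" by (simp add: y_def algebra_simps)
  then have "y \<in> ball m e" using \<open>t * norm (c - m) < e\<close> t by (simp add: dist_norm)
  then have yU: "y \<in> U" using e by auto
  then have "y \<in> P" using interior_subset by (auto simp: U_def)
  then obtain T' where T': "T' \<in> \<Delta>" "y \<in> T'" using Union_\<Delta> by auto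
  then have mT': "m \<in> T'" using yU by (auto simp: U_def)
  have "side x b m = 0" unfolding m_def by (subst side_convex_comb) auto
  then have "side x b y = - t * side x b c"
    unfolding y_def by (subst side_convex_comb) auto
  moreover have nz: "side x b c \<noteq> 0" using c(2) by auto
  ultimately have "side x b y / side x b c = - t" by simp
  then have "y \<notin> T" unfolding c(1) mem_triangle_iff[OF nz] using t by auto
  have mo: "m \<in> open_segment x b"
    using open_segmentI[of "1/2" x b] b(2) by (simp add: m_def)
  have "m \<in> T"
    unfolding m_def using convexD[OF compact_triangle(2)[OF T], of x b "1/2" "1/2"] x b by auto
  then have "x \<in> T'" "b \<in> T'"
    using Int_face_of[OF T T'(1)] mT' mo x(2) b(1) unfolding face_of_def by blast+
  then have "closed_segment x b edge_of T'"
    using edge_iff[OF T'(1)] x(2) b by blast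
  then show thesis using that T' \<open>y \<notin> T\<close> by blast
qed

text \<open>Of three triangles at one edge, two would lie on the same side.\<close>

lemma dual_edge:
  assumes "closed_segment a b \<in> edges \<Gamma>"
  obtains T T' c c' where "T \<in> \<Delta>" "T' \<in> \<Delta>" "T = convex hull {a, b, c}" "side a b c = 1"
    "T' = convex hull {a, b, c'}" "side a b c' = -1" "{a, b, c, c'} \<subseteq> L"
    "{R \<in> \<Delta>. closed_segment a b edge_of R} = {T, T'}"
proof -
  obtain T T' where TT: "T \<in> \<Delta>" "T' \<in> \<Delta>" "T \<noteq> T'" "closed_segment a b edge_of T" "closed_segment a b edge_of T'"
    using assms unfolding dual_graph_def by auto
  have apex: "\<exists>c. R = convex hull {a, b, c} \<and> \<bar>side a b c\<bar> = 1 \<and> {a, b, c} \<subseteq> L"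
    if R: "R \<in> \<Delta>" "closed_segment a b edge_of R" for R
  proof -
    note ab = edge_closed_segment[OF R]
    obtain c where "c \<in> L" "R = convex hull {a, b, c}" "\<bar>side a b c\<bar> = 1"
      using lattice_vertex[OF R(1) ab] by metis
    then show ?thesis using ab by auto
  qed
  have opp: "side a b c' = - side a b c"
    if "R \<in> \<Delta>" "R' \<in> \<Delta>" "R \<noteq> R'" "R = convex hull {a, b, c}" "\<bar>side a b c\<bar> = 1" "{a, b, c} \<subseteq> L"
      "R' = convex hull {a, b, c'}" "\<bar>side a b c'\<bar> = 1" "{a, b, c'} \<subseteq> L" for R R' c c'
  proof (cases "side a b c = 1")
    case True
    then show ?thesis using opposite_sides[OF that(1-4) True that(6,7,8)] that(9) by auto
  next
    case False
    then have "side b a c = 1" using that(5) side_swap[of b a c] by linarith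
    moreover have "R = convex hull {b, a, c}" "R' = convex hull {b, a, c'}" "\<bar>side b a c'\<bar> = 1"
      using that side_swap[of b a c'] by (auto simp: insert_commute)
    ultimately have "side b a c' = -1"
      using opposite_sides[OF that(1-3), of b a c c'] that by auto
    then show ?thesis using \<open>side b a c = 1\<close> side_swap[of b a] by simp
  qed
  obtain c where c: "T = convex hull {a, b, c}" "\<bar>side a b c\<bar> = 1" "{a, b, c} \<subseteq> L" using apex TT by metis
  obtain c' where c': "T' = convex hull {a, b, c'}" "\<bar>side a b c'\<bar> = 1" "{a, b, c'} \<subseteq> L" using apex TT by metis
  have o: "side a b c' = - side a b c" using opp[OF TT(1-3) c c'] .
  have "R \<in> {T, T'}" if R: "R \<in> \<Delta>" "closed_segment a b edge_of R" for R
  proof (rule ccontr)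
    assume R': "R \<notin> {T, T'}"
    obtain d where d: "R = convex hull {a, b, d}" "\<bar>side a b d\<bar> = 1" "{a, b, d} \<subseteq> L" using apex R by metis
    have "side a b d = - side a b c" using opp[OF TT(1) R(1) _ c d] R' by auto
    moreover have "side a b d = - side a b c'" using opp[OF TT(2) R(1) _ c' d] R' by auto
    ultimately show False using o d(2) by linarith
  qed
  then have E: "{R \<in> \<Delta>. closed_segment a b edge_of R} = {T, T'}" using TT by blast
  show thesis
  proof (cases "side a b c = 1")
    case True
    then show thesis using that[of T T' c c'] TT c c' o E by auto
  next
    case False
    then have "side a b c = -1" using c(2) by linarith
    then show thesis using that[of T' T c' c] TT c c' o E by (auto simp: insert_commute)
  qed
qed

section \<open>Chords: shared edges of \<Delta> with both endpoints on the boundary\<close>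

definition chord :: "real^2 \<Rightarrow> real^2 \<Rightarrow> bool" where
  "chord a b \<longleftrightarrow> closed_segment a b \<in> edges \<Gamma> \<and> a \<notin> interior P \<and> b \<notin> interior P"

lemma chord_commute: "chord a b \<longleftrightarrow> chord b a"
  by (auto simp: chord_def closed_segment_commute)

text \<open>A supporting line at the midpoint would contain \<open>a\<close> and \<open>b\<close>,
  but the two triangles at the chord reach strictly to both sides of that line.\<close>

lemma chord_midpoint:
  assumes "chord a b"
  shows "(1/2) *\<^sub>R a + (1/2) *\<^sub>R b \<in> interior P" "a \<in> P" "b \<in> P" "a \<noteq> b"
proof -
  define m where "m = (1/2) *\<^sub>R a + (1/2) *\<^sub>R b"
  have e: "closed_segment a b \<in> edges \<Gamma>" using assms by (simp add: chord_def)
  obtain T T' c c' where T: "T \<in> \<Delta>" "T' \<in> \<Delta>" "T = convex hull {a, b, c}" "side a b c = 1"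
    "T' = convex hull {a, b, c'}" "side a b c' = -1" "{a, b, c, c'} \<subseteq> L"
    "{R \<in> \<Delta>. closed_segment a b edge_of R} = {T, T'}"
    using dual_edge[OF e] .
  have vP: "a \<in> P" "b \<in> P" "c \<in> P" "c' \<in> P"
    using T triangle_subset_P by (auto simp: hull_inc subset_iff)
  show "a \<in> P" "b \<in> P" using vP by auto
  show "a \<noteq> b" using T by auto
  have mP: "m \<in> P" unfolding m_def using convexD[OF convex_P vP(1,2)] by auto
  have "m \<in> interior P"
  proof (rule ccontr)
    assume "m \<notin> interior P"
    moreover have "interior P = rel_interior P"
      using interior_rel_interior_gen[of P] polygon by (simp add: lattice_polygon_def)
    ultimately have "m \<notin> rel_interior P" by simp
    then obtain n where n: "n \<noteq> 0" "\<And>y. y \<in> P \<Longrightarrow> n \<bullet> m \<le> n \<bullet> y"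
      using supporting_hyperplane_rel_boundary[OF convex_P mP] by metis
    have nm: "n \<bullet> m = (n \<bullet> a) / 2 + (n \<bullet> b) / 2" by (simp add: m_def inner_add_right)
    then have na: "n \<bullet> a = n \<bullet> m" "n \<bullet> b = n \<bullet> m" using n(2)[OF vP(1)] n(2)[OF vP(2)] by linarith+
    have bc: "x = side b c x *\<^sub>R a + side c a x *\<^sub>R b + side a b x *\<^sub>R c" for x
      using barycentric[of a b c x] T(4) by simp
    have nx: "n \<bullet> x = n \<bullet> m + side a b x * (n \<bullet> c - n \<bullet> m)" for x
    proof -
      have "n \<bullet> x = (side b c x + side c a x) * (n \<bullet> m) + side a b x * (n \<bullet> c)"
        using arg_cong[OF bc[of x], of "\<lambda>x. n \<bullet> x"] na by (simp add: inner_add_right algebra_simps)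
      moreover have "side b c x + side c a x = 1 - side a b x" using side_sum[of b c x a] T(4) by simp
      ultimately show ?thesis by (simp add: algebra_simps)
    qed
    \<comment> \<open>\<open>c\<close> and \<open>c'\<close> have opposite values of
      \<open>side a b\<close>, so both inequalities are equalities and the functional is constant;
      testing it at \<open>m + n\<close> gives \<open>n = 0\<close>.\<close>
    have "n \<bullet> c = n \<bullet> m" using nx[of c'] n(2)[OF vP(3)] n(2)[OF vP(4)] T(6) by simp
    then have "n \<bullet> (m + n) = n \<bullet> m" using nx[of "m + n"] by simp
    then show False using n(1) by (simp add: inner_add_right)
  qed
  then show "(1/2) *\<^sub>R a + (1/2) *\<^sub>R b \<in> interior P" by (simp add: m_def)
qed

text \<open>A point of \<open>P\<close> on the line beyond \<open>b\<close> would place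
  \<open>b\<close> between it and the interior midpoint of the chord.\<close>

lemma chord_line:
  assumes "chord a b" "x \<in> P" "side a b x = 0"
  shows "x \<in> closed_segment a b"
proof -
  have bd: "b \<in> interior P" if "chord a b" "x \<in> P" "x = (1 - t) *\<^sub>R a + t *\<^sub>R b" "t > 1" for a b t
  proof -
    have "(2 * (t - 1) / (2 * t - 1)) *\<^sub>R ((1/2) *\<^sub>R a + (1/2) *\<^sub>R b) + (1 / (2 * t - 1)) *\<^sub>R x \<in> interior P"
      using that by (intro interior_convex_comb convex_P chord_midpoint(1)) (auto simp: divide_simps)
    moreover have "(2 * (t - 1) / (2 * t - 1)) *\<^sub>R ((1/2) *\<^sub>R a + (1/2) *\<^sub>R b) + (1 / (2 * t - 1)) *\<^sub>R x = b"
    proof -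
      have "((2 * (t - 1) / (2 * t - 1)) *\<^sub>R ((1/2) *\<^sub>R a + (1/2) *\<^sub>R b) + (1 / (2 * t - 1)) *\<^sub>R x) $ i = b $ i" for i
        using that(4) unfolding that(3) by (simp add: divide_simps) (simp add: algebra_simps)
      then show ?thesis by (simp add: vec_eq_iff)
    qed
    ultimately show ?thesis by simp
  qed
  obtain t where t: "x = (1 - t) *\<^sub>R a + t *\<^sub>R b"
    using side_zero_line[OF assms(3) chord_midpoint(4)[OF assms(1)]] .
  have "t \<le> 1" using bd[OF assms(1,2) t] assms(1) by (force simp: chord_def)
  moreover have "t \<ge> 0"
  proof (rule ccontr)
    assume "\<not> t \<ge> 0"
    then have "a \<in> interior P"
      using bd[of b a "1 - t"] assms(1,2) chord_commute t by (simp add: add.commute)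
    then show False using assms(1) by (simp add: chord_def)
  qed
  ultimately show ?thesis using t unfolding closed_segment_def by auto
qed

text \<open>A triangle reaching to both sides meets the chord itself, by \<open>chord_line\<close>,
  hence the triangle \<open>R\<close> on its positive side. The face property then forces a point of
  the negative side into \<open>R\<close>.\<close>

lemma chord_one_sided:
  assumes "chord a b" "T \<in> \<Delta>"
  shows "(\<forall>x\<in>T. 0 \<le> side a b x) \<or> (\<forall>x\<in>T. side a b x \<le> 0)"
proof (rule ccontr)
  assume "\<not> ?thesis"
  then obtain x y where xy: "x \<in> T" "y \<in> T" "side a b x > 0" "side a b y < 0" by force
  obtain w where w: "w \<in> open_segment x y" "side a b w = 0" using side_crossing[OF xy(3,4)] .
  have e: "closed_segment a b \<in> edges \<Gamma>" using assms by (simp add: chord_def)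
  obtain R R' c c' where RR: "R \<in> \<Delta>" "R' \<in> \<Delta>" "R = convex hull {a, b, c}" "side a b c = 1"
    "R' = convex hull {a, b, c'}" "side a b c' = -1" "{a, b, c, c'} \<subseteq> L"
    "{R \<in> \<Delta>. closed_segment a b edge_of R} = {R, R'}"
    using dual_edge[OF e] .
  note R = RR(1,3,4)
  have wT: "w \<in> T" using xy w(1) compact_triangle(2)[OF assms(2)] by (meson convex_contains_open_segment subsetD)
  then have "w \<in> closed_segment a b"
    using chord_line[OF assms(1)] w(2) triangle_subset_P assms(2) by blast
  then have "w \<in> R" using segment_subset_triangle[of a b c] R(2) by auto
  then have "y \<in> R" using Int_face_of[OF assms(2) R(1)] w(1) wT xy unfolding face_of_def by blast
  then show False unfolding R(2) using mem_triangle_iff[of a b c y] R(3) xy(4) by simp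
qed

lemma triangle_off_line:
  assumes "T \<in> \<Delta>" "a \<noteq> b"
  shows "\<exists>x\<in>T. side a b x \<noteq> 0"
proof -
  obtain p q r where T: "T = convex hull {p, q, r}" "\<bar>side p q r\<bar> = 1" using unimodular_triangle[OF assms(1)] by metis
  then have "p \<in> T" "q \<in> T" "r \<in> T" by (auto simp: hull_inc)
  then show ?thesis using side_collinear[OF assms(2), of p q r] T(2) by force
qed

lemma chord_edge:
  assumes "chord a b" "T \<in> \<Delta>" "s edge_of T" "s \<noteq> closed_segment a b"
  shows "\<exists>x\<in>s. side a b x \<noteq> 0"
proof (rule ccontr)
  assume n: "\<not> ?thesis"
  obtain p q where pq: "p \<in> T \<inter> L" "q \<in> T \<inter> L" "p \<noteq> q" "s = closed_segment p q"
    using edge_iff[OF assms(2)] assms(3) by auto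
  have "p \<in> closed_segment a b" "q \<in> closed_segment a b"
    using n pq triangle_subset_P[OF assms(2)] by (auto intro!: chord_line[OF assms(1)])
  moreover obtain R where "R \<in> \<Delta>" "closed_segment a b edge_of R"
    using assms(1) unfolding chord_def dual_graph_def by auto
  ultimately have "p \<in> {a, b}" "q \<in> {a, b}" using edge_lattice pq by blast+
  then show False using pq assms(4) closed_segment_commute by auto
qed

text \<open>Transfers the side of a chord between a triangle and its edges; applied at both edges of
  a contracted node, it carries the side along a class.\<close>

lemma chord_edge_pos:
  assumes "chord a b" "T \<in> \<Delta>" "s edge_of T" "s \<noteq> closed_segment a b"
  shows "(\<exists>x\<in>s. side a b x > 0) \<longleftrightarrow> (\<exists>x\<in>T. side a b x > 0)"
  using chord_edge[OF assms] chord_one_sided[OF assms(1,2)] edge_of_imp_subset[OF assms(3)]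
  by (meson linorder_neqE_linordered_idom not_le subsetD)

section \<open>Edges at interior lattice points, and pruning\<close>

abbreviation "I \<equiv> interior_lattice_points P"

lemma interior_latticeD: "x \<in> I \<Longrightarrow> x \<in> interior P" "x \<in> I \<Longrightarrow> x \<in> L" "x \<in> I \<Longrightarrow> x \<in> P"
  using interior_subset[of P] by (auto simp: interior_lattice_points_def)

lemma edges_at_vertex:
  assumes T: "T \<in> \<Delta>" "T \<inter> L = {x, a, b}" "x \<noteq> a" "x \<noteq> b" "a \<noteq> b"
  shows "{s. s edge_of T \<and> x \<in> s} = {closed_segment x a, closed_segment x b}"
    and "closed_segment x a \<noteq> closed_segment x b"
    and "{s. s edge_of T \<and> x \<notin> s} = {closed_segment a b}"
proof -
  have e: "s edge_of T \<longleftrightarrow> s = closed_segment x a \<or> s = closed_segment x b \<or> s = closed_segment a b" for s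
    unfolding edge_iff[OF T(1)] T(2) using T(3-5) by (auto simp: closed_segment_commute)
  have "x \<notin> closed_segment a b"
    using edge_lattice[OF T(1), of a b] e T by blast
  then show "{s. s edge_of T \<and> x \<in> s} = {closed_segment x a, closed_segment x b}"
    "{s. s edge_of T \<and> x \<notin> s} = {closed_segment a b}"
    using e by auto
  show "closed_segment x a \<noteq> closed_segment x b"
    using T(3-5) by (auto simp: closed_segment_eq doubleton_eq_iff)
qed

lemma edges_at_interior_point:
  assumes T: "T \<in> \<Delta>" and x: "x \<in> I" "x \<in> T"
  shows "card {s. s edge_of T \<and> x \<in> s} = 2"
    and "s edge_of T \<Longrightarrow> x \<in> s \<Longrightarrow> s \<in> edges \<Gamma>"
proof -
  have xL: "x \<in> T \<inter> L" using x interior_latticeD by auto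
  obtain a b where ab: "a \<in> L" "b \<in> L" "a \<noteq> x" "b \<noteq> x" "a \<noteq> b" "T = convex hull {x, a, b}"
    "\<bar>side x a b\<bar> = 1" "T \<inter> L = {x, a, b}"
    using lattice_vertices[OF T xL] .
  note E = edges_at_vertex[OF T ab(8) ab(3)[symmetric] ab(4)[symmetric] ab(5)]
  show "card {s. s edge_of T \<and> x \<in> s} = 2" using E(1,2) by simp
  assume s: "s edge_of T" "x \<in> s"
  then have "s \<in> {closed_segment x a, closed_segment x b}" using E(1) by auto
  then obtain p where p: "p \<in> T \<inter> L" "p \<noteq> x" "s = closed_segment x p" using ab(3,4,8) by auto
  obtain T' where "T' \<in> \<Delta>" "T' \<noteq> T" "closed_segment x p edge_of T'"
    using interior_edge_shared[OF T interior_latticeD(1)[OF x(1)] xL p(1,2)] .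
  then show "s \<in> edges \<Gamma>" using s T p(3) unfolding dual_graph_def by auto
qed

lemma finite_edges_dual: "finite (edges \<Gamma>)"
proof -
  have "finite {s. s edge_of T}" if T: "T \<in> \<Delta>" for T
  proof -
    obtain p q r where "T = convex hull {p, q, r}" using unimodular_triangle[OF T] by metis
    then have "polytope T" unfolding polytope_def by (intro exI[of _ "{p, q, r}"]) simp
    then have "finite {s. s face_of T}" by (rule finite_polytope_faces)
    then show ?thesis by (rule rev_finite_subset) (auto simp: edge_of_def)
  qed
  then have "finite (\<Union>T\<in>\<Delta>. {s. s edge_of T})" using finite_\<Delta> by blast
  then show ?thesis by (rule rev_finite_subset) (auto simp: dual_graph_def)
qed

text \<open>Invariant of the first phase. A triangle with an interior lattice point has two dual
  edges at that point, so it never becomes a leaf.\<close>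

definition pruned :: "((real^2) set, (real^2) set) multigraph \<Rightarrow> bool" where
  "pruned K \<longleftrightarrow> nodes K \<subseteq> \<Delta> \<and> edges K = {s \<in> edges \<Gamma>. ends \<Gamma> s \<subseteq> nodes K} \<and> ends K = ends \<Gamma> \<and>
     {T \<in> \<Delta>. T \<inter> I \<noteq> {}} \<subseteq> nodes K"

lemma pruned_incident:
  assumes "pruned K" "s \<in> incident K T"
  shows "T \<in> \<Delta>" "s edge_of T" "s \<in> edges \<Gamma>" "s \<in> edges K"
  using assms by (auto simp: pruned_def incident_def dual_graph_def)

lemma pruned_incident_interior:
  assumes K: "pruned K" and T: "T \<in> \<Delta>" "x \<in> I" "x \<in> T"
  shows "{s \<in> incident K T. x \<in> s} = {s. s edge_of T \<and> x \<in> s}"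
proof -
  have "s \<in> incident K T" if "s edge_of T" "x \<in> s" for s
  proof -
    have "R \<in> nodes K" if "R \<in> ends \<Gamma> s" for R
    proof -
      have "R \<in> \<Delta>" "x \<in> R" using that \<open>x \<in> s\<close> edge_of_imp_subset by (auto simp: dual_graph_def)
      then show ?thesis using K T(2) unfolding pruned_def by blast
    qed
    then have "s \<in> edges K" using K edges_at_interior_point(2)[OF T that] by (auto simp: pruned_def)
    moreover have "T \<in> ends K s" using K T(1) that by (auto simp: pruned_def dual_graph_def)
    ultimately show ?thesis by (simp add: incident_def)
  qed
  then show ?thesis using pruned_incident[OF K] by blast
qed

lemma pruned_prune_step:
  assumes K: "pruned K" and step: "prune_step K K'"
  shows "pruned K'"
proof -
  obtain v where v: "v \<in> nodes K" "node_degree K v = 1" "K' = delete_node K v"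
    using step unfolding prune_step_def by auto
  have fin: "finite (edges K)" using K finite_edges_dual by (auto simp: pruned_def)
  have "x \<notin> v" if x: "x \<in> I" for x
  proof
    assume xv: "x \<in> v"
    have T: "v \<in> \<Delta>" using K v by (auto simp: pruned_def)
    have "2 = card {s \<in> incident K v. x \<in> s}"
      using pruned_incident_interior[OF K T x xv] edges_at_interior_point(1)[OF T x xv] by simp
    also have "\<dots> \<le> card (incident K v)"
      using fin by (intro card_mono) (auto simp: incident_def)
    also have "\<dots> \<le> node_degree K v" by (simp add: node_degree_def incident_def)
    finally show False using v by simp
  qed
  then have "v \<inter> I = {}" by auto
  then show ?thesis using K v unfolding pruned_def delete_node_def by auto
qed

lemma pruned_rtranclp: "prune_step\<^sup>*\<^sup>* \<Gamma> K \<Longrightarrow> pruned K"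
proof (induction rule: rtranclp_induct)
  case base
  show ?case by (auto simp: pruned_def dual_graph_def)
next
  case (step K K')
  then show ?case using pruned_prune_step by blast
qed

lemma chord_of_edge:
  assumes "s \<in> edges \<Gamma>" "\<And>x. x \<in> I \<Longrightarrow> x \<notin> s" "s = closed_segment a b"
  shows "chord a b"
proof -
  obtain T where T: "T \<in> \<Delta>" "s edge_of T" using assms(1) by (auto simp: dual_graph_def)
  then have "a \<in> L" "b \<in> L" using edge_closed_segment assms(3) by blast+
  then show ?thesis using assms unfolding chord_def interior_lattice_points_def by auto
qed

lemma dual_edge_segment:
  assumes "s \<in> edges \<Gamma>" obtains a b where "s = closed_segment a b" "a \<in> L" "b \<in> L" "a \<noteq> b"
proof -
  obtain T where T: "T \<in> \<Delta>" "s edge_of T" using assms(1) by (auto simp: dual_graph_def)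
  then show thesis using that edge_iff by blast
qed

lemma chord_opposite:
  assumes ab: "chord a b" and R: "R \<in> \<Delta>" "R' \<in> \<Delta>" "R \<noteq> R'"
    and s: "closed_segment a b edge_of R" "closed_segment a b edge_of R'"
  shows "(\<exists>x\<in>R. side a b x > 0) \<longleftrightarrow> \<not> (\<exists>x\<in>R'. side a b x > 0)"
proof -
  have e: "closed_segment a b \<in> edges \<Gamma>" using ab by (simp add: chord_def)
  obtain T T' c c' where T: "T \<in> \<Delta>" "T' \<in> \<Delta>" "T = convex hull {a, b, c}" "side a b c = 1"
    "T' = convex hull {a, b, c'}" "side a b c' = -1" "{a, b, c, c'} \<subseteq> L"
    "{R \<in> \<Delta>. closed_segment a b edge_of R} = {T, T'}"
    using dual_edge[OF e] .
  have "c \<in> T" "c' \<in> T'" using T by (auto simp: hull_inc)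
  then have "\<exists>x\<in>T. side a b x > 0" using T(4) by force
  moreover have "\<not> (\<exists>x\<in>T'. side a b x > 0)"
  proof -
    have "side a b c' < 0" using T(6) by simp
    then show ?thesis using \<open>c' \<in> T'\<close> chord_one_sided[OF ab T(2)] by force
  qed
  moreover have "R \<in> {T, T'}" "R' \<in> {T, T'}" using T(8) R s by blast+
  ultimately show ?thesis using R(3) by blast
qed

lemma chord_triangle_sign:
  assumes ab: "chord a b" and R: "R \<in> \<Delta>"
  shows "(\<exists>x\<in>R. side a b x < 0) \<longleftrightarrow> \<not> (\<exists>x\<in>R. side a b x > 0)"
proof -
  have "a \<noteq> b" using chord_midpoint(4)[OF ab] .
  then have "\<exists>x\<in>R. side a b x \<noteq> 0" using triangle_off_line[OF R] by blast
  then show ?thesis using chord_one_sided[OF ab R] by force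
qed

end

section \<open>The skeleton of a unimodular triangulation\<close>

locale trivalent_skeleton = unimodular_polygon +
  fixes K :: "((real^2) set, (real^2) set) multigraph"
    and G :: "((real^2) set, (real^2) set set) multigraph"
  assumes pruned: "pruned K" and no_leaf: "v \<in> nodes K \<Longrightarrow> node_degree K v \<noteq> 1"
    and smoothing: "smoothing K G" and trivalent: "trivalent G"
begin

lemma nodes_subset: "nodes G \<subseteq> nodes K" "nodes K \<subseteq> \<Delta>" "nodes G \<subseteq> \<Delta>"
  using smoothing pruned by (auto simp: smoothing_def pruned_def)

lemma edges_subset: "edges K \<subseteq> edges \<Gamma>" "e \<in> edges G \<Longrightarrow> e \<subseteq> edges K"
  using smoothing pruned by (auto simp: smoothing_def pruned_def)

lemma incidentD:
  assumes "s \<in> incident K T" shows "T \<in> nodes K" "T \<in> \<Delta>" "s edge_of T" "s \<in> edges \<Gamma>" "s \<in> edges K"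
  using pruned_incident[OF pruned assms] assms pruned by (auto simp: pruned_def incident_def)

lemma incident_iff:
  assumes "s \<in> edges K" shows "s \<in> incident K T \<longleftrightarrow> T \<in> \<Delta> \<and> s edge_of T"
  using assms pruned by (auto simp: pruned_def incident_def dual_graph_def)

lemma finite_edges: "finite (edges K)" "finite (edges G)" "e \<in> edges G \<Longrightarrow> finite e"
proof -
  show f: "finite (edges K)" using finite_edges_dual edges_subset(1) finite_subset by blast
  have "edges G \<subseteq> Pow (edges K)" using edges_subset(2) by auto
  then show "finite (edges G)" using f finite_subset by blast
  show "e \<in> edges G \<Longrightarrow> finite e" using f edges_subset(2) finite_subset by blast
qed

lemma edge_class:
  assumes "s \<in> edges K" obtains e where "e \<in> edges G" "s \<in> e"
proof -
  have "\<Union>(edges G) = edges K" using smoothing by (simp add: smoothing_def)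
  then show thesis using that assms by blast
qed

lemma edge_class_unique:
  assumes "e \<in> edges G" "e' \<in> edges G" "s \<in> e" "s \<in> e'" shows "e = e'"
proof -
  have "disjoint (edges G)" using smoothing by (simp add: smoothing_def)
  then show ?thesis using assms unfolding disjoint_def by blast
qed

lemma ends_nodes: "e \<in> edges G \<Longrightarrow> ends G e \<noteq> {} \<and> ends G e \<subseteq> nodes G"
  using smoothing by (simp add: smoothing_def)

lemma card_incident:
  "T \<in> nodes G \<Longrightarrow> e \<in> edges G \<Longrightarrow> card (incident K T \<inter> e) =
        (if ends G e = {T} then 2 else if T \<in> ends G e then 1 else 0)"
  using smoothing by (simp add: smoothing_def)

lemma incident_class:
  assumes "T \<in> nodes G" "e \<in> edges G" "T \<in> ends G e"
  obtains s where "s \<in> incident K T" "s \<in> e"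
proof -
  have "card (incident K T \<inter> e) \<noteq> 0" using card_incident[OF assms(1,2)] assms(3) by auto
  then have "incident K T \<inter> e \<noteq> {}" by (metis card.empty)
  then show thesis using that by blast
qed

lemma class_incident:
  assumes "T \<in> nodes G" "e \<in> edges G" "s \<in> incident K T" "s \<in> e"
  shows "T \<in> ends G e"
proof -
  have "incident K T \<inter> e \<noteq> {}" "finite (incident K T \<inter> e)" using assms finite_edges by auto
  then have "card (incident K T \<inter> e) \<noteq> 0" by simp
  then show ?thesis using card_incident[OF assms(1,2)] by (auto split: if_splits)
qed

lemma removed_class:
  assumes "T \<in> nodes K - nodes G" "s \<in> incident K T" "s \<in> e" "e \<in> edges G"
  shows "incident K T \<subseteq> e"
proof -
  have "\<exists>e'\<in>edges G. incident K T \<subseteq> e'"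
    using smoothing assms(1) by (simp add: smoothing_def)
  then obtain e' where e': "e' \<in> edges G" "incident K T \<subseteq> e'" by blast
  then show ?thesis using edge_class_unique assms by blast
qed

lemma removed_card: "T \<in> nodes K - nodes G \<Longrightarrow> card (incident K T) = 2"
  using smoothing by (simp add: smoothing_def)

text \<open>The induction principle for walking along the path contracted to
  \<open>e\<close>.\<close>

lemma constant_on_edge:
  assumes "e \<in> edges G"
    and "\<And>T s t. T \<in> nodes K - nodes G \<Longrightarrow> incident K T \<subseteq> e \<Longrightarrow> s \<in> incident K T \<Longrightarrow> t \<in> incident K T \<Longrightarrow> Q s \<Longrightarrow> Q t"
    and "s \<in> e" "t \<in> e" "Q s"
  shows "Q t"
proof -
  have "linked K (nodes K - nodes G) e" using smoothing assms(1) by (simp add: smoothing_def)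
  then show ?thesis using assms(2-5) by (rule linkedD[where Q = Q and s = s])
qed

lemma interior_edges:
  assumes T: "T \<in> \<Delta>" and x: "x \<in> I" "x \<in> T"
  shows "card {s \<in> incident K T. x \<in> s} = 2"
  using edges_at_interior_point(1)[OF assms] pruned_incident_interior[OF pruned assms] by simp

text \<open>A contracted node has only two edges in \<open>K\<close>. If it contains
  \<open>x\<close>, two of its edges contain \<open>x\<close>, hence both do.\<close>

lemma region_constant:
  assumes e: "e \<in> edges G" and x: "x \<in> I" and st: "s \<in> e" "t \<in> e" "x \<in> s"
  shows "x \<in> t"
proof (rule constant_on_edge[where Q = "\<lambda>s. x \<in> s", OF e _ st])
  fix T s t assume T: "T \<in> nodes K - nodes G" and s: "s \<in> incident K T" "t \<in> incident K T" "x \<in> s"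
  have "x \<in> T" using incidentD(3)[OF s(1)] s(3) edge_of_imp_subset by blast
  then have "card {s \<in> incident K T. x \<in> s} = card (incident K T)"
    using interior_edges[of T x] T x nodes_subset removed_card by auto
  moreover have "finite (incident K T)" using finite_edges by (auto simp: incident_def)
  ultimately have "{s \<in> incident K T. x \<in> s} = incident K T" by (intro card_subset_eq) auto
  then show "x \<in> t" using s by auto
qed

lemma loop_node_edges:
  assumes "u \<in> nodes G" "e \<in> edges G" "l \<in> edges G" "u \<in> ends G e" "ends G e \<noteq> {u}" "ends G l = {u}"
  shows "{e' \<in> edges G. u \<in> ends G e'} = {e, l}"
proof -
  have "node_degree G u = 3" using trivalent assms(1) unfolding trivalent_def by blast
  then have "card {e \<in> edges G. u \<in> ends G e} + card {e \<in> edges G. ends G e = {u}} = 3"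
    unfolding node_degree_def .
  moreover have "card {e \<in> edges G. ends G e = {u}} > 0"
    using finite_edges(2) assms(3,6) by (subst card_gt_0_iff) auto
  moreover have "e \<noteq> l" using assms(5,6) by auto
  ultimately have le: "card {e' \<in> edges G. u \<in> ends G e'} \<le> card {e, l}" by simp
  have sub: "{e, l} \<subseteq> {e' \<in> edges G. u \<in> ends G e'}" using assms by simp
  have fin: "finite {e' \<in> edges G. u \<in> ends G e'}" using finite_edges by simp
  show ?thesis using card_seteq[OF fin sub le] by (rule sym)
qed

lemma tripod_node_edges:
  assumes "v \<in> nodes G" "{a, b, c} \<subseteq> edges G" "distinct [a, b, c]" "v \<in> ends G a" "v \<in> ends G b" "v \<in> ends G c"
  shows "{e' \<in> edges G. v \<in> ends G e'} = {a, b, c}"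
proof -
  have "node_degree G v = 3" using trivalent assms(1) unfolding trivalent_def by blast
  moreover have "card {a, b, c} = 3" using assms(3) by simp
  ultimately have le: "card {e' \<in> edges G. v \<in> ends G e'} \<le> card {a, b, c}" by (simp add: node_degree_def)
  have sub: "{a, b, c} \<subseteq> {e' \<in> edges G. v \<in> ends G e'}" using assms by simp
  have fin: "finite {e' \<in> edges G. v \<in> ends G e'}" using finite_edges by simp
  show ?thesis using card_seteq[OF fin sub le] by (rule sym)
qed

text \<open>The triangles at an interior lattice point form a cycle, which meets every node of the skeleton
  in none or two of its edges; at a node with a loop this is impossible for the edge leading to the loop.\<close>

lemma loop_stem_interior_free:
  assumes u: "u \<in> nodes G" and e: "e \<in> edges G" "u \<in> ends G e" "ends G e \<noteq> {u}"
    and l: "l \<in> edges G" "ends G l = {u}" and s: "s \<in> e" and x: "x \<in> I"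
  shows "x \<notin> s"
proof
  assume xs: "x \<in> s"
  have el: "e \<noteq> l" using e l by auto
  have ce: "card (incident K u \<inter> e) = 1" and cl: "card (incident K u \<inter> l) = 2"
    using card_incident[OF u] e l by auto
  obtain se where se: "se \<in> incident K u" "se \<in> e" using incident_class[OF u e(1,2)] .
  then have xe: "x \<in> se" using region_constant[OF e(1) x s _ xs] by blast
  then have xu: "x \<in> u" using incidentD(3)[OF se(1)] edge_of_imp_subset by blast
  have X: "card {s \<in> incident K u. x \<in> s} = 2" using interior_edges[OF _ x xu] u nodes_subset by auto
  have fin: "finite (incident K u)" using finite_edges by (auto simp: incident_def)
  have "{s \<in> incident K u. x \<in> s} \<noteq> {se}"
  proof
    assume "{s \<in> incident K u. x \<in> s} = {se}"
    then show False using X by simp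
  qed
  moreover have "se \<in> {s \<in> incident K u. x \<in> s}" using se xe by simp
  ultimately obtain s' where "s' \<in> {s \<in> incident K u. x \<in> s}" and ne: "s' \<noteq> se" by blast
  then have s': "s' \<in> incident K u" "x \<in> s'" "s' \<noteq> se" by simp_all
  obtain e' where e': "e' \<in> edges G" "s' \<in> e'" using edge_class incidentD(5)[OF s'(1)] .
  have "e' \<in> {e' \<in> edges G. u \<in> ends G e'}" using class_incident[OF u e'(1) s'(1) e'(2)] e'(1) by simp
  then have "e' \<in> {e, l}" using loop_node_edges[OF u e(1) l(1) e(2,3) l(2)] by simp
  moreover have "e' \<noteq> e"
  proof
    assume "e' = e"
    then have "{s', se} \<subseteq> incident K u \<inter> e" using s' se e' by simp
    moreover obtain r where "incident K u \<inter> e = {r}" using ce card_1_singletonE by blast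
    ultimately show False using s'(3) by auto
  qed
  ultimately have "e' = l" by blast
  \<comment> \<open>The edge of \<open>u\<close> in \<open>e\<close> and the two in \<open>l\<close>
    would be three edges of one triangle through \<open>x\<close>.\<close>
  then have "insert se (incident K u \<inter> l) \<subseteq> {s \<in> incident K u. x \<in> s}"
    using region_constant[OF l(1) x _ _ s'(2)] e' se xe by auto
  then have "card (insert se (incident K u \<inter> l)) \<le> card {s \<in> incident K u. x \<in> s}"
    using fin by (intro card_mono) simp_all
  moreover have "se \<notin> l" using edge_class_unique[OF e(1) l(1) se(2)] el by blast
  ultimately show False using cl fin X by simp
qed

end

text \<open>The stem \<open>e\<close> leads from \<open>v\<close> to the loop node \<open>u\<close>.
  The chord is the member of \<open>e\<close> at \<open>v\<close> itself, oriented so that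
  \<open>v\<close> is on its negative side; positive therefore means beyond the chord. The last
  assumption is the conclusion of \<open>heavy_lobe\<close>.\<close>

locale skeleton_lobe = trivalent_skeleton +
  fixes e l :: "(real^2) set set" and v u :: "(real^2) set" and a b :: "real^2"
  assumes e: "e \<in> edges G" "ends G e = {v, u}" and vu: "v \<noteq> u"
    and l: "l \<in> edges G" "ends G l = {u}"
    and chord_e: "closed_segment a b \<in> e" and chord_v: "closed_segment a b \<in> incident K v"
    and v_negative: "\<exists>x\<in>v. side a b x < 0"
    and lobe: "F \<subseteq> nodes G \<Longrightarrow> v \<notin> F \<Longrightarrow>
      (\<And>e'. e' \<in> edges G \<Longrightarrow> e' \<noteq> e \<Longrightarrow> ends G e' \<inter> F \<noteq> {} \<Longrightarrow> ends G e' \<subseteq> F) \<Longrightarrow> F \<subseteq> {u}"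
begin

lemma uv: "u \<in> nodes G" "v \<in> nodes G" "u \<in> \<Delta>" "v \<in> \<Delta>"
  using ends_nodes[OF e(1)] e(2) nodes_subset by auto

lemma u_edges: "{e' \<in> edges G. u \<in> ends G e'} = {e, l}"
  using loop_node_edges[OF uv(1) e(1) l(1)] e(2) l(2) vu by auto

lemma stem_interior_free: "s \<in> e \<Longrightarrow> x \<in> I \<Longrightarrow> x \<notin> s"
  using loop_stem_interior_free[OF uv(1) e(1) _ _ l] e(2) vu by auto

lemma chord_ab: "chord a b"
  using chord_of_edge[of "closed_segment a b" a b] stem_interior_free[OF chord_e] incidentD(4)[OF chord_v] by blast

lemma v_not_positive: "\<not> (\<exists>x\<in>v. side a b x > 0)"
  using chord_triangle_sign[OF chord_ab uv(4)] v_negative by blast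

lemma across_positive:
  assumes "T \<in> \<Delta>" "T \<noteq> v" "closed_segment a b edge_of T"
  shows "\<exists>x\<in>T. side a b x > 0"
  using chord_opposite[OF chord_ab assms(1) uv(4) assms(2,3) incidentD(3)[OF chord_v]] v_not_positive by blast

text \<open>The stem leaves \<open>v\<close> across the chord, whose other triangle is positive, and
  no later edge lies on the line of the chord.\<close>

lemma u_positive: "\<exists>x\<in>u. side a b x > 0"
proof -
  have "u \<in> ends G e" using e(2) by simp
  then obtain s where s: "s \<in> incident K u" "s \<in> e" using incident_class[OF uv(1) e(1)] by blast
  \<comment> \<open>Weak inequality, because the walk starts at the chord, where
    \<open>side a b\<close> vanishes.\<close>
  have Q: "\<forall>x\<in>s. side a b x \<ge> 0"
  proof (rule constant_on_edge[where Q = "\<lambda>s. \<forall>x\<in>s. side a b x \<ge> 0", OF e(1) _ chord_e s(2)])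
    show "\<forall>x\<in>closed_segment a b. side a b x \<ge> 0" using side_segment_zero by simp
  next
    fix T s' t
    assume T: "T \<in> nodes K - nodes G" and st: "s' \<in> incident K T" "t \<in> incident K T" "\<forall>x\<in>s'. side a b x \<ge> 0"
    have T\<Delta>: "T \<in> \<Delta>" using T nodes_subset by auto
    have "\<exists>x\<in>T. side a b x > 0"
    proof (cases "s' = closed_segment a b")
      case True
      then show ?thesis using across_positive[OF T\<Delta>] T uv(2) incidentD(3)[OF st(1)] by blast
    next
      case False
      then show ?thesis
        using chord_edge[OF chord_ab T\<Delta> incidentD(3)[OF st(1)]] chord_edge_pos[OF chord_ab T\<Delta> incidentD(3)[OF st(1)]] st(3)
        by force
    qed
    then have "\<forall>x\<in>T. side a b x \<ge> 0" using chord_one_sided[OF chord_ab T\<Delta>] by force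
    then show "\<forall>x\<in>t. side a b x \<ge> 0" using incidentD(3)[OF st(2)] edge_of_imp_subset by blast
  qed
  show ?thesis
  proof (cases "s = closed_segment a b")
    case True
    then show ?thesis using across_positive[OF uv(3)] vu incidentD(3)[OF s(1)] by blast
  next
    case False
    then show ?thesis
      using chord_edge[OF chord_ab uv(3) incidentD(3)[OF s(1)]] chord_edge_pos[OF chord_ab uv(3) incidentD(3)[OF s(1)]] Q
      by force
  qed
qed

lemma u_nonneg: "x \<in> u \<Longrightarrow> side a b x \<ge> 0"
  using u_positive chord_one_sided[OF chord_ab uv(3)] by force

lemma positive_constant:
  assumes e': "e' \<in> edges G" "e' \<noteq> e" and st: "s \<in> e'" "t \<in> e'" "\<exists>x\<in>s. side a b x > 0"
  shows "\<exists>x\<in>t. side a b x > 0"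
proof (rule constant_on_edge[where Q = "\<lambda>s. \<exists>x\<in>s. side a b x > 0", OF e'(1) _ st])
  fix T s t
  assume T: "T \<in> nodes K - nodes G" "incident K T \<subseteq> e'" "s \<in> incident K T" "t \<in> incident K T"
    "\<exists>x\<in>s. side a b x > 0"
  have "closed_segment a b \<notin> e'" using edge_class_unique[OF e(1) e'(1) chord_e] e'(2) by blast
  then show "\<exists>x\<in>t. side a b x > 0"
    using chord_edge_pos[OF chord_ab incidentD(2,3)[OF T(3)]] chord_edge_pos[OF chord_ab incidentD(2,3)[OF T(4)]] T
    by blast
qed

lemma positive_end:
  assumes e': "e' \<in> edges G" "e' \<noteq> e" and s: "s \<in> e'" and w: "w \<in> ends G e'"
  shows "(\<exists>x\<in>s. side a b x > 0) \<longleftrightarrow> (\<exists>x\<in>w. side a b x > 0)"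
proof -
  have wG: "w \<in> nodes G" using ends_nodes[OF e'(1)] w by blast
  obtain t where t: "t \<in> incident K w" "t \<in> e'" using incident_class[OF wG e'(1) w] .
  have "t \<noteq> closed_segment a b" using edge_class_unique[OF e(1) e'(1) chord_e] e'(2) t(2) by blast
  then have "(\<exists>x\<in>t. side a b x > 0) \<longleftrightarrow> (\<exists>x\<in>w. side a b x > 0)"
    using chord_edge_pos[OF chord_ab incidentD(2,3)[OF t(1)]] by blast
  then show ?thesis using positive_constant[OF e' s t(2)] positive_constant[OF e' t(2) s] by blast
qed

text \<open>Along edges other than \<open>e\<close> the side cannot change, so the nodes beyond the
  chord form a set closed under these edges that misses \<open>v\<close>.\<close>

lemma positive_node:
  assumes "w \<in> nodes G" "\<exists>x\<in>w. side a b x > 0"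
  shows "w = u"
proof -
  have "{w \<in> nodes G. \<exists>x\<in>w. side a b x > 0} \<subseteq> {u}"
  proof (rule lobe)
    show "v \<notin> {w \<in> nodes G. \<exists>x\<in>w. side a b x > 0}" using v_not_positive by blast
    fix e' assume e': "e' \<in> edges G" "e' \<noteq> e" "ends G e' \<inter> {w \<in> nodes G. \<exists>x\<in>w. side a b x > 0} \<noteq> {}"
    then obtain w where w: "w \<in> ends G e'" "\<exists>x\<in>w. side a b x > 0" by blast
    obtain s where "s \<in> e'" using incident_class[of w e'] w(1) e'(1) ends_nodes by blast
    then show "ends G e' \<subseteq> {w \<in> nodes G. \<exists>x\<in>w. side a b x > 0}"
      using positive_end[OF e'(1,2)] w ends_nodes[OF e'(1)] by blast
  qed auto
  then show ?thesis using assms by blast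
qed

lemma positive_edge:
  assumes e': "e' \<in> edges G" and s: "s \<in> e'" "\<exists>x\<in>s. side a b x > 0"
  shows "e' \<in> {e, l}"
proof (cases "e' = e")
  case False
  obtain w where w: "w \<in> ends G e'" using ends_nodes[OF e'] by blast
  then have "w = u" using positive_node[of w] positive_end[OF e' False s(1) w] s(2) ends_nodes[OF e'] by blast
  then show ?thesis using u_edges w e' by blast
qed simp

lemma loop_edges:
  obtains r r' where "incident K u \<inter> l = {r, r'}" "r \<noteq> r'"
  using card_incident[OF uv(1) l(1)] l(2) by (auto simp: card_2_iff)

text \<open>Suppose the edge \<open>r\<close> of \<open>u\<close> in the loop contains no interior
  lattice point. Then \<open>r\<close> is a chord, and the other loop edge \<open>r'\<close> of
  \<open>u\<close> reaches strictly to the side of \<open>u\<close>. Following the loop from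
  \<open>r'\<close> round to \<open>r\<close> preserves this, yet \<open>r\<close> lies on its own
  line.\<close>

lemma loop_interior_point: "\<exists>y\<in>I. side a b y > 0 \<and> y \<in> u"
proof -
  obtain r r' where r: "incident K u \<inter> l = {r, r'}" "r \<noteq> r'" using loop_edges .
  then have "{r, r'} \<subseteq> incident K u \<inter> l" by simp
  then have r1: "r \<in> incident K u" "r' \<in> incident K u" "r \<in> l" "r' \<in> l" by simp_all
  have "\<exists>x\<in>I. x \<in> r"
  proof (rule ccontr)
    assume n: "\<not> (\<exists>x\<in>I. x \<in> r)"
    obtain p q where "r = closed_segment p q" using dual_edge_segment[OF incidentD(4)[OF r1(1)]] .
    then have c: "chord p q" "chord q p"
      using chord_of_edge[OF incidentD(4)[OF r1(1)]] n chord_commute by blast+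
    have "\<exists>x\<in>u. side p q x \<noteq> 0" using triangle_off_line[OF uv(3) chord_midpoint(4)[OF c(1)]] .
    then have "(\<exists>x\<in>u. side p q x > 0) \<or> (\<exists>x\<in>u. side q p x > 0)"
      using side_swap[of q p] by force
    then obtain p q where pq: "chord p q" "r = closed_segment p q" "\<exists>x\<in>u. side p q x > 0"
      using c \<open>r = closed_segment p q\<close> closed_segment_commute by metis
    have "\<exists>x\<in>r. side p q x > 0"
    proof (rule constant_on_edge[where Q = "\<lambda>s. \<exists>x\<in>s. side p q x > 0", OF l(1) _ r1(4,3)])
      show "\<exists>x\<in>r'. side p q x > 0"
        using chord_edge_pos[OF pq(1) uv(3) incidentD(3)[OF r1(2)]] r(2) pq by blast
    next
      fix T s t
      assume T: "T \<in> nodes K - nodes G" "s \<in> incident K T" "t \<in> incident K T" "\<exists>x\<in>s. side p q x > 0"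
      have Tp: "\<exists>x\<in>T. side p q x > 0" using T(4) edge_of_imp_subset[OF incidentD(3)[OF T(2)]] by blast
      \<comment> \<open>The triangle across \<open>r\<close> from \<open>u\<close> is on the other
        side.\<close>
      have "t \<noteq> r"
      proof
        assume "t = r"
        then show False
          using chord_opposite[OF pq(1) uv(3) incidentD(2)[OF T(2)]] T uv(1) pq incidentD(3)[OF r1(1)] incidentD(3)[OF T(3)] Tp
          by blast
      qed
      then show "\<exists>x\<in>t. side p q x > 0"
        using chord_edge_pos[OF pq(1) incidentD(2,3)[OF T(3)]] pq(2) Tp by blast
    qed
    then show False using pq(2) side_segment_zero by force
  qed
  then obtain y where y: "y \<in> I" "y \<in> r" by blast
  have yu: "y \<in> u" using y(2) edge_of_imp_subset[OF incidentD(3)[OF r1(1)]] by blast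
  have "side a b y \<noteq> 0"
  proof
    assume "side a b y = 0"
    then have "y \<in> closed_segment a b" using chord_line[OF chord_ab] interior_latticeD y by blast
    then show False using stem_interior_free[OF chord_e y(1)] by blast
  qed
  then show ?thesis using u_nonneg[OF yu] yu y by force
qed

text \<open>Edges at \<open>y\<close> reach beyond the chord, so they belong to \<open>e\<close> or
  \<open>l\<close>, and those in \<open>e\<close> contain no interior lattice point.\<close>

lemma positive_point_region:
  assumes y: "y \<in> I" "side a b y > 0"
  shows "region_boundary G y = {l}" "\<And>r. r \<in> l \<Longrightarrow> y \<in> r"
proof -
  have sub: "e' = l" if e': "e' \<in> edges G" "s \<in> e'" "y \<in> s" for e' s
  proof -
    have "e' \<in> {e, l}" using positive_edge[OF e'(1,2)] y(2) e'(3) by blast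
    moreover have "e' \<noteq> e" using stem_interior_free[OF _ y(1)] e'(2,3) by blast
    ultimately show ?thesis by simp
  qed
  obtain T where T: "T \<in> \<Delta>" "y \<in> T" using interior_latticeD(3)[OF y(1)] Union_\<Delta> by blast
  have "card {s \<in> incident K T. y \<in> s} = 2" using interior_edges[OF T(1) y(1) T(2)] .
  then have "{s \<in> incident K T. y \<in> s} \<noteq> {}" by (metis card.empty zero_neq_numeral)
  then obtain s where s: "s \<in> incident K T" "y \<in> s" by blast
  obtain e' where e': "e' \<in> edges G" "s \<in> e'" using edge_class[OF incidentD(5)[OF s(1)]] .
  then have "s \<in> l" using sub s(2) by blast
  then show "region_boundary G y = {l}" using sub l(1) s(2) unfolding region_boundary_def by blast
  show "\<And>r. r \<in> l \<Longrightarrow> y \<in> r" using region_constant[OF l(1) y(1) \<open>s \<in> l\<close> _ s(2)] by blast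
qed

text \<open>Two such points would both lie on both loop edges of \<open>u\<close>. An edge of
  \<Delta> contains only two lattice points, so these two edges would coincide.\<close>

lemma positive_interior_point_unique: "\<exists>!y. y \<in> I \<and> side a b y > 0"
proof -
  obtain r r' where r: "incident K u \<inter> l = {r, r'}" "r \<noteq> r'" using loop_edges .
  have "y = y'" if y: "y \<in> I" "side a b y > 0" "y' \<in> I" "side a b y' > 0" for y y'
  proof (rule ccontr)
    assume ne: "y \<noteq> y'"
    have "t = closed_segment y y'" if t: "t \<in> incident K u \<inter> l" for t
    proof -
      have in_t: "y \<in> t" "y' \<in> t"
        using positive_point_region(2)[OF y(1,2)] positive_point_region(2)[OF y(3,4)] t by simp_all
      obtain p q where pq: "t = closed_segment p q" "closed_segment p q edge_of u"
      proof -
        have "t edge_of u" using incidentD(3)[of t u] t by simp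
        then show ?thesis using that edge_iff[OF uv(3)] by metis
      qed
      have "{y, y'} \<subseteq> t \<inter> L" using in_t interior_latticeD(2) y(1,3) by simp
      then have "{y, y'} \<subseteq> {p, q}" using edge_lattice[OF uv(3) pq(2)] pq(1) by simp
      then show ?thesis using ne pq(1) closed_segment_commute by auto
    qed
    then show False using r by blast
  qed
  then show ?thesis using loop_interior_point by blast
qed

text \<open>The triangle across the chord has an edge at \<open>y\<close>, which is not in
  \<open>e\<close>, so it is not contracted and must be \<open>u\<close>. Hence the stem has a
  single edge, which later determines the split edge completely.\<close>

lemma stem_eq_singleton:
  assumes T: "T \<in> \<Delta>" "T \<noteq> v" "closed_segment a b edge_of T" and y: "y \<in> I" "y \<in> T"
  shows "e = {closed_segment a b}"
proof -
  have cK: "closed_segment a b \<in> edges K" using incidentD(5)[OF chord_v] .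
  then have cT: "closed_segment a b \<in> incident K T" using incident_iff T by blast
  have "card {s \<in> incident K T. y \<in> s} = 2" using interior_edges[OF T(1) y] .
  then have "{s \<in> incident K T. y \<in> s} \<noteq> {}" by (metis card.empty zero_neq_numeral)
  then obtain s where s: "s \<in> incident K T" "y \<in> s" by blast
  have "s \<notin> e" using stem_interior_free[OF _ y(1)] s(2) by blast
  have TG: "T \<in> nodes G"
  proof (rule ccontr)
    assume "T \<notin> nodes G"
    then have "incident K T \<subseteq> e"
      using removed_class[of T "closed_segment a b" e] incidentD(1)[OF cT] cT chord_e e(1) by blast
    then show False using s(1) \<open>s \<notin> e\<close> by blast
  qed
  have "T = u" using positive_node[OF TG across_positive[OF T]] .
  have "t = closed_segment a b" if t: "t \<in> e" for t
  proof (rule constant_on_edge[where Q = "\<lambda>s. s = closed_segment a b", OF e(1) _ chord_e t])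
    show "closed_segment a b = closed_segment a b" by simp
  next
    fix R s t
    assume R: "R \<in> nodes K - nodes G" "s \<in> incident K R" "s = closed_segment a b"
    have "R \<in> \<Delta>" "closed_segment a b edge_of R" using incidentD[OF R(2)] R(3) by auto
    moreover have "R \<noteq> v" "R \<noteq> T" using R(1) uv(2) TG by auto
    ultimately show "t = closed_segment a b"
      using chord_opposite[OF chord_ab T(1) \<open>R \<in> \<Delta>\<close>] across_positive T by blast
  qed
  then show ?thesis using chord_e by blast
qed

lemma across_triangle:
  assumes "side a b z < 0" "z \<in> v" "z \<in> L"
  obtains T c where "T \<in> \<Delta>" "T \<noteq> v" "closed_segment a b edge_of T" "c \<in> T" "c \<in> L" "side a b c = 1"
proof -
  have E: "closed_segment a b \<in> edges \<Gamma>" using incidentD(4)[OF chord_v] .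
  obtain T T' c c' where T: "T \<in> \<Delta>" "T' \<in> \<Delta>" "T = convex hull {a, b, c}" "side a b c = 1"
    "T' = convex hull {a, b, c'}" "side a b c' = -1" "{a, b, c, c'} \<subseteq> L"
    "{R \<in> \<Delta>. closed_segment a b edge_of R} = {T, T'}"
    using dual_edge[OF E] .
  have cT: "c \<in> T" using T(3) by (simp add: hull_inc)
  have "T \<noteq> v"
  proof
    assume "T = v"
    moreover have "side a b c > 0" using T(4) by simp
    ultimately show False using v_not_positive cT by blast
  qed
  then show thesis using that[of T c] T cT by blast
qed

end

context trivalent_skeleton begin

text \<open>The edge of \<open>v\<close> on the cycle contains \<open>z\<close>, while that in
  \<open>e\<close> does not, so the latter is the side of the triangle opposite to
  \<open>z\<close>.\<close>

lemma tripod_chord: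
  assumes z: "z \<in> I" and v: "v \<in> nodes G"
    and b: "b \<in> region_boundary G z" "v \<in> ends G b"
    and e: "e \<in> edges G" "e \<notin> region_boundary G z" "v \<in> ends G e"
  obtains p q where "v = convex hull {z, p, q}" "v \<inter> L = {z, p, q}" "side p q z = -1" "{z, p, q} \<subseteq> L"
    "closed_segment p q \<in> e" "closed_segment p q \<in> incident K v" "p \<noteq> z" "q \<noteq> z" "p \<noteq> q"
proof -
  have v\<Delta>: "v \<in> \<Delta>" using v nodes_subset by auto
  have zL: "z \<in> L" using interior_latticeD z by blast
  obtain s where s: "b \<in> edges G" "s \<in> b" "z \<in> s" using b(1) unfolding region_boundary_def by blast
  obtain r where r: "r \<in> incident K v" "r \<in> b" using incident_class[OF v s(1) b(2)] .
  have "z \<in> r" using region_constant[OF s(1) z s(2) r(2) s(3)] .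
  then have zv: "z \<in> v" using edge_of_imp_subset[OF incidentD(3)[OF r(1)]] by blast
  then have zvL: "z \<in> v \<inter> L" using zL by simp
  obtain p q where pq: "p \<in> L" "q \<in> L" "p \<noteq> z" "q \<noteq> z" "p \<noteq> q" "v = convex hull {z, p, q}"
    "\<bar>side z p q\<bar> = 1" "v \<inter> L = {z, p, q}"
    using lattice_vertices[OF v\<Delta> zvL] .
  obtain t where t: "t \<in> incident K v" "t \<in> e" using incident_class[OF v e(1,3)] .
  have "z \<notin> t" using e(1,2) t(2) unfolding region_boundary_def by blast
  then have t_eq: "t = closed_segment p q"
    using edges_at_vertex(3)[OF v\<Delta> pq(8) pq(3)[symmetric] pq(4)[symmetric] pq(5)] incidentD(3)[OF t(1)] by blast
  show thesis
  proof (cases "side p q z = -1")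
    case True
    then show thesis using that[of p q] pq t t_eq zL by auto
  next
    case False
    then have "side q p z = -1" using pq(7) by (simp add: side_def algebra_simps)
    then show thesis
      using that[of q p] pq t t_eq zL by (auto simp: insert_commute closed_segment_commute)
  qed
qed

text \<open>If both coordinates of \<open>r\<close> were positive, the segment from \<open>z\<close>
  to \<open>r\<close> in \<open>T'\<close> would cross the open edge between \<open>p\<close> and
  \<open>q\<close> of \<open>T\<close>; the face property would put \<open>p\<close> and
  \<open>q\<close> into \<open>T'\<close>, so \<open>T = T'\<close>. On the axes
  \<open>cap_axis\<close> leaves only \<open>p\<close> and \<open>q\<close>.\<close>

lemma cone_vertex:
  assumes cap: "cap P z p q" and T: "T \<in> \<Delta>" "T' \<in> \<Delta>" "T \<noteq> T'" "T = convex hull {z, p, q}" "T \<inter> L = {z, p, q}"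
    and r: "r \<in> T' \<inter> L" "r \<noteq> z" "z \<in> T'" "in_cone z p q r"
  shows "r \<in> {p, q}"
proof -
  have rP: "r \<in> P" "r \<in> L" using r(1) triangle_subset_P[OF T(2)] by auto
  have nz: "side z p q \<noteq> 0" using cap by (auto simp: cap_def)
  obtain i j :: int where ij: "r = lattice_comb z p q i j" using cap_lattice_point[OF cap rP] .
  obtain i' j' where "0 \<le> i'" "0 \<le> j'" "r = lattice_comb z p q i' j'"
    using r(4) unfolding in_cone_def by auto
  then have ge: "0 \<le> i" "0 \<le> j" using lattice_comb_inject[OF nz, of i j i' j'] ij by auto
  consider "i = 0" | "j = 0" | "i \<ge> 1" "j \<ge> 1" using ge by linarith
  then show ?thesis
  proof cases
    case 1
    then have "j \<le> 1" using cap_axis(1)[OF cap rP(1), of j] ij by simp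
    moreover have "j \<noteq> 0" using r(2) ij 1 by (auto simp: lattice_comb_def)
    ultimately have "j = 1" using ge by linarith
    then show ?thesis using ij 1 by (simp add: lattice_comb_def)
  next
    case 2
    then have "i \<le> 1"
      using cap_axis(1)[OF cap_commute[THEN iffD1, OF cap] rP(1), of i] ij lattice_comb_swap[of z p q] by simp
    moreover have "i \<noteq> 0" using r(2) ij 2 by (auto simp: lattice_comb_def)
    ultimately have "i = 1" using ge by linarith
    then show ?thesis using ij 2 by (simp add: lattice_comb_def)
  next
    case 3
    define ri rj where "ri = real_of_int i" "rj = real_of_int j"
    have rij: "ri \<ge> 1" "rj \<ge> 1" using 3 by (auto simp: ri_rj_def)
    \<comment> \<open>Scaling by \<open>1 / (i + j)\<close> moves \<open>r\<close> onto the line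
      \<open>i + j = 1\<close> through \<open>p\<close> and \<open>q\<close>.\<close>
    define m where "m = (1 - 1 / (ri + rj)) *\<^sub>R z + (1 / (ri + rj)) *\<^sub>R r"
    have "m \<in> T'" unfolding m_def
      by (intro convexD compact_triangle(2)[OF T(2)]) (use r rij in \<open>auto simp: divide_simps\<close>)
    have m_eq: "m = (1 - rj / (ri + rj)) *\<^sub>R p + (rj / (ri + rj)) *\<^sub>R q"
      unfolding m_def ij ri_rj_def[symmetric] using rij
      by (simp add: vec_eq_iff lattice_comb_nth divide_simps) (simp add: algebra_simps)
    have "p \<noteq> q" using nz by auto
    then have mo: "m \<in> open_segment p q"
      unfolding m_eq by (intro open_segmentI) (use rij in \<open>auto simp: divide_simps\<close>)
    have pqT: "p \<in> T" "q \<in> T" using T(5) by auto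
    have "m \<in> T"
      using mo convex_contains_open_segment compact_triangle(2)[OF T(1)] pqT by blast
    then have "p \<in> T'" "q \<in> T'"
      using Int_face_of[OF T(1,2)] \<open>m \<in> T'\<close> mo pqT unfolding face_of_def by blast+
    then have "T = T'" using triangle_eqI[OF T(1,2)] r(3) unfolding T(5) by blast
    then show ?thesis using T(3) by simp
  qed
qed

lemma skeleton_ends_K:
  assumes "s \<in> edges K" "T \<in> \<Delta>" "s edge_of T"
  shows "T \<in> nodes K" "s \<in> incident K T"
  using assms pruned by (auto simp: pruned_def incident_def dual_graph_def)

end

lemma trivalent_skeleton_exists:
  assumes P: "lattice_polygon P" "unimodular_triangulation \<Delta> P" and "skeleton \<Delta> G" "trivalent G"
  obtains K where "trivalent_skeleton P \<Delta> K G"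
proof -
  interpret unimodular_polygon P \<Delta> using P by unfold_locales
  obtain K where K: "prune_step\<^sup>*\<^sup>* \<Gamma> K" "\<forall>v\<in>nodes K. node_degree K v \<noteq> 1"
    "smooth_step\<^sup>*\<^sup>* (singleton_edges K) G"
    using assms(3) unfolding skeleton_def by blast
  have pr: "pruned K" using pruned_rtranclp[OF K(1)] .
  have "smoothing K G"
  proof (rule smoothing_rtranclp[OF K(3)])
    show "finite (edges K)" using pr finite_edges_dual by (auto simp: pruned_def)
    show "ends K s \<noteq> {} \<and> ends K s \<subseteq> nodes K" if "s \<in> edges K" for s
      using that pr by (auto simp: pruned_def dual_graph_def)
    fix s v assume "s \<in> edges K"
    then have "s \<in> edges \<Gamma>" "ends K s = ends \<Gamma> s" using pr by (auto simp: pruned_def)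
    moreover from this obtain T T' where "T \<in> \<Delta>" "T' \<in> \<Delta>" "T \<noteq> T'" "s edge_of T" "s edge_of T'"
      unfolding dual_graph_def by auto
    then have "{T, T'} \<subseteq> ends \<Gamma> s" by (simp add: dual_graph_def)
    ultimately show "ends K s \<noteq> {v}" using \<open>T \<noteq> T'\<close> by auto
  qed
  then show thesis using that[of K] pr K(2) assms(4)
    by (simp add: trivalent_skeleton_def trivalent_skeleton_axioms_def unimodular_polygon_axioms)
qed

section \<open>The graph data of a heavy cycle\<close>

locale heavy_skeleton = trivalent_skeleton +
  fixes C :: "(real^2) set set set" and e1 e2 :: "(real^2) set set"
    and G3 :: "((real^2) set, (real^2) set set) multigraph" and z :: "real^2"
    and v1 v2 u1 u2 x1 x2 :: "(real^2) set" and l1 l2 b f1 f2 :: "(real^2) set set"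
    and vs :: "(real^2) set list" and es :: "(real^2) set set list"
  assumes nodes4: "distinct [v1, v2, u1, u2]" "{v1, v2, u1, u2} \<subseteq> nodes G"
    and edges7: "distinct [b, f1, f2, e1, e2, l1, l2]" "{b, f1, f2, e1, e2, l1, l2} \<subseteq> edges G"
    and ends_el: "ends G e1 = {v1, u1}" "ends G l1 = {u1}" "ends G e2 = {v2, u2}" "ends G l2 = {u2}"
    and G3: "G3 = G\<lparr>nodes := nodes G - {v1, v2, u1, u2}, edges := edges G - {b, f1, f2, e1, e2, l1, l2}\<rparr>"
    and conn: "connected_graph G3" and genus: "graph_genus G3 > 0"
    and ends_bf: "ends G b = {v1, v2}" "ends G f1 = {v1, x1}" "ends G f2 = {v2, x2}"
    and path: "is_path G3 x1 vs es x2" and C: "C = {b, f1, f2} \<union> set es" "C = region_boundary G z"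
    and z: "z \<in> I"
begin

lemma G3_sel: "nodes G3 = nodes G - {v1, v2, u1, u2}" "edges G3 = edges G - {b, f1, f2, e1, e2, l1, l2}"
  "ends G3 = ends G"
  by (simp_all add: G3)

lemma path_facts: "set es \<subseteq> edges G3" "set vs \<subseteq> nodes G3" "distinct vs" "length vs = length es + 1"
  "x1 \<in> nodes G3" "x2 \<in> nodes G3"
proof -
  show p: "set es \<subseteq> edges G3" "set vs \<subseteq> nodes G3" "distinct vs" "length vs = length es + 1"
    using path by (simp_all add: is_path_def)
  have "vs \<noteq> []" using p(4) by auto
  then have "hd vs \<in> set vs" "last vs \<in> set vs" by auto
  moreover have "hd vs = x1" "last vs = x2" using path by (simp_all add: is_path_def)
  ultimately show "x1 \<in> nodes G3" "x2 \<in> nodes G3" using p(2) by blast+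
qed

lemma e_notin_C: "e1 \<notin> C" "e2 \<notin> C"
proof -
  have "set es \<inter> {e1, e2} = {}" using path_facts(1) unfolding G3_sel by blast
  moreover have "{b, f1, f2} \<inter> {e1, e2} = {}" using edges7(1) by auto
  ultimately have "C \<inter> {e1, e2} = {}" unfolding C(1) by blast
  then show "e1 \<notin> C" "e2 \<notin> C" by blast+
qed

lemma in_C: "b \<in> C" "f1 \<in> C" "f2 \<in> C"
  by (simp_all add: C(1))

lemma edge_facts: "b \<in> edges G" "f1 \<in> edges G" "f2 \<in> edges G" "e1 \<in> edges G" "e2 \<in> edges G"
    "l1 \<in> edges G" "l2 \<in> edges G" "f1 \<noteq> e1" "b \<noteq> e1" "e2 \<noteq> e1" "f2 \<noteq> e2" "b \<noteq> e2" "e1 \<noteq> e2"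
    "e1 \<notin> edges G3" "e2 \<notin> edges G3" "edges G3 \<subseteq> edges G" "b \<noteq> f1" "b \<noteq> f2"
    "v1 \<in> nodes G" "v2 \<in> nodes G" "u1 \<in> nodes G" "u2 \<in> nodes G" "v1 \<noteq> u1" "v2 \<noteq> u2" "v1 \<noteq> v2"
proof -
  show "b \<in> edges G" "f1 \<in> edges G" "f2 \<in> edges G" "e1 \<in> edges G" "e2 \<in> edges G"
    "l1 \<in> edges G" "l2 \<in> edges G"
    using edges7(2) by (simp_all only: insert_subset)
  show "f1 \<noteq> e1" "b \<noteq> e1" "e2 \<noteq> e1" "f2 \<noteq> e2" "b \<noteq> e2" "e1 \<noteq> e2" "b \<noteq> f1" "b \<noteq> f2"
    using edges7(1) by auto
  show "e1 \<notin> edges G3" "e2 \<notin> edges G3" "edges G3 \<subseteq> edges G"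
    unfolding G3_sel by blast+
  show "v1 \<in> nodes G" "v2 \<in> nodes G" "u1 \<in> nodes G" "u2 \<in> nodes G"
    using nodes4(2) by (simp_all only: insert_subset)
  show "v1 \<noteq> u1" "v2 \<noteq> u2" "v1 \<noteq> v2"
    using nodes4(1) by auto
qed

lemma lobe1:
  assumes "F \<subseteq> nodes G" "v1 \<notin> F"
    "\<And>e'. e' \<in> edges G \<Longrightarrow> e' \<noteq> e1 \<Longrightarrow> ends G e' \<inter> F \<noteq> {} \<Longrightarrow> ends G e' \<subseteq> F"
  shows "F \<subseteq> {u1}"
  using conn edge_facts(16,14) G3_sel(3,1) path_facts(5) edge_facts(2,8) ends_bf(2)
    edge_facts(1,9) ends_bf(1) edge_facts(5,10) ends_el(3) assms
  by (rule heavy_lobe)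

lemma lobe2:
  assumes "F \<subseteq> nodes G" "v2 \<notin> F"
    "\<And>e'. e' \<in> edges G \<Longrightarrow> e' \<noteq> e2 \<Longrightarrow> ends G e' \<inter> F \<noteq> {} \<Longrightarrow> ends G e' \<subseteq> F"
  shows "F \<subseteq> {u2}"
proof -
  have b: "ends G b = {v2, v1}" "nodes G3 = nodes G - {v2, v1, u2, u1}"
    unfolding ends_bf(1) G3_sel(1) by blast+
  show ?thesis
    using conn edge_facts(16,15) G3_sel(3) b(2) path_facts(6) edge_facts(3,11) ends_bf(3)
      edge_facts(1,12) b(1) edge_facts(4,13) ends_el(1) assms
    by (rule heavy_lobe)
qed

lemma lobe1_obtain:
  obtains p q where "skeleton_lobe P \<Delta> K G e1 l1 v1 u1 p q" "v1 = convex hull {z, p, q}"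
    "v1 \<inter> L = {z, p, q}" "side p q z = -1" "{z, p, q} \<subseteq> L"
proof -
  have v: "v1 \<in> nodes G" "v1 \<in> ends G b" "e1 \<in> edges G" "v1 \<in> ends G e1"
    using edge_facts ends_bf ends_el by simp_all
  obtain p q where pq: "v1 = convex hull {z, p, q}" "v1 \<inter> L = {z, p, q}" "side p q z = -1" "{z, p, q} \<subseteq> L"
    "closed_segment p q \<in> e1" "closed_segment p q \<in> incident K v1" "p \<noteq> z" "q \<noteq> z" "p \<noteq> q"
    using tripod_chord[OF z v(1) in_C(1)[unfolded C(2)] v(2,3) e_notin_C(1)[unfolded C(2)] v(4)] .
  have zv: "z \<in> v1" "side p q z < 0" using pq(1,3) by (auto simp: hull_inc)
  have "skeleton_lobe P \<Delta> K G e1 l1 v1 u1 p q"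
  proof unfold_locales
    show "e1 \<in> edges G" "l1 \<in> edges G" "v1 \<noteq> u1" by (rule edge_facts)+
    show "ends G e1 = {v1, u1}" "ends G l1 = {u1}" by (rule ends_el)+
    show "closed_segment p q \<in> e1" "closed_segment p q \<in> incident K v1" by (rule pq)+
    show "\<exists>x\<in>v1. side p q x < 0" using zv by blast
    fix F assume "F \<subseteq> nodes G" "v1 \<notin> F"
      "\<And>e'. e' \<in> edges G \<Longrightarrow> e' \<noteq> e1 \<Longrightarrow> ends G e' \<inter> F \<noteq> {} \<Longrightarrow> ends G e' \<subseteq> F"
    then show "F \<subseteq> {u1}" by (rule lobe1)
  qed
  then show thesis using that pq by blast
qed

lemma lobe2_obtain:
  obtains p q where "skeleton_lobe P \<Delta> K G e2 l2 v2 u2 p q" "v2 = convex hull {z, p, q}"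
    "v2 \<inter> L = {z, p, q}" "side p q z = -1" "{z, p, q} \<subseteq> L"
proof -
  have v: "v2 \<in> nodes G" "v2 \<in> ends G b" "e2 \<in> edges G" "v2 \<in> ends G e2"
    using edge_facts ends_bf ends_el by simp_all
  obtain p q where pq: "v2 = convex hull {z, p, q}" "v2 \<inter> L = {z, p, q}" "side p q z = -1" "{z, p, q} \<subseteq> L"
    "closed_segment p q \<in> e2" "closed_segment p q \<in> incident K v2" "p \<noteq> z" "q \<noteq> z" "p \<noteq> q"
    using tripod_chord[OF z v(1) in_C(1)[unfolded C(2)] v(2,3) e_notin_C(2)[unfolded C(2)] v(4)] .
  have zv: "z \<in> v2" "side p q z < 0" using pq(1,3) by (auto simp: hull_inc)
  have "skeleton_lobe P \<Delta> K G e2 l2 v2 u2 p q"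
  proof unfold_locales
    show "e2 \<in> edges G" "l2 \<in> edges G" "v2 \<noteq> u2" by (rule edge_facts)+
    show "ends G e2 = {v2, u2}" "ends G l2 = {u2}" by (rule ends_el)+
    show "closed_segment p q \<in> e2" "closed_segment p q \<in> incident K v2" by (rule pq)+
    show "\<exists>x\<in>v2. side p q x < 0" using zv by blast
    fix F assume "F \<subseteq> nodes G" "v2 \<notin> F"
      "\<And>e'. e' \<in> edges G \<Longrightarrow> e' \<noteq> e2 \<Longrightarrow> ends G e' \<inter> F \<noteq> {} \<Longrightarrow> ends G e' \<subseteq> F"
    then show "F \<subseteq> {u2}" by (rule lobe2)
  qed
  then show thesis using that pq by blast
qed

lemma node_edges:
  "{e' \<in> edges G. v1 \<in> ends G e'} = {b, f1, e1}" "{e' \<in> edges G. v2 \<in> ends G e'} = {b, f2, e2}"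
  "{e' \<in> edges G. u1 \<in> ends G e'} = {e1, l1}" "{e' \<in> edges G. u2 \<in> ends G e'} = {e2, l2}"
proof -
  show "{e' \<in> edges G. v1 \<in> ends G e'} = {b, f1, e1}"
    by (rule tripod_node_edges) (simp_all add: edge_facts(1,2,4,8,9,17,19) ends_bf ends_el)
  show "{e' \<in> edges G. v2 \<in> ends G e'} = {b, f2, e2}"
    by (rule tripod_node_edges) (simp_all add: edge_facts(1,3,5,11,12,18,20) ends_bf ends_el)
  show "{e' \<in> edges G. u1 \<in> ends G e'} = {e1, l1}"
    by (rule loop_node_edges)
      (simp_all add: edge_facts(4,6,21) ends_el edge_facts(23) edge_facts(23)[symmetric])
  show "{e' \<in> edges G. u2 \<in> ends G e'} = {e2, l2}"
    by (rule loop_node_edges)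
      (simp_all add: edge_facts(5,7,22) ends_el edge_facts(24) edge_facts(24)[symmetric])
qed

end

section \<open>Heavy cycles\<close>

context heavy_skeleton begin

lemma region_edge:
  assumes "e \<in> edges G" "s \<in> e" "x \<in> s" shows "e \<in> region_boundary G x"
  using assms unfolding region_boundary_def by blast

text \<open>If all interior lattice points other than \<open>z\<close> were dual to the two loops, the edges of \<open>G3\<close>
  outside \<open>C\<close> would consist of chords.  A chord farthest from \<open>z\<close> would lead to a leaf, so
  \<open>G3\<close> would be contained in the path \<open>es\<close> and have genus zero.\<close>

lemma third_interior_point:
  assumes lobe: "\<And>x. x \<in> I \<Longrightarrow> Q x \<Longrightarrow> region_boundary G x \<subseteq> {l1, l2}"
  shows "\<exists>y\<in>I. y \<noteq> z \<and> \<not> Q y"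
proof (rule ccontr)
  assume none: "\<not> ?thesis"
  define E where "E = edges G3 - C"
  have E_G: "e \<in> edges G" if "e \<in> E" for e using that edge_facts(16) by (auto simp: E_def)
  have free: "x \<notin> s" if e: "e \<in> E" "s \<in> e" and x: "x \<in> I" for e s x
  proof
    assume xs: "x \<in> s"
    have r: "e \<in> region_boundary G x" by (rule region_edge[OF E_G[OF e(1)] e(2) xs])
    show False
    proof (cases "x = z")
      case True
      then show False using r e(1) C(2) by (simp add: E_def)
    next
      case False
      then have "Q x" using none x by blast
      then have "e \<in> {l1, l2}" using lobe[OF x] r by blast
      then show False using e(1) unfolding E_def G3_sel by blast
    qed
  qed
  have chordE: "chord a b" if "e \<in> E" "closed_segment a b \<in> e" for e a b
  proof (rule chord_of_edge[OF _ _ refl])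
    show "closed_segment a b \<in> edges \<Gamma>" using that E_G edges_subset by blast
    show "x \<notin> closed_segment a b" if "x \<in> I" for x
      using free[OF \<open>e \<in> E\<close> \<open>closed_segment a b \<in> e\<close> that] .
  qed
  \<comment> \<open>Induction on the number of triangles beyond the chord: every chord of
    \<open>E\<close> produces another one with fewer triangles beyond it.\<close>
  have no: False if "e \<in> E" "closed_segment a b \<in> e" "side a b z < 0" for e a b
    using that
  proof (induction "card {T \<in> \<Delta>. \<exists>x\<in>T. side a b x > 0}" arbitrary: e a b rule: less_induct)
    case less
    define s where "s = closed_segment a b"
    have eE: "e \<in> E" and se: "s \<in> e" and neg: "side a b z < 0" using less.prems by (simp_all add: s_def)
    have ch: "chord a b" using chordE less.prems(1,2) .
    have sK: "s \<in> edges K" using edges_subset(2)[OF E_G[OF eE]] se by blast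
    have E\<Gamma>: "closed_segment a b \<in> edges \<Gamma>" using ch by (simp add: chord_def)
    obtain T T' c c' where T: "T \<in> \<Delta>" "T' \<in> \<Delta>" "T = convex hull {a, b, c}" "side a b c = 1"
      "T' = convex hull {a, b, c'}" "side a b c' = -1" "{a, b, c, c'} \<subseteq> L"
      "{R \<in> \<Delta>. closed_segment a b edge_of R} = {T, T'}"
      using dual_edge[OF E\<Gamma>] .
    have sT: "s edge_of T" using T(8) unfolding s_def by blast
    have TK: "T \<in> nodes K" "s \<in> incident K T" using skeleton_ends_K[OF sK T(1) sT] .
    have "c \<in> T" using T(3) by (simp add: hull_inc)
    have "side a b c > 0" using T(4) by simp
    then have Tpos: "\<exists>x\<in>T. side a b x > 0" using \<open>c \<in> T\<close> by blast
    then have Tge: "\<forall>x\<in>T. side a b x \<ge> 0" using chord_one_sided[OF ch T(1)] by force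
    \<comment> \<open>Otherwise \<open>T\<close>, the triangle beyond the chord, would be a leaf,
      and pruning left none.\<close>
    have "incident K T \<noteq> {s}"
    proof
      assume eq: "incident K T = {s}"
      have "{e \<in> edges K. ends K e = {T}} = {}"
      proof (rule ccontr)
        assume "{e \<in> edges K. ends K e = {T}} \<noteq> {}"
        then obtain r where r: "r \<in> edges K" "ends K r = {T}" by blast
        then have "r = s" using eq unfolding incident_def by blast
        moreover have "T' \<in> ends K s"
          using skeleton_ends_K(2)[OF sK T(2)] T(8) unfolding s_def incident_def by blast
        ultimately have "T' = T" using r(2) by blast
        moreover have "c' \<in> T'" unfolding T(5) by (simp add: hull_inc)
        ultimately have "side a b c' \<ge> 0" using Tge by blast
        then show False using T(6) by simp
      qed
      then have "card {e \<in> edges K. ends K e = {T}} = 0" by (metis card.empty)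
      then have "node_degree K T = 1" using eq unfolding node_degree_def incident_def by simp
      then show False using no_leaf[OF TK(1)] by simp
    qed
    then obtain s' where s': "s' \<in> incident K T" "s' \<noteq> s" using TK(2) by blast
    have s'T: "s' edge_of T" using incidentD(3)[OF s'(1)] .
    obtain e' where e': "e' \<in> edges G" "s' \<in> e'" using edge_class[OF incidentD(5)[OF s'(1)]] .
    have "z \<notin> T" using Tge neg by force
    then have zs': "z \<notin> s'" using edge_of_imp_subset[OF s'T] by blast
    have e'C: "e' \<notin> C"
    proof
      assume "e' \<in> C"
      then obtain r where "r \<in> e'" "z \<in> r" unfolding C(2) region_boundary_def by blast
      then show False using region_constant[OF e'(1) z _ e'(2)] zs' by blast
    qed
    have eG3: "e \<in> edges G3" using eE by (simp add: E_def)
    \<comment> \<open>If \<open>e'\<close> were a stem or a loop, the class would change at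
      \<open>T\<close>, so \<open>T\<close> would be one of the four nodes \<open>v1\<close>,
      \<open>v2\<close>, \<open>u1\<close>, \<open>u2\<close>; their edges are all known, and none
      is in \<open>E\<close>.\<close>
    have e'E: "e' \<in> E"
    proof (rule ccontr)
      assume "e' \<notin> E"
      then have e'4: "e' \<in> {e1, e2, l1, l2}" using e'(1) e'C in_C unfolding E_def G3_sel by blast
      have ee': "e \<noteq> e'" using e'4 eG3 unfolding G3_sel by blast
      show False
      proof (cases "T \<in> nodes G")
        case False
        then have "incident K T \<subseteq> e" using removed_class[OF _ TK(2) se E_G[OF eE]] TK(1) by blast
        then show False using edge_class_unique[OF E_G[OF eE] e'(1) _ e'(2)] s'(1) ee' by blast
      next
        case True
        have Te: "T \<in> ends G e" using class_incident[OF True E_G[OF eE] TK(2) se] .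
        have "T \<in> ends G e'" using class_incident[OF True e'(1) s'(1) e'(2)] .
        then have "T \<in> {v1, v2, u1, u2}" using e'4 ends_el by auto
        then have "e \<in> {e' \<in> edges G. v1 \<in> ends G e'} \<union> {e' \<in> edges G. v2 \<in> ends G e'} \<union>
            {e' \<in> edges G. u1 \<in> ends G e'} \<union> {e' \<in> edges G. u2 \<in> ends G e'}"
          using Te E_G[OF eE] by auto
        then show False unfolding node_edges using eE in_C unfolding E_def G3_sel by blast
      qed
    qed
    obtain p q where pq: "s' = closed_segment p q" using dual_edge_segment[OF incidentD(4)[OF s'(1)]] .
    have "closed_segment p q \<in> e'" using e'(2) pq by simp
    then have chp: "chord p q" using chordE[OF e'E] by blast
    have "side p q z \<noteq> 0" using chord_line[OF chp interior_latticeD(3)[OF z]] zs' pq by blast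
    then have "side p q z < 0 \<or> side q p z < 0" using side_swap[of q p z] by linarith
    then obtain p q where pq: "s' = closed_segment p q" "side p q z < 0"
      using pq closed_segment_commute by metis
    have s'e': "closed_segment p q \<in> e'" using e'(2) pq by simp
    then have chp: "chord p q" using chordE[OF e'E] by blast
    \<comment> \<open>The segment from \<open>x\<close> to \<open>z\<close> crosses the new chord in
      a point of \<open>T\<close>, where \<open>side a b\<close> is nonnegative. It is negative at
      \<open>z\<close>, hence positive at \<open>x\<close> by affinity.\<close>
    have beyond: "side a b x > 0" if x: "x \<in> P" "side p q x > 0" for x
    proof -
      obtain w where w: "w \<in> open_segment x z" "side p q w = 0" using side_crossing[OF x(2) pq(2)] .
      then obtain t where t: "0 < t" "t < 1" "w = (1 - t) *\<^sub>R x + t *\<^sub>R z" by (auto simp: in_segment)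
      have "w \<in> P" unfolding t(3) using convexD[OF convex_P x(1) interior_latticeD(3)[OF z]] t by simp
      then have "w \<in> s'" using chord_line[OF chp _ w(2)] pq by blast
      then have "side a b w \<ge> 0" using Tge edge_of_imp_subset[OF s'T] by blast
      then have "(1 - t) * side a b x + t * side a b z \<ge> 0" unfolding t(3) by (simp add: side_convex_comb)
      moreover have "t * side a b z < 0" using t neg by (simp add: mult_pos_neg)
      ultimately have "(1 - t) * side a b x > 0" by linarith
      then show ?thesis using t by (simp add: zero_less_mult_iff)
    qed
    have "\<not> (\<exists>x\<in>T. side p q x > 0)"
    proof
      assume "\<exists>x\<in>T. side p q x > 0"
      then obtain x where x: "x \<in> s" "side p q x > 0"
        using chord_edge_pos[OF chp T(1) sT] s'(2) pq by blast
      have "x \<in> P" using x(1) edge_of_imp_subset[OF sT] triangle_subset_P[OF T(1)] by blast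
      then have "side a b x > 0" using beyond x by blast
      then show False using x(1) side_segment_zero[of x a b] by (simp add: s_def)
    qed
    then have "{R \<in> \<Delta>. \<exists>x\<in>R. side p q x > 0} \<subset> {R \<in> \<Delta>. \<exists>x\<in>R. side a b x > 0}"
      using beyond triangle_subset_P T(1) Tpos by blast
    then have "card {R \<in> \<Delta>. \<exists>x\<in>R. side p q x > 0} < card {R \<in> \<Delta>. \<exists>x\<in>R. side a b x > 0}"
      using finite_\<Delta> by (intro psubset_card_mono) auto
    then show False using less.hyps e'E s'e' pq(2) by blast
  qed
  have "E = {}"
  proof (rule ccontr)
    assume "E \<noteq> {}"
    then obtain e where e: "e \<in> E" by blast
    obtain w where w: "w \<in> ends G e" using ends_nodes[OF E_G[OF e]] by blast
    have "w \<in> nodes G" using w ends_nodes[OF E_G[OF e]] by blast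
    then obtain s where s: "s \<in> incident K w" "s \<in> e" using incident_class[OF _ E_G[OF e] w] by blast
    obtain p q where pq: "s = closed_segment p q" using dual_edge_segment[OF incidentD(4)[OF s(1)]] .
    have in_e: "closed_segment p q \<in> e" "closed_segment q p \<in> e"
      using s(2) unfolding pq closed_segment_commute[of p q] by -
    note chp = chordE[OF e in_e(1)] in_e
    have "side p q z \<noteq> 0"
      using chord_line[OF chp(1) interior_latticeD(3)[OF z]] free[OF e s(2) z] pq by blast
    then have "side p q z < 0 \<or> side q p z < 0" using side_swap[of q p z] by linarith
    then show False using no[OF e] chp by blast
  qed
  \<comment> \<open>Now \<open>G3\<close> has at most \<open>length es\<close> edges but at least
    \<open>length es + 1\<close> nodes.\<close>
  then have "edges G3 \<subseteq> C" by (simp add: E_def)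
  then have "edges G3 \<subseteq> set es" unfolding C(1) using G3_sel(2) by blast
  then have "card (edges G3) \<le> length es" by (meson List.finite_set card_length card_mono le_trans)
  moreover have "length vs \<le> card (nodes G3)"
  proof -
    have "finite (nodes G3)" using nodes_subset(3) finite_\<Delta> finite_subset unfolding G3_sel by blast
    then have "card (set vs) \<le> card (nodes G3)" using path_facts(2) by (rule card_mono)
    then show ?thesis using path_facts(3) by (simp add: distinct_card)
  qed
  ultimately show False using genus path_facts(4) unfolding graph_genus_def by linarith
qed

end

section \<open>Caps at the heavy cycle and the polygon between the chords\<close>

context skeleton_lobe begin

text \<open>The interior point beyond the chord makes \<open>a + b - z\<close> interior by
  \<open>interior_apex\<close>. By \<open>cap_apex\<close> this point is also the third vertex of
  the triangle across the chord, which triggers \<open>stem_eq_singleton\<close>.\<close>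

lemma lobe_cap:
  assumes z: "z \<in> I" "v = convex hull {z, a, b}" "side a b z = -1" "{z, a, b} \<subseteq> L"
  shows "cap P z a b" "side a b (a + b - z) > 0" "a + b - z \<in> I" "e = {closed_segment a b}"
proof -
  obtain y where y: "y \<in> I" "side a b y > 0" using positive_interior_point_unique by blast
  have out: "a \<notin> interior P" "b \<notin> interior P" using chord_ab by (auto simp: chord_def)
  have in_P: "a \<in> P" "b \<in> P" using chord_midpoint(2,3)[OF chord_ab] .
  have D: "\<bar>side z a b\<bar> = 1" using z(3) side_rotate[of a b z] by simp
  have neg: "side a b y / side a b z < 0" using y(2) z(3) by simp
  have apex: "a + b - z \<in> interior P"
    by (rule interior_apex[OF convex_P interior_latticeD(1)[OF z(1)] in_P out D z(4)
          interior_latticeD(1)[OF y(1)] interior_latticeD(2)[OF y(1)] neg])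
  then show cap: "cap P z a b"
    using convex_P interior_latticeD(1)[OF z(1)] in_P out D z(4) unfolding cap_def by blast
  have "side a b (a + b - z) = - side a b z" by (simp add: side_def algebra_simps)
  then show "side a b (a + b - z) > 0" using z(3) by simp
  have "a + b - z \<in> L" using z(4) by (auto simp: lattice_points_def)
  then show I: "a + b - z \<in> I" using apex by (simp add: interior_lattice_points_def)
  have zv: "z \<in> v" unfolding z(2) by (simp add: hull_inc)
  have sz: "side a b z < 0" using z(3) by simp
  obtain T c where T: "T \<in> \<Delta>" "T \<noteq> v" "closed_segment a b edge_of T" "c \<in> T" "c \<in> L" "side a b c = 1"
    using across_triangle[OF sz zv interior_latticeD(2)[OF z(1)]] .
  have "c \<in> P" using T triangle_subset_P by blast
  moreover have "side a b c = - side a b z" using T(6) z(3) by simp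
  ultimately have "c = a + b - z" using cap_apex[OF cap _ T(5)] by blast
  then show "e = {closed_segment a b}" using stem_eq_singleton[OF T(1-3) I] T(4) by blast
qed

lemma positive_interior_point_eq:
  assumes z: "z \<in> I" "v = convex hull {z, a, b}" "side a b z = -1" "{z, a, b} \<subseteq> L"
    and y: "y \<in> I" "side a b y > 0"
  shows "y = a + b - z"
  using positive_interior_point_unique lobe_cap[OF z] y by blast

end

context unimodular_polygon begin

lemma finite_lattice_P: "finite (P \<inter> L)"
proof -
  have "finite (T \<inter> L)" if T_in: "T \<in> \<Delta>" for T
  proof -
    obtain p q r where T: "T = convex hull {p, q, r}" "\<bar>side p q r\<bar> = 1" "{p, q, r} \<subseteq> L"
      "\<not> affine_dependent {p, q, r}" "card {p, q, r} = 3"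
      using unimodular_triangle[OF T_in] .
    then show ?thesis using lattice_points_triangle[OF T(2,3)] by simp
  qed
  then have "finite (\<Union>T\<in>\<Delta>. T \<inter> L)" using finite_\<Delta> by blast
  moreover have "P \<inter> L = (\<Union>T\<in>\<Delta>. T \<inter> L)" using Union_\<Delta> by blast
  ultimately show ?thesis by simp
qed

lemma triangle_hull_lattice:
  assumes "T \<in> \<Delta>" shows "T = convex hull (T \<inter> L)"
proof -
  obtain p q r where T: "T = convex hull {p, q, r}" "\<bar>side p q r\<bar> = 1" "{p, q, r} \<subseteq> L"
    "\<not> affine_dependent {p, q, r}" "card {p, q, r} = 3"
    using unimodular_triangle[OF assms] .
  then show ?thesis using lattice_points_triangle[OF T(2,3)] by simp
qed

lemma aff_dim_triangle: "T \<in> \<Delta> \<Longrightarrow> aff_dim T = 2"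
  using unimodular aff_dim_simplex by (auto simp: unimodular_triangulation_def)

text \<open>No triangle crosses a chord, so a triangle meeting \<open>M\<close> lies in its closure:
  segments from a point of \<open>M\<close> stay in \<open>M\<close> up to their last point. The
  closure is thus the hull of its lattice points, and \<open>T0\<close> gives it full
  dimension.\<close>

lemma lattice_polygon_chord_region:
  assumes ch: "chord a b" "chord c d" and T0: "T0 \<in> \<Delta>"
    and M: "M = P \<inter> {x. side a b x < 0} \<inter> {x. side c d x < 0}" and T0M: "T0 \<subseteq> closure M"
  shows "lattice_polygon (closure M)" "closure M \<subseteq> P"
    "\<And>x. x \<in> closure M \<Longrightarrow> side a b x \<le> 0" "\<And>x. x \<in> closure M \<Longrightarrow> side c d x \<le> 0"
proof -
  have "closed {x. side p q x \<le> 0}" for p q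
    unfolding side_def by (intro closed_Collect_le continuous_intros)
  moreover have "M \<subseteq> P" "M \<subseteq> {x. side a b x \<le> 0}" "M \<subseteq> {x. side c d x \<le> 0}" unfolding M by auto
  ultimately have cl: "closure M \<subseteq> {x. side a b x \<le> 0}" "closure M \<subseteq> {x. side c d x \<le> 0}"
    using closure_minimal by blast+
  show MP: "closure M \<subseteq> P" using \<open>M \<subseteq> P\<close> compact_imp_closed[OF compact_P] closure_minimal by blast
  show "\<And>x. x \<in> closure M \<Longrightarrow> side a b x \<le> 0" "\<And>x. x \<in> closure M \<Longrightarrow> side c d x \<le> 0"
    using cl by auto
  have tri: "T \<subseteq> closure M" if T: "T \<in> \<Delta>" "x \<in> T" "x \<in> M" for T x
  proof
    fix t assume t: "t \<in> T"
    have x_neg: "side a b x < 0" "side c d x < 0" using T(3) by (simp_all add: M)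
    have le: "side a b t \<le> 0" "side c d t \<le> 0"
      using chord_one_sided[OF ch(1) T(1)] chord_one_sided[OF ch(2) T(1)] T(2) t x_neg
      by (meson not_le)+
    show "t \<in> closure M"
    proof (cases "t = x")
      case True
      then show ?thesis using T(3) closure_subset by blast
    next
      case False
      have "open_segment x t \<subseteq> M"
      proof
        fix w assume "w \<in> open_segment x t"
        then obtain u where u: "0 < u" "u < 1" "w = (1 - u) *\<^sub>R x + u *\<^sub>R t" by (auto simp: in_segment)
        have "w \<in> P" unfolding u(3)
          using convexD[OF convex_P, of x t "1 - u" u] triangle_subset_P[OF T(1)] T(2) t u by auto
        moreover have "side a b w < 0" "side c d w < 0"
          using le x_neg u unfolding u(3)
          by (auto simp: side_convex_comb add_neg_nonpos mult_pos_neg mult_nonneg_nonpos)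
        ultimately show "w \<in> M" unfolding M by blast
      qed
      then have "closure (open_segment x t) \<subseteq> closure M" by (rule closure_mono)
      then show ?thesis using False by auto
    qed
  qed
  define V where "V = closure M \<inter> L"
  have finV: "finite V"
    by (rule finite_subset[OF _ finite_lattice_P]) (use MP in \<open>auto simp: V_def\<close>)
  have "M \<subseteq> convex hull V"
  proof
    fix x assume x: "x \<in> M"
    then obtain T where T: "T \<in> \<Delta>" "x \<in> T" using Union_\<Delta> \<open>M \<subseteq> P\<close> by blast
    have "T \<inter> L \<subseteq> V" using tri[OF T x] unfolding V_def by blast
    then have "convex hull (T \<inter> L) \<subseteq> convex hull V" by (rule hull_mono)
    then show "x \<in> convex hull V" using T triangle_hull_lattice by blast
  qed
  then have "closure M \<subseteq> convex hull V"
    using finite_imp_compact_convex_hull[OF finV] closure_minimal compact_imp_closed by blast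
  moreover have "convex hull V \<subseteq> closure M"
  proof (rule hull_minimal)
    show "V \<subseteq> closure M" by (auto simp: V_def)
    show "convex (closure M)" unfolding M by (intro convex_closure convex_Int convex_P convex_side_less)
  qed
  ultimately have hull: "closure M = convex hull V" by blast
  have VL: "V \<subseteq> L" by (simp add: V_def)
  have ad: "aff_dim (closure M) = 2"
    using aff_dim_subset[OF T0M] aff_dim_triangle[OF T0] aff_dim_le_DIM[of "closure M"] by simp
  show "lattice_polygon (closure M)"
    unfolding lattice_polygon_def by (intro conjI exI[of _ V] finV VL hull ad)
qed

end

context heavy_skeleton begin

lemma heavy_structure:
  obtains p w q where "chord p w" "chord q w" "e1 = {closed_segment p w}" "e2 = {closed_segment q w}"
    "v1 = convex hull {z, p, w}" "v2 = convex hull {z, q, w}" "v1 \<inter> L = {z, p, w}"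
    "closed_segment p w \<inter> closed_segment q w = {w}" "z \<noteq> w" "side p w z \<noteq> 0" "side q w z \<noteq> 0"
    "\<forall>y\<in>I. (side p w y / side p w z < 0 \<and> y = p + w - z) \<or> (side q w y / side q w z < 0 \<and> y = q + w - z)
      \<or> (\<exists>m\<le>2::nat. y = z - real m *\<^sub>R (w - z))"
proof -
  obtain p1 q1 where l1: "skeleton_lobe P \<Delta> K G e1 l1 v1 u1 p1 q1" and v1: "v1 = convex hull {z, p1, q1}"
    "v1 \<inter> L = {z, p1, q1}" "side p1 q1 z = -1" "{z, p1, q1} \<subseteq> L" using lobe1_obtain .
  obtain p2 q2 where l2: "skeleton_lobe P \<Delta> K G e2 l2 v2 u2 p2 q2" and v2: "v2 = convex hull {z, p2, q2}"
    "v2 \<inter> L = {z, p2, q2}" "side p2 q2 z = -1" "{z, p2, q2} \<subseteq> L" using lobe2_obtain .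
  interpret A: skeleton_lobe P \<Delta> K G e1 l1 v1 u1 p1 q1 by (rule l1)
  interpret B: skeleton_lobe P \<Delta> K G e2 l2 v2 u2 p2 q2 by (rule l2)
  note capA = A.lobe_cap[OF z v1(1,3,4)] and capB = B.lobe_cap[OF z v2(1,3,4)]
  have vv: "v1 \<in> \<Delta>" "v2 \<in> \<Delta>" "v1 \<noteq> v2" using A.uv B.uv edge_facts by blast+
  have zv: "z \<in> v1" "z \<in> v2" using v1(1) v2(1) by (simp_all add: hull_inc)
  \<comment> \<open>The positive genus of \<open>G3\<close> enters here; by
    \<open>cap_in_cone_beyond\<close>, \<open>y\<close> lies outside both cones.\<close>
  obtain y where y: "y \<in> I" "y \<noteq> z" "\<not> (side p1 q1 y > 0 \<or> side p2 q2 y > 0)"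
    using third_interior_point[of "\<lambda>y. side p1 q1 y > 0 \<or> side p2 q2 y > 0"]
      A.positive_point_region(1) B.positive_point_region(1) by blast
  have yP: "y \<in> P" "y \<in> L" "y \<in> interior P" using interior_latticeD[OF y(1)] by blast+
  have coneA: "side p1 q1 y > 0" if "y \<in> I" "y \<noteq> z" "in_cone z p1 q1 y" for y
    using cap_in_cone_beyond[OF capA(1) interior_latticeD(1,2)[OF that(1)] that(2,3)] v1(3) by simp
  have coneB: "side p2 q2 y > 0" if "y \<in> I" "y \<noteq> z" "in_cone z p2 q2 y" for y
    using cap_in_cone_beyond[OF capB(1) interior_latticeD(1,2)[OF that(1)] that(2,3)] v2(3) by simp
  have nz: "p1 \<noteq> z" "q1 \<noteq> z" "p2 \<noteq> z" "q2 \<noteq> z" using v1(3) v2(3) by auto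
  have inA: "p1 \<in> v1 \<inter> L" "q1 \<in> v1 \<inter> L" and inB: "p2 \<in> v2 \<inter> L" "q2 \<in> v2 \<inter> L"
    using v1(2) v2(2) by simp_all
  have "in_cone z p2 q2 p1 \<Longrightarrow> p1 \<in> {p2, q2}" "in_cone z p2 q2 q1 \<Longrightarrow> q1 \<in> {p2, q2}"
    using cone_vertex[OF capB(1) vv(2,1) vv(3)[symmetric] v2(1,2) inA(1) nz(1) zv(1)]
      cone_vertex[OF capB(1) vv(2,1) vv(3)[symmetric] v2(1,2) inA(2) nz(2) zv(1)] by blast+
  moreover have "\<not> in_cone z p1 q1 y" "\<not> in_cone z p2 q2 y" using coneA coneB y by blast+
  ultimately have "{p1, q1} \<inter> {p2, q2} \<noteq> {}"
    using caps_share_vertex[OF capA(1) capB(1) _ _ yP(1,2)] by blast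
  then obtain w where w: "w \<in> {p1, q1}" "w \<in> {p2, q2}" by blast
  obtain p where p: "p1 = p \<and> q1 = w \<or> p1 = w \<and> q1 = p" using w(1) by blast
  obtain q where q: "p2 = q \<and> q2 = w \<or> p2 = w \<and> q2 = q" using w(2) by blast
  have cap1: "cap P z p w" using capA(1) p cap_commute by metis
  have cap2: "cap P z q w" using capB(1) q cap_commute by metis
  have seg: "closed_segment p1 q1 = closed_segment p w" "closed_segment p2 q2 = closed_segment q w"
    using p q closed_segment_commute by metis+
  have tri: "v1 = convex hull {z, p, w}" "v2 = convex hull {z, q, w}" "v1 \<inter> L = {z, p, w}"
  proof -
    have "{z, p1, q1} = {z, p, w}" "{z, p2, q2} = {z, q, w}" using p q by auto
    then show "v1 = convex hull {z, p, w}" "v2 = convex hull {z, q, w}" "v1 \<inter> L = {z, p, w}"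
      using v1(1,2) v2(1) by simp_all
  qed
  have chords: "chord p w" "chord q w" using A.chord_ab B.chord_ab p q chord_commute by metis+
  have cone_eq: "in_cone z p1 q1 x \<longleftrightarrow> in_cone z p w x" "in_cone z p2 q2 x \<longleftrightarrow> in_cone z q w x" for x
    using p q in_cone_commute by metis+
  \<comment> \<open>After renaming, the endpoints of a chord may be exchanged; the quotient does not
    depend on their order.\<close>
  have pos: "side p1 q1 x > 0 \<longleftrightarrow> side p w x / side p w z < 0" "side p2 q2 x > 0 \<longleftrightarrow> side q w x / side q w z < 0" for x
    using p q v1(3) v2(3) side_swap[of w p] side_swap[of w q] by auto
  have sums: "p1 + q1 = p + w" "p2 + q2 = q + w" using p q by auto
  have pq: "p \<noteq> q" using tri(1,2) vv(3) by auto
  have "in_cone z p w q \<Longrightarrow> q \<in> {p, w}"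
    using cone_vertex[OF capA(1) vv v1(1,2), of q] inB nz zv(2) p q cone_eq(1) by blast
  then obtain k where k: "k \<ge> 0" "q = lattice_comb z p w (-1) (- k)"
    using adjacent_caps[OF cap1 cap2 pq] by blast
  have axis: "\<exists>m\<le>2::nat. x = z - real m *\<^sub>R (w - z)" if x: "x \<in> I" "\<not> side p1 q1 x > 0" "\<not> side p2 q2 x > 0" for x
  proof (cases "x = z")
    case True
    then show ?thesis by (intro exI[of _ 0]) simp
  next
    case False
    have "\<not> in_cone z p w x" "\<not> in_cone z q w x" using coneA coneB False x cone_eq by blast+
    then obtain m :: nat where m: "x = z - real m *\<^sub>R (w - z)"
      using adjacent_caps_axis[OF cap1 cap2 k interior_latticeD(3)[OF x(1)] interior_latticeD(2)[OF x(1)]] by blast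
    \<comment> \<open>It would be a second interior lattice point beyond the chord, besides
      \<open>(1, 1)\<close>.\<close>
    have "lattice_comb z p w 1 2 \<notin> interior P"
    proof
      assume int: "lattice_comb z p w 1 2 \<in> interior P"
      have "lattice_comb z p w 1 2 \<in> L"
        using cap1 by (auto simp: cap_def lattice_points_def lattice_comb_nth)
      then have I12: "lattice_comb z p w 1 2 \<in> I" using int by (simp add: interior_lattice_points_def)
      have D: "side z p w \<noteq> 0" using cap1 by (auto simp: cap_def)
      have "side p w z = side z p w" by (simp add: side_rotate)
      then have "side p w (lattice_comb z p w 1 2) / side p w z < 0"
        using D by (simp add: side_lattice_comb)
      then have "lattice_comb z p w 1 2 = p + w - z"
        using A.positive_interior_point_eq[OF z v1(1,3,4) I12] pos(1) sums by simp
      also have "\<dots> = lattice_comb z p w 1 1" by (simp add: lattice_comb_def algebra_simps)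
      finally show False using lattice_comb_inject(2)[OF D] by force
    qed
    then have "m \<le> 2" using cap_axis_bound[OF cap1 polygon] interior_latticeD(1)[OF x(1)] m by blast
    then show ?thesis using m by blast
  qed
  have seg_int: "closed_segment p w \<inter> closed_segment q w = {w}"
  proof -
    have D: "side z p w \<noteq> 0" using cap1 by (auto simp: cap_def)
    \<comment> \<open>\<open>p\<close> and \<open>q\<close> lie strictly on opposite sides of the
      line through \<open>z\<close> and \<open>w\<close>.\<close>
    have sq: "side w z q = - side z p w" unfolding k(2) side_lattice_comb by simp
    have sp: "side w z p = side z p w" by (simp add: side_rotate)
    have "x = w" if x: "x \<in> closed_segment p w" "x \<in> closed_segment q w" for x
    proof -
      obtain s where s: "0 \<le> s" "s \<le> 1" "x = (1 - s) *\<^sub>R p + s *\<^sub>R w" using x(1) unfolding closed_segment_def by auto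
      obtain t where t: "0 \<le> t" "t \<le> 1" "x = (1 - t) *\<^sub>R q + t *\<^sub>R w" using x(2) unfolding closed_segment_def by auto
      have "side w z x = (1 - s) * side z p w" unfolding s(3) by (simp add: side_convex_comb sp)
      moreover have "side w z x = - ((1 - t) * side z p w)" unfolding t(3) by (simp add: side_convex_comb sq)
      ultimately have "(2 - s - t) * side z p w = 0" by (simp add: algebra_simps)
      then have "s = 1" using D s t by auto
      then show ?thesis using s(3) by simp
    qed
    then show ?thesis by auto
  qed
  have zw: "z \<noteq> w" using nz w by auto
  have fin: "(side p w y / side p w z < 0 \<and> y = p + w - z) \<or> (side q w y / side q w z < 0 \<and> y = q + w - z)
      \<or> (\<exists>m\<le>2::nat. y = z - real m *\<^sub>R (w - z))" if yI: "y \<in> I" for y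
    using axis[OF yI] A.positive_interior_point_eq[OF z v1(1,3,4) yI] B.positive_interior_point_eq[OF z v2(1,3,4) yI]
      pos[of y] unfolding sums by blast
  have e12: "e1 = {closed_segment p w}" "e2 = {closed_segment q w}" using capA(4) capB(4) seg by simp_all
  have off: "side p w z \<noteq> 0" "side q w z \<noteq> 0"
    using cap1 cap2 side_rotate[of p w z] side_rotate[of q w z] by (auto simp: cap_def)
  show thesis
    using that[OF chords e12 tri seg_int zw off] fin by blast
qed

end

lemma heavy_skeleton_exists:
  fixes \<Delta> :: "(real^2) set set"
  assumes P: "lattice_polygon P" "unimodular_triangulation \<Delta> P" and G: "skeleton \<Delta> G"
    and heavy: "heavy_cycle_with_two_loops G C e1 e2 G3" and C: "dual_point P G C z"
  obtains K v1 v2 u1 u2 x1 x2 l1 l2 b f1 f2 vs es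
  where "heavy_skeleton P \<Delta> K G C e1 e2 G3 z v1 v2 u1 u2 x1 x2 l1 l2 b f1 f2 vs es"
proof -
  have "trivalent G" using heavy unfolding heavy_cycle_with_two_loops_def by (elim conjE)
  then obtain K where K: "trivalent_skeleton P \<Delta> K G" using trivalent_skeleton_exists[OF P G] by blast
  have Cz: "C = region_boundary G z" "z \<in> interior_lattice_points P" using C by (simp_all add: dual_point_def)
  obtain v1 v2 u1 u2 l1 l2 b f1 f2 x1 x2 vs es where H:
    "distinct [v1, v2, u1, u2]" "{v1, v2, u1, u2} \<subseteq> nodes G"
    "distinct [b, f1, f2, e1, e2, l1, l2]" "{b, f1, f2, e1, e2, l1, l2} \<subseteq> edges G"
    "ends G e1 = {v1, u1}" "ends G l1 = {u1}" "ends G e2 = {v2, u2}" "ends G l2 = {u2}"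
    "G3 = G\<lparr>nodes := nodes G - {v1, v2, u1, u2}, edges := edges G - {b, f1, f2, e1, e2, l1, l2}\<rparr>"
    "connected_graph G3" "graph_genus G3 > 0"
    "ends G b = {v1, v2}" "ends G f1 = {v1, x1}" "ends G f2 = {v2, x2}"
    "is_path G3 x1 vs es x2" "C = {b, f1, f2} \<union> set es"
    using heavy unfolding heavy_cycle_with_two_loops_def by (elim conjE exE) (rule that)
  have "heavy_skeleton P \<Delta> K G C e1 e2 G3 z v1 v2 u1 u2 x1 x2 l1 l2 b f1 f2 vs es"
    by (intro heavy_skeleton.intro heavy_skeleton_axioms.intro K H Cz)
  then show thesis by (rule that)
qed

context heavy_skeleton begin

lemma card_interior_lattice_points: "card I \<le> 5"
proof -
  obtain p w q where "\<forall>y\<in>I. (side p w y / side p w z < 0 \<and> y = p + w - z) \<or> (side q w y / side q w z < 0 \<and> y = q + w - z)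
      \<or> (\<exists>m\<le>2::nat. y = z - real m *\<^sub>R (w - z))"
    by (rule heavy_structure) (rule that)
  then have "I \<subseteq> {p + w - z, q + w - z} \<union> (\<lambda>m. z - real m *\<^sub>R (w - z)) ` {..2}" by blast
  then have "card I \<le> card ({p + w - z, q + w - z} \<union> (\<lambda>m. z - real m *\<^sub>R (w - z)) ` {..2})"
    by (intro card_mono) auto
  also have "\<dots> \<le> card {p + w - z, q + w - z} + card ((\<lambda>m. z - real m *\<^sub>R (w - z)) ` {..2})"
    by (rule card_Un_le)
  also have "\<dots> \<le> 2 + 3"
    using card_image_le[of "{..2::nat}" "\<lambda>m. z - real m *\<^sub>R (w - z)"] card_insert_le_m1[of 2 "{q + w - z}" "p + w - z"]
    by simp
  finally show ?thesis by simp
qed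

lemma heavy_component_structure:
  assumes s1: "split_edge P \<Delta> e1 s1" and s2: "split_edge P \<Delta> e2 s2"
    and P': "heavy_component P G G3 C (affine hull s1) (affine hull s2) P'"
  shows "card (interior_lattice_points P') \<le> 3"
    and "\<exists>w. s1 \<inter> s2 = {w} \<and> closed_segment z w \<in> triangulation_edges \<Delta> \<and>
          interior_lattice_points P' \<subseteq> affine hull (closed_segment z w)"
    and "hyperelliptic P'"
proof -
  obtain p w q where w: "chord p w" "chord q w" "e1 = {closed_segment p w}" "e2 = {closed_segment q w}"
    "v1 = convex hull {z, p, w}" "v2 = convex hull {z, q, w}" "v1 \<inter> L = {z, p, w}"
    "closed_segment p w \<inter> closed_segment q w = {w}" "z \<noteq> w" "side p w z \<noteq> 0" "side q w z \<noteq> 0"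
    and pts: "\<forall>y\<in>I. (side p w y / side p w z < 0 \<and> y = p + w - z) \<or> (side q w y / side q w z < 0 \<and> y = q + w - z)
      \<or> (\<exists>m\<le>2::nat. y = z - real m *\<^sub>R (w - z))"
    using heavy_structure .
  \<comment> \<open>The stems are singletons, so there is no choice for the split edges.\<close>
  have s: "s1 = closed_segment p w" "s2 = closed_segment q w"
    using s1 s2 w(3,4) by (simp_all add: split_edge_def)
  have v1: "v1 \<in> \<Delta>" "v1 \<in> nodes G" using edge_facts(19) nodes_subset(3) by blast+
  have zP: "z \<in> P" using interior_latticeD(3)[OF z] .
  \<comment> \<open>Each chord is oriented with \<open>z\<close> on its negative side, as
    \<open>half_plane_component\<close> requires.\<close>
  have orient: "\<exists>a b. chord a b \<and> affine hull (closed_segment p w) = {x. side a b x = 0} \<and> side a b z < 0 \<and>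
      (\<forall>y. side p w y / side p w z < 0 \<longrightarrow> side a b y > 0)"
    if "chord p w" "side p w z \<noteq> 0" for p w
  proof (cases "side p w z < 0")
    case True
    then show ?thesis
      using that affine_hull_segment_side[OF chord_midpoint(4)[OF that(1)]]
      by (intro exI[of _ p] exI[of _ w]) (auto simp: divide_less_0_iff)
  next
    case False
    then have "side w p z < 0" using that(2) side_swap[of w p z] by linarith
    then show ?thesis
      using that affine_hull_segment_side[OF chord_midpoint(4)[OF that(1)]] chord_commute side_swap[of w p]
      by (intro exI[of _ w] exI[of _ p]) (auto simp: divide_less_0_iff)
  qed
  obtain a1 b1 where ab1: "chord a1 b1" "affine hull s1 = {x. side a1 b1 x = 0}" "side a1 b1 z < 0"
    "\<And>y. side p w y / side p w z < 0 \<Longrightarrow> side a1 b1 y > 0"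
    using orient[OF w(1,10)] unfolding s by metis
  obtain a2 b2 where ab2: "chord a2 b2" "affine hull s2 = {x. side a2 b2 x = 0}" "side a2 b2 z < 0"
    "\<And>y. side q w y / side q w z < 0 \<Longrightarrow> side a2 b2 y > 0"
    using orient[OF w(2,11)] unfolding s by metis
  define M where "M = P \<inter> {x. side a1 b1 x < 0} \<inter> {x. side a2 b2 x < 0}"
  obtain C0 where C0: "C0 \<in> components (P - (affine hull s1 \<union> affine hull s2))" "P' = closure C0"
    and nodesP': "{T \<in> nodes G. T \<subseteq> P'} = nodes G3 \<union> \<Union>(ends G ` C)"
    using P' unfolding heavy_component_def by blast
  \<comment> \<open>\<open>v1\<close> is an end of the edge \<open>b\<close> of \<open>C\<close>, so
    \<open>P'\<close> contains it and with it \<open>z\<close>. This determines which component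
    \<open>P'\<close> comes from.\<close>
  have "v1 \<in> \<Union>(ends G ` C)" using in_C(1) ends_bf(1) by blast
  then have v1P': "v1 \<subseteq> P'" using nodesP' by blast
  have zv: "z \<in> v1" unfolding w(5) by (simp add: hull_inc)
  then have "z \<in> closure C0" using v1P' C0(2) by blast
  then have "C0 = M"
    unfolding M_def using half_plane_component[OF convex_P C0(1)[unfolded ab1(2) ab2(2)] _ ab1(3) ab2(3)] by blast
  then have P'M: "P' = closure M" using C0(2) by simp
  note R = lattice_polygon_chord_region[OF ab1(1) ab2(1) v1(1) M_def v1P'[unfolded P'M], folded P'M]
  have sub: "interior_lattice_points P' \<subseteq> (\<lambda>m. z - real m *\<^sub>R (w - z)) ` {..2}"
  proof
    fix y assume y: "y \<in> interior_lattice_points P'"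
    then have "y \<in> P'" "y \<in> I"
      using interior_subset[of P'] interior_mono[OF R(2)] by (auto simp: interior_lattice_points_def)
    moreover have "\<not> side p w y / side p w z < 0" "\<not> side q w y / side q w z < 0"
      using ab1(4)[of y] ab2(4)[of y] R(3,4)[OF \<open>y \<in> P'\<close>] by linarith+
    ultimately show "y \<in> (\<lambda>m. z - real m *\<^sub>R (w - z)) ` {..2}" using pts by blast
  qed
  have "card (interior_lattice_points P') \<le> card ((\<lambda>m. z - real m *\<^sub>R (w - z)) ` {..2})"
    using sub by (intro card_mono) auto
  then show "card (interior_lattice_points P') \<le> 3"
    using card_image_le[of "{..2::nat}" "\<lambda>m. z - real m *\<^sub>R (w - z)"] by simp
  have on_line: "interior_lattice_points P' \<subseteq> affine hull (closed_segment z w)"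
  proof
    fix y assume "y \<in> interior_lattice_points P'"
    then obtain m :: nat where "y = z - real m *\<^sub>R (w - z)" using sub by blast
    then have "y = (1 + real m) *\<^sub>R z + (- real m) *\<^sub>R w" by (simp add: algebra_simps)
    moreover have "1 + real m + - real m = 1" by simp
    ultimately have "y \<in> affine hull {z, w}" unfolding affine_hull_2 by blast
    then show "y \<in> affine hull (closed_segment z w)" by (simp add: segment_convex_hull)
  qed
  have "closed_segment z w edge_of v1"
    unfolding edge_iff[OF v1(1)] using w(7,9) by blast
  then have "closed_segment z w \<in> triangulation_edges \<Delta>" using v1(1) unfolding triangulation_edges_def by blast
  then show "\<exists>w. s1 \<inter> s2 = {w} \<and> closed_segment z w \<in> triangulation_edges \<Delta> \<and>
      interior_lattice_points P' \<subseteq> affine hull (closed_segment z w)"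
    using w(8) on_line unfolding s by blast
  have "aff_dim (affine hull (closed_segment z w)) = 1"
    using w(9) by (simp add: segment_convex_hull aff_dim_2)
  then show "hyperelliptic P'"
    unfolding hyperelliptic_def using R(1) on_line affine_affine_hull by blast
qed

end

theorem theorem14:
  fixes P :: "(real^2) set" and \<Delta> :: "(real^2) set set" and g :: nat
    and G G3 :: "((real^2) set, (real^2) set set) multigraph"
    and C :: "(real^2) set set set" and e1 e2 :: "(real^2) set set" and z :: "real^2"
  assumes "lattice_polygon P"
    and "card (interior_lattice_points P) = g"
    and "unimodular_triangulation \<Delta> P"
    and "skeleton \<Delta> G"
    and "heavy_cycle_with_two_loops G C e1 e2 G3"
    and "dual_point P G C z"
  shows "(\<forall>s1 s2 P'.
            split_edge P \<Delta> e1 s1 \<and> split_edge P \<Delta> e2 s2 \<and>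
            heavy_component P G G3 C (affine hull s1) (affine hull s2) P' \<longrightarrow>
              card (interior_lattice_points P') \<le> 3 \<and>
              (\<exists>w. s1 \<inter> s2 = {w} \<and> closed_segment z w \<in> triangulation_edges \<Delta> \<and>
                   interior_lattice_points P' \<subseteq> affine hull (closed_segment z w)) \<and>
              hyperelliptic P')
         \<and> g \<le> 5"
proof -
  obtain K v1 v2 u1 u2 x1 x2 l1 l2 b f1 f2 vs es
    where "heavy_skeleton P \<Delta> K G C e1 e2 G3 z v1 v2 u1 u2 x1 x2 l1 l2 b f1 f2 vs es"
    using heavy_skeleton_exists[OF assms(1,3-6)] .
  then interpret heavy_skeleton P \<Delta> K G C e1 e2 G3 z v1 v2 u1 u2 x1 x2 l1 l2 b f1 f2 vs es .
  have "g \<le> 5" using card_interior_lattice_points assms(2) by simp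
  then show ?thesis using heavy_component_structure by blast
qed

end
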